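(* For every real $x\geq 2$, $$\sum_{n\leq x} d_{4}(n) = C_1 x\log^3 x + C_2 x\log^2 x + C_3 x\log x + C_4 x + \vartheta\!\left(4.48\, x^{3/4}\log x\right),$$ where $$C_1=\tfrac{1}{6},\quad C_2=2\gamma-\tfrac12,\quad C_3=6\gamma^2-4\gamma-4\gamma_1+1,\quad C_4=4\gamma^3-6\gamma^2+4\gamma-12\gamma\gamma_1+4\gamma_1+2\gamma_2-1$$ (numerically $C_2=0.654\ldots$, $C_3=0.981\ldots$, $C_4=0.272\ldots$). Furthermore, for every real $x\geq 193$, $$\sum_{n\leq x} d_4(n)\leq \tfrac{1}{3}\,x\log^3 x.$$
   Context: For an integer $n\geq1$, $d_4(n)$ denotes the number of ordered ways of writing $n$ as a product $n=n_1n_2n_3n_4$ of four positive integers. $\log$ is the natural logarithm. $\gamma$ is Euler's constant, and $\gamma_1,\gamma_2$ are the Stieltjes constants, defined by the Laurent expansion $\zeta(s)=\frac{1}{s-1}+\sum_{k\geq0}\frac{(-1)^k}{k!}\gamma_k (s-1)^k$ (with $\gamma_0=\gamma$). The notation $\vartheta(y)$ denotes a quantity whose absolute value is at most $y$. *)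

theory Defs
  imports "HOL-Complex_Analysis.Complex_Analysis"
begin

definition d4 :: "nat \<Rightarrow> nat" where
  "d4 n = card {(a, b, c, d). a > 0 \<and> b > 0 \<and> c > 0 \<and> d > 0 \<and> a * b * c * d = n}"

text \<open>
  The Riemann zeta function, obtained from its Dirichlet series by analytic continuation.
  The continuation is taken to the punctured half-plane \<open>Re s > 0\<close>, \<open>s \<noteq> 1\<close>, which contains
  a punctured neighbourhood of the pole. That region is connected, so the values there are
  uniquely determined; values outside it are unspecified.
\<close>

definition zeta :: "complex \<Rightarrow> complex" where
  "zeta = (SOME f. f holomorphic_on ({s. Re s > 0} - {1}) \<and>
             (\<forall>s. Re s > 1 \<longrightarrow> f s = (\<Sum>n. of_nat (Suc n) powr (-s))))"

text \<open>
  The coefficient of \<open>(s - 1) ^ k\<close> in the Laurent expansion of \<open>zeta\<close> at 1 is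
  \<open>(-1) ^ k / k! * stieltjes k\<close>. The coefficients are real.
\<close>

definition stieltjes :: "nat \<Rightarrow> real" where
  "stieltjes k = Re ((-1) ^ k * fact k * fls_nth (laurent_expansion zeta 1) (int k))"

end

theory Submission
  imports Defs "HOL-Real_Asymp.Real_Asymp"
begin

text \<open>
  Write \<open>d2\<close> for the divisor function and \<open>D2\<close>, \<open>D4\<close> for the summatory functions of \<open>d2\<close> and \<open>d4\<close>. Since
  \<open>d4\<close> is the Dirichlet convolution of \<open>d2\<close> with itself, the hyperbola method with \<open>y = sqrt x\<close> gives
  \<open>D4 x = 2 * (\<Sum>n\<le>y. d2 n * D2 (x / n)) - D2 y ^ 2\<close>. Insert \<open>D2 t = t * ln t + (2 * \<gamma> - 1) * t + \<Delta> t\<close>.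
  The terms linear in \<open>\<Delta> y\<close> that come from partial summation and from \<open>D2 y ^ 2\<close> cancel, so the elementary
  bound \<open>\<bar>\<Delta> t\<bar> \<le> 1.1 * sqrt t\<close> yields an error below \<open>4.4 * x powr (3 / 4) * ln x\<close> once \<open>x \<ge> 60\<close>.

  The constants enter through the asymptotics of \<open>\<Sum>n\<le>z. d2 n / n\<close> and \<open>\<Sum>n\<le>z. d2 n * ln n / n\<close>, which the
  hyperbola method reduces to \<open>\<Sum>n\<le>z. ln n ^ k / n\<close> for \<open>k \<le> 2\<close>. Their constant terms are the Stieltjes
  constants because \<open>(s - 1) * \<zeta> s\<close> is the locally uniform limit of \<open>(s - 1) * (\<Sum>n\<le>N. n powr -s) + N powr (1 - s)\<close>,
  whose derivatives at 1 are explicit. The remaining bounded ranges of \<open>x\<close> are checked on finitely many intervals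
  on which monotonicity reduces the claim to one numerical inequality.
\<close>

section \<open>Partial summation\<close>

text \<open>Since \<open>zeta\<close> is a \<open>SOME\<close>-choice, \<open>stieltjes\<close>
  carries no numerical information at first: the constants have to be identified as limits, both to
  recognise them in the main term and to enclose them numerically. The weighted sums of
  \<open>d2\<close> are expanded only at squares \<open>w * w\<close> of integers, where the
  hyperbola method has integral ranges. This suffices, because Abel summation controls the remainder
  between any two real points, so a limit along one sequence fixes its constant. The cancellation
  decides the size of the constant. Each of the two cancelling terms is
  \<open>2 * D2_main y * E y\<close> up to sign, with \<open>E\<close> the error of
  \<open>D2\<close>; it has the order of the final error, and bounding both separately would add
  about 2.2 to its coefficient. What remains at that order is 2 * 1.1 from the tail of the partial
  summation and 2 * 1.1 from the errors of \<open>D2 (x / n)\<close>, hence 4.4. These two also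
  carry a negative contribution proportional to \<open>x powr (3 / 4)\<close>, which pays for all
  terms of order sqrt x * ln x.\<close>

definition pos_upto :: "real \<Rightarrow> nat set" where
  "pos_upto t = {n. 1 \<le> n \<and> real n \<le> t}"

definition summatory :: "(nat \<Rightarrow> real) \<Rightarrow> real \<Rightarrow> real" where
  "summatory a t = (\<Sum>n\<in>pos_upto t. a n)"

lemma pos_upto_eq: "0 \<le> t \<Longrightarrow> pos_upto t = {1..nat \<lfloor>t\<rfloor>}"
  unfolding pos_upto_def by (auto simp: le_nat_floor nat_le_iff) linarith

lemma pos_upto_eq_step: "real k \<le> t \<Longrightarrow> t < real k + 1 \<Longrightarrow> pos_upto t = {1..k}"
  unfolding pos_upto_def by auto

lemma pos_upto_of_nat [simp]: "pos_upto (real k) = {1..k}"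
  by (rule pos_upto_eq_step) auto

lemma finite_pos_upto [simp, intro]: "finite (pos_upto t)"
proof -
  have "pos_upto t \<subseteq> {..nat \<lfloor>t\<rfloor>}"
    unfolding pos_upto_def by (auto simp: le_nat_floor)
  thus ?thesis using finite_subset by blast
qed

lemma pos_upto_iff: "n \<in> pos_upto t \<longleftrightarrow> 1 \<le> n \<and> real n \<le> t"
  by (simp add: pos_upto_def)

lemma pos_upto_mono: "s \<le> t \<Longrightarrow> pos_upto s \<subseteq> pos_upto t"
  by (auto simp: pos_upto_def)

text \<open>Meant for a smooth approximation \<open>M\<close> of the summatory function of
  \<open>a\<close> and an antiderivative \<open>F\<close> of \<open>f\<close> times the derivative
  of \<open>M\<close>. The boundary term \<open>f t * (summatory a t - M t)\<close> is also taken
  out: its jumps would spoil continuity, and it is the term that cancels in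
  \<open>D4_error_bound_explicit\<close>.\<close>

definition abel_rest ::
  "(nat \<Rightarrow> real) \<Rightarrow> (real \<Rightarrow> real) \<Rightarrow> (real \<Rightarrow> real) \<Rightarrow> (real \<Rightarrow> real) \<Rightarrow> real \<Rightarrow> real" where
  "abel_rest a f F M t =
     summatory (\<lambda>n. a n * f (real n)) t - F t - f t * (summatory a t - M t)"

text \<open>Extending the sum to the fixed range \<open>n \<le> z\<close> by \<open>f (max n t)\<close> shows that the remainder
  is continuous in \<open>t\<close>; off the integers its derivative is \<open>- f' t * (A t - M t)\<close>.\<close>

lemma abel_rest_diff_le:
  fixes a :: "nat \<Rightarrow> real" and f f' F M m G g :: "real \<Rightarrow> real"
  assumes yz: "y \<le> z"
    and f: "\<And>t. y \<le> t \<Longrightarrow> t \<le> z \<Longrightarrow> (f has_real_derivative f' t) (at t)"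
    and M: "\<And>t. y \<le> t \<Longrightarrow> t \<le> z \<Longrightarrow> (M has_real_derivative m t) (at t)"
    and F: "\<And>t. y \<le> t \<Longrightarrow> t \<le> z \<Longrightarrow> (F has_real_derivative f t * m t) (at t)"
    and G: "\<And>t. y \<le> t \<Longrightarrow> t \<le> z \<Longrightarrow> (G has_real_derivative g t) (at t)"
    and bound: "\<And>t. y \<le> t \<Longrightarrow> t \<le> z \<Longrightarrow> \<bar>f' t\<bar> * \<bar>summatory a t - M t\<bar> \<le> g t"
  shows "\<bar>abel_rest a f F M z - abel_rest a f F M y\<bar> \<le> G z - G y"
proof -
  define R where "R = (\<lambda>t. (\<Sum>n\<in>pos_upto z. a n * (f (real n) - f (max (real n) t))) - F t + f t * M t)"
  define r where "r = (\<lambda>t. - (f' t * (summatory a t - M t)))"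
  define S where "S = real ` pos_upto z"
  have R_eq: "abel_rest a f F M t = R t" if t: "t \<le> z" for t
  proof -
    have "(\<Sum>n\<in>pos_upto z. a n * (f (real n) - f (max (real n) t)))
        = (\<Sum>n\<in>pos_upto t. a n * (f (real n) - f (max (real n) t)))"
      using t by (intro sum.mono_neutral_right pos_upto_mono) (auto simp: pos_upto_iff max_def)
    also have "\<dots> = (\<Sum>n\<in>pos_upto t. a n * f (real n) - f t * a n)"
      by (intro sum.cong) (auto simp: pos_upto_iff max_def algebra_simps)
    finally show ?thesis
      by (simp add: abel_rest_def R_def summatory_def sum_subtractf sum_distrib_left algebra_simps)
  qed
  have cont: "continuous_on {y..z} R"
  proof -
    have fc: "continuous_on {y..z} f" using f by (intro DERIV_continuous_on) (auto intro: has_field_derivative_at_within)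
    have Fc: "continuous_on {y..z} F" using F by (intro DERIV_continuous_on) (auto intro: has_field_derivative_at_within)
    have Mc: "continuous_on {y..z} M" using M by (intro DERIV_continuous_on) (auto intro: has_field_derivative_at_within)
    have "continuous_on {y..z} (\<lambda>t. f (max (real n) t))" if "n \<in> pos_upto z" for n
      by (rule continuous_on_compose2[OF fc]) (use that in \<open>auto intro!: continuous_intros simp: pos_upto_iff\<close>)
    thus ?thesis unfolding R_def
      by (intro continuous_intros fc Fc Mc) auto
  qed
  have der: "(R has_vector_derivative r t) (at t)" if t: "t \<in> {y<..<z} - S" for t
  proof -
    have t': "y \<le> t" "t \<le> z" using t by auto
    have d1: "((\<lambda>t. a n * (f (real n) - f (max (real n) t))) has_real_derivative
            (if real n \<le> t then - (a n * f' t) else 0)) (at t)" if n: "n \<in> pos_upto z" for n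
    proof (cases "real n \<le> t")
      case True
      hence lt: "real n < t" using t n by (auto simp: S_def less_le)
      have "((\<lambda>t. a n * (f (real n) - f t)) has_real_derivative - (a n * f' t)) (at t)"
        by (auto intro!: derivative_eq_intros f t')
      hence "((\<lambda>t. a n * (f (real n) - f (max (real n) t))) has_real_derivative - (a n * f' t)) (at t)"
        by (rule DERIV_cong_ev[THEN iffD1, rotated 3])
           (use lt in \<open>auto intro!: eventually_mono[OF eventually_nhds_in_open[of "{real n<..}" t]] simp: max_def\<close>)
      thus ?thesis using True by simp
    next
      case False
      have "((\<lambda>t. 0) has_real_derivative 0) (at t)" by simp
      hence "((\<lambda>t. a n * (f (real n) - f (max (real n) t))) has_real_derivative 0) (at t)"
        by (rule DERIV_cong_ev[THEN iffD1, rotated 3])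
           (use False in \<open>auto intro!: eventually_mono[OF eventually_nhds_in_open[of "{..<real n}" t]] simp: max_def\<close>)
      thus ?thesis using False by simp
    qed
    have "(\<Sum>n\<in>pos_upto z. (if real n \<le> t then - (a n * f' t) else 0))
        = (\<Sum>n\<in>pos_upto t. (if real n \<le> t then - (a n * f' t) else 0))"
      using t' by (intro sum.mono_neutral_right pos_upto_mono) (auto simp: pos_upto_iff)
    also have "\<dots> = - (f' t * summatory a t)"
      unfolding summatory_def sum_distrib_left sum_negf[symmetric]
      by (intro sum.cong) (auto simp: pos_upto_iff)
    finally have s: "(\<Sum>n\<in>pos_upto z. (if real n \<le> t then - (a n * f' t) else 0)) = - (f' t * summatory a t)" .
    have "(R has_real_derivative ((\<Sum>n\<in>pos_upto z. (if real n \<le> t then - (a n * f' t) else 0))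
            - f t * m t + (f' t * M t + m t * f t))) (at t)"
      unfolding R_def by (intro DERIV_add DERIV_diff DERIV_sum DERIV_mult d1 F f M t')
    hence "(R has_real_derivative r t) (at t)"
      unfolding s r_def by (simp add: algebra_simps)
    thus ?thesis by (simp add: has_real_derivative_iff_has_vector_derivative)
  qed
  \<comment> \<open>The integers up to \<open>z\<close> form a finite exceptional set; across them
    the fundamental theorem asks only for continuity of \<open>R\<close>.\<close>
  have I1: "(r has_integral (R z - R y)) {y..z}"
    by (rule fundamental_theorem_of_calculus_interior_strong[where S = S])
       (use yz cont der in \<open>auto simp: S_def\<close>)
  have I2: "(g has_integral (G z - G y)) {y..z}"
    by (rule fundamental_theorem_of_calculus)
       (use yz G in \<open>auto simp: has_real_derivative_iff_has_vector_derivative[symmetric] intro: has_field_derivative_at_within\<close>)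
  have b: "r t \<le> g t" "- r t \<le> g t" if "t \<in> {y..z}" for t
  proof -
    have "\<bar>r t\<bar> \<le> g t" using bound[of t] that by (simp add: r_def abs_mult)
    thus "r t \<le> g t" "- r t \<le> g t" by linarith+
  qed
  have "R z - R y \<le> G z - G y" using has_integral_le[OF I1 I2] b by blast
  moreover have "- (R z - R y) \<le> G z - G y" using has_integral_le[OF has_integral_neg[OF I1] I2] b by blast
  ultimately show ?thesis using R_eq[of z] R_eq[of y] yz by auto
qed

section \<open>The Stieltjes constants as limits\<close>

text \<open>For \<open>N > 0\<close> this is 1 + (s - 1) * (sum of n^(-s) for n up to N, minus the
  integral of t^(-s) from 1 to N). Subtracting the integral gives convergence for Re s > 0, and the
  factor \<open>s - 1\<close> removes the pole.\<close>

definition zeta_reg_partial :: "nat \<Rightarrow> complex \<Rightarrow> complex" where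
  "zeta_reg_partial N s =
     (s - 1) * (\<Sum>n=1..N. of_nat n powr (-s)) + of_nat N powr (1 - s)"

text \<open>The mean value inequality is used twice on the segment from \<open>N\<close> to
  \<open>N + 1\<close>: for \<open>z powr (-s)\<close>, and for an auxiliary function whose
  derivative is a multiple of \<open>z powr (-s) - b powr (-s)\<close>. The exponent gained is
  summable for every Re s > 0.\<close>

lemma norm_zeta_reg_increment_le:
  fixes s :: complex
  assumes s: "Re s > 0" and N: "N > 0"
  shows "norm (zeta_reg_partial (Suc N) s - zeta_reg_partial N s)
           \<le> norm s * norm (1 - s) * real N powr (- Re s - 1)"
proof -
  define S where "S = (of_real :: real \<Rightarrow> complex) ` {real N..real N + 1}"
  have conv: "convex S"
    unfolding S_def by (intro convex_linear_image bounded_linear.linear[OF bounded_linear_of_real]) auto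
  define b where "b = (of_nat (Suc N) :: complex)"
  have bS: "b \<in> S" and aS: "of_nat N \<in> S"
    unfolding S_def b_def by (auto intro: image_eqI[of _ _ "real N + 1"] image_eqI[of _ _ "real N"])
  have nonneg: "z \<notin> \<real>\<^sub>\<le>\<^sub>0" if "z \<in> S" for z
    using that N by (auto simp: S_def)
  have dist: "norm (z - b) \<le> 1" if zS: "z \<in> S" for z
  proof -
    obtain t where t: "z = of_real t" "t \<in> {real N..real N + 1}" using zS by (auto simp: S_def)
    have "z - b = of_real (t - real N - 1)" by (simp add: t b_def)
    hence "norm (z - b) = \<bar>t - real N - 1\<bar>" by (simp only: norm_of_real)
    thus ?thesis using t(2) by auto
  qed
  have d1: "norm (z powr (-s) - b powr (-s)) \<le> norm s * real N powr (- Re s - 1)" if zS: "z \<in> S" for z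
  proof -
    have "norm (z powr (-s) - b powr (-s)) \<le> (norm s * real N powr (- Re s - 1)) * norm (z - b)"
    proof (rule field_differentiable_bound[OF conv _ _ zS bS])
      fix w assume w: "w \<in> S"
      show "((\<lambda>z. z powr (-s)) has_field_derivative (-s) * w powr (-s - 1)) (at w within S)"
        by (rule has_field_derivative_at_within[OF has_field_derivative_powr[OF nonneg[OF w]]])
      obtain t where t: "w = of_real t" "t \<ge> real N" using w by (auto simp: S_def)
      have "norm (w powr (-s - 1)) = t powr (- Re s - 1)"
        using t N by (simp add: norm_powr_real_powr)
      also have "\<dots> \<le> real N powr (- Re s - 1)"
        using t N s by (intro powr_mono2') auto
      finally show "norm (- s * w powr (- s - 1)) \<le> norm s * real N powr (- Re s - 1)"
        by (simp add: norm_mult mult_left_mono)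
    qed
    also have "\<dots> \<le> (norm s * real N powr (- Re s - 1)) * 1"
      using dist[OF zS] by (intro mult_left_mono) auto
    finally show ?thesis by simp
  qed
  \<comment> \<open>The linear term is chosen so that the derivative vanishes at \<open>b\<close>,
    while the difference of the values at \<open>b\<close> and \<open>N\<close> is exactly the
    increment.\<close>
  define \<phi> where "\<phi> = (\<lambda>z. z powr (1 - s) - (1 - s) * b powr (-s) * z)"
  have "norm (\<phi> b - \<phi> (of_nat N)) \<le> (norm (1 - s) * (norm s * real N powr (- Re s - 1))) * norm (b - of_nat N)"
  proof (rule field_differentiable_bound[OF conv _ _ bS aS])
    fix w assume w: "w \<in> S"
    have "(\<phi> has_field_derivative (1 - s) * w powr (1 - s - 1) - (1 - s) * b powr (-s) * 1) (at w)"
      unfolding \<phi>_def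
      by (rule DERIV_diff[OF has_field_derivative_powr[OF nonneg[OF w]] DERIV_cmult[OF DERIV_ident]])
    moreover have "(1 - s) * w powr (1 - s - 1) - (1 - s) * b powr (-s) * 1
        = (1 - s) * (w powr (-s) - b powr (-s))"
      by (simp add: right_diff_distrib)
    ultimately show "(\<phi> has_field_derivative (1 - s) * (w powr (-s) - b powr (-s))) (at w within S)"
      by (metis has_field_derivative_at_within)
    show "norm ((1 - s) * (w powr (-s) - b powr (-s))) \<le> norm (1 - s) * (norm s * real N powr (- Re s - 1))"
      using d1[OF w] by (simp add: norm_mult mult_left_mono)
  qed
  also have "\<phi> b - \<phi> (of_nat N) = zeta_reg_partial (Suc N) s - zeta_reg_partial N s"
    by (simp add: zeta_reg_partial_def \<phi>_def b_def algebra_simps)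
  also have "norm (b - of_nat N) = 1" by (simp add: b_def)
  finally show ?thesis by (simp add: mult_ac)
qed

text \<open>The limit of the partial expressions, written as a telescoping series so that the
  Weierstrass M-test applies. Away from 1 it turns out to be
  \<open>(s - 1) * zeta s\<close>.\<close>

definition zeta_reg :: "complex \<Rightarrow> complex" where
  "zeta_reg s = zeta_reg_partial 1 s +
     (\<Sum>N. zeta_reg_partial (Suc (Suc N)) s - zeta_reg_partial (Suc N) s)"

lemma zeta_reg_partial_telescope:
  "zeta_reg_partial (Suc N) s = zeta_reg_partial 1 s +
     (\<Sum>k<N. zeta_reg_partial (Suc (Suc k)) s - zeta_reg_partial (Suc k) s)"
  by (induction N) auto

text \<open>The increment bound grows like \<open>norm s * norm (1 - s)\<close>, so a bound
  \<open>B\<close> on the modulus is needed besides the distance from the imaginary axis.\<close>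

lemma uniform_limit_zeta_reg:
  assumes "\<sigma> > 0"
  shows "uniform_limit {s. Re s > \<sigma> \<and> norm s < B}
           (\<lambda>N. zeta_reg_partial (Suc N)) zeta_reg sequentially"
proof -
  have "summable (\<lambda>n. real n powr (- \<sigma> - 1))"
    using assms by (subst summable_real_powr_iff) auto
  hence "summable (\<lambda>n. B * (1 + B) * real (Suc n) powr (- \<sigma> - 1))"
    by (intro summable_mult) (rule summable_Suc_iff[THEN iffD2])
  moreover have "norm (zeta_reg_partial (Suc (Suc n)) s - zeta_reg_partial (Suc n) s)
       \<le> B * (1 + B) * real (Suc n) powr (- \<sigma> - 1)" if s: "Re s > \<sigma>" "norm s < B" for n s
  proof -
    have "norm (zeta_reg_partial (Suc (Suc n)) s - zeta_reg_partial (Suc n) s)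
        \<le> norm s * norm (1 - s) * real (Suc n) powr (- Re s - 1)"
      using assms s by (intro norm_zeta_reg_increment_le) auto
    also have "\<dots> \<le> B * (1 + B) * real (Suc n) powr (- \<sigma> - 1)"
    proof (intro mult_mono powr_mono)
      show "norm (1 - s) \<le> 1 + B" using norm_triangle_ineq4[of 1 s] s by simp
    qed (use s assms order.strict_trans1[OF norm_ge_zero s(2)] in auto)
    finally show ?thesis .
  qed
  ultimately have lim: "uniform_limit {s. Re s > \<sigma> \<and> norm s < B}
     (\<lambda>N s. \<Sum>k<N. zeta_reg_partial (Suc (Suc k)) s - zeta_reg_partial (Suc k) s)
     (\<lambda>s. \<Sum>k. zeta_reg_partial (Suc (Suc k)) s - zeta_reg_partial (Suc k) s) sequentially"
    by (intro Weierstrass_m_test_ev[where M = "\<lambda>n. B * (1 + B) * real (Suc n) powr (- \<sigma> - 1)"]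
          always_eventually allI ballI) blast+
  have "uniform_limit {s. Re s > \<sigma> \<and> norm s < B}
     (\<lambda>N s. zeta_reg_partial 1 s + (\<Sum>k<N. zeta_reg_partial (Suc (Suc k)) s - zeta_reg_partial (Suc k) s))
     (\<lambda>s. zeta_reg_partial 1 s + (\<Sum>k. zeta_reg_partial (Suc (Suc k)) s - zeta_reg_partial (Suc k) s)) sequentially"
    by (intro uniform_limit_add uniform_limit_const lim)
  thus ?thesis
    unfolding zeta_reg_def zeta_reg_partial_telescope[symmetric] .
qed

lemma open_half_plane_ball: "open {s. Re s > \<sigma> \<and> norm s < B}"
  by (intro open_Collect_conj open_halfspace_Re_gt open_Collect_less continuous_intros)

lemma holomorphic_zeta_reg_partial: "zeta_reg_partial (Suc N) holomorphic_on A"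
  unfolding zeta_reg_partial_def by (intro holomorphic_intros) auto

lemma holomorphic_zeta_reg: "zeta_reg holomorphic_on {s. Re s > 0}"
proof (rule holomorphic_uniform_sequence)
  show "open {s. Re s > 0}" by (rule open_halfspace_Re_gt)
  show "zeta_reg_partial (Suc N) holomorphic_on {s. Re s > 0}" for N
    by (rule holomorphic_zeta_reg_partial)
  fix z assume z: "z \<in> {s. Re s > 0}"
  define U where "U = {s. Re s > Re z / 2 \<and> norm s < norm z + 1}"
  have "open U" unfolding U_def by (rule open_half_plane_ball)
  moreover have "z \<in> U" using z by (simp add: U_def)
  ultimately obtain d where d: "d > 0" "cball z d \<subseteq> U" by (meson open_contains_cball)
  have "uniform_limit U (\<lambda>N. zeta_reg_partial (Suc N)) zeta_reg sequentially"
    unfolding U_def using z by (intro uniform_limit_zeta_reg) auto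
  hence "uniform_limit (cball z d) (\<lambda>N. zeta_reg_partial (Suc N)) zeta_reg sequentially"
    by (rule uniform_limit_on_subset) (use d in auto)
  moreover have "cball z d \<subseteq> {s. Re s > 0}" using d(2) z by (auto simp: U_def)
  ultimately show "\<exists>d>0. cball z d \<subseteq> {s. Re s > 0} \<and>
      uniform_limit (cball z d) (\<lambda>n. zeta_reg_partial (Suc n)) zeta_reg sequentially"
    using d by blast
qed

lemma zeta_reg_tendsto:
  assumes "Re s > 0"
  shows "(\<lambda>N. zeta_reg_partial (Suc N) s) \<longlonglongrightarrow> zeta_reg s"
  by (rule tendsto_uniform_limitI[OF uniform_limit_zeta_reg[of "Re s / 2" "norm s + 1"]])
     (use assms in auto)

text \<open>For Re s > 1 the correction \<open>of_nat N powr (1 - s)\<close> tends to 0, leaving the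
  Dirichlet series.\<close>

lemma zeta_reg_eq_suminf:
  assumes s: "Re s > 1"
  shows "zeta_reg s / (s - 1) = (\<Sum>n. of_nat (Suc n) powr (-s))"
proof -
  have "(\<lambda>N. complex_of_real (real (Suc N)) powr (1 - s)) \<longlonglongrightarrow> 0"
  proof (rule tendsto_norm_zero_cancel)
    have "(\<lambda>N. real (Suc N) powr (1 - Re s)) \<longlonglongrightarrow> 0"
      using s by (intro tendsto_neg_powr filterlim_compose[OF filterlim_real_sequentially filterlim_Suc]) auto
    thus "(\<lambda>N. norm (complex_of_real (real (Suc N)) powr (1 - s))) \<longlonglongrightarrow> 0"
      by (simp add: norm_powr_real_powr)
  qed
  hence "(\<lambda>N. (of_nat (Suc N) :: complex) powr (1 - s)) \<longlonglongrightarrow> 0" by simp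
  hence "(\<lambda>N. (zeta_reg_partial (Suc N) s - of_nat (Suc N) powr (1 - s)) / (s - 1)) \<longlonglongrightarrow> (zeta_reg s - 0) / (s - 1)"
    using s by (intro tendsto_divide tendsto_diff zeta_reg_tendsto tendsto_const) auto
  also have "(\<lambda>N. (zeta_reg_partial (Suc N) s - of_nat (Suc N) powr (1 - s)) / (s - 1))
     = (\<lambda>N. \<Sum>n=1..Suc N. of_nat n powr (-s))"
  proof -
    have "s - 1 \<noteq> 0" using s by auto
    thus ?thesis by (simp add: zeta_reg_partial_def del: sum.cl_ivl_Suc)
  qed
  also have "\<dots> = (\<lambda>N. \<Sum>n<Suc N. of_nat (Suc n) powr (-s))"
    by (rule ext, rule sum.reindex_bij_witness[of _ Suc "\<lambda>n. n - 1"]) auto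
  finally have "(\<lambda>n. of_nat (Suc n) powr (-s)) sums (zeta_reg s / (s - 1))"
    unfolding sums_def by (subst filterlim_sequentially_Suc[symmetric]) simp
  thus ?thesis by (simp add: sums_iff)
qed

text \<open>The quotient on the right witnesses that the choice defining \<open>zeta\<close> is not
  vacuous, so \<open>zeta\<close> meets its specification. The identity theorem on the connected
  punctured half-plane then forces agreement.\<close>

lemma zeta_eq_zeta_reg:
  assumes s: "Re s > 0" "s \<noteq> 1"
  shows "zeta s = zeta_reg s / (s - 1)"
proof -
  define A where "A = {s. Re s > 0} - {1}"
  define Z where "Z = (\<lambda>s. zeta_reg s / (s - 1))"
  define P where "P = (\<lambda>f. f holomorphic_on A \<and> (\<forall>s. Re s > 1 \<longrightarrow> f s = (\<Sum>n. of_nat (Suc n) powr (-s))))"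
  have holZ: "Z holomorphic_on A"
    unfolding Z_def A_def
    by (intro holomorphic_intros holomorphic_on_subset[OF holomorphic_zeta_reg]) auto
  hence "P Z" using zeta_reg_eq_suminf by (auto simp: P_def Z_def)
  hence "P zeta" unfolding zeta_def P_def A_def by (rule someI[of _ Z])
  have opA: "open A" unfolding A_def by (intro open_Diff open_halfspace_Re_gt) auto
  have "connected A" unfolding A_def
    by (intro connected_open_delete open_halfspace_Re_gt convex_connected convex_halfspace_Re_gt) auto
  have "zeta s - Z s = 0"
  proof (rule analytic_continuation[of "\<lambda>s. zeta s - Z s" A "{s. Re s > 1}" 2 s])
    show "(\<lambda>s. zeta s - Z s) holomorphic_on A"
      using \<open>P zeta\<close> holZ by (intro holomorphic_intros) (auto simp: P_def)
    show "2 islimpt {s. Re s > 1}"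
      by (intro interior_limit_point) (auto simp: interior_open open_halfspace_Re_gt)
    show "zeta z - Z z = 0" if "z \<in> {s. Re s > 1}" for z
      using \<open>P zeta\<close> \<open>P Z\<close> that by (auto simp: P_def)
  qed (use s opA \<open>connected A\<close> in \<open>auto simp: A_def\<close>)
  thus ?thesis by (simp add: Z_def)
qed

lemma laurent_expansion_zeta:
  "laurent_expansion zeta 1 = fls_shift 1 (fps_to_fls (fps_expansion zeta_reg 1))"
proof (rule laurent_expansion_eqI)
  have "zeta_reg analytic_on {s. Re s > 0}"
    using holomorphic_zeta_reg open_halfspace_Re_gt by (simp add: analytic_on_open)
  hence "zeta_reg analytic_on {1}" by (rule analytic_on_subset) auto
  hence "(\<lambda>x. zeta_reg (1 + x)) has_fps_expansion fps_expansion zeta_reg 1"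
    by (rule analytic_at_imp_has_fps_expansion)
  hence "(\<lambda>x. zeta_reg (1 + x) * x powi (-1)) has_laurent_expansion
           fls_shift 1 (fps_to_fls (fps_expansion zeta_reg 1))"
    by (intro has_laurent_expansion_shift' has_laurent_expansion_fps)
  also have "?this \<longleftrightarrow> (\<lambda>x. zeta (1 + x)) has_laurent_expansion
           fls_shift 1 (fps_to_fls (fps_expansion zeta_reg 1))"
  proof (intro has_laurent_expansion_cong refl)
    have "eventually (\<lambda>x. x \<in> ball 0 1 - {0}) (at (0::complex))"
      by (intro eventually_at_in_open) auto
    thus "eventually (\<lambda>x. zeta_reg (1 + x) * x powi (-1) = zeta (1 + x)) (at 0)"
    proof eventually_elim
      case (elim x)
      hence "Re (1 + x) > 0" using abs_Re_le_cmod[of x] by auto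
      thus ?case using elim by (subst zeta_eq_zeta_reg) (auto simp: field_simps)
    qed
  qed
  finally show "(\<lambda>x. zeta (1 + x)) has_laurent_expansion
           fls_shift 1 (fps_to_fls (fps_expansion zeta_reg 1))" .
qed

text \<open>Division by \<open>s - 1\<close> shifts indices: coefficient \<open>k\<close> of
  \<open>zeta\<close> is Taylor coefficient \<open>k + 1\<close> of \<open>zeta_reg\<close>, and
  \<open>fact k / fact (k + 1)\<close> leaves the denominator.\<close>

lemma stieltjes_eq: "stieltjes k = Re ((-1) ^ k * (deriv ^^ Suc k) zeta_reg 1 / of_nat (Suc k))"
  unfolding stieltjes_def laurent_expansion_zeta
  by (simp add: fps_expansion_def nat_add_distrib del: funpow.simps)

text \<open>Leibniz rule with a linear factor \<open>s - 1\<close>, of which only two terms survive.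
  For \<open>j = 0\<close> the truncated exponent \<open>j - 1\<close> is harmless, since its term
  has the factor \<open>of_nat j\<close>.\<close>

lemma higher_deriv_zeta_reg_partial:
  "(deriv ^^ j) (zeta_reg_partial (Suc N)) =
     (\<lambda>s. (s - 1) * (\<Sum>n=1..Suc N. of_real ((- ln (real n)) ^ j) * of_nat n powr (-s))
        + of_nat j * (\<Sum>n=1..Suc N. of_real ((- ln (real n)) ^ (j - 1)) * of_nat n powr (-s))
        + of_real ((- ln (real (Suc N))) ^ j) * of_nat (Suc N) powr (1 - s))"
proof (induction j)
  case 0
  show ?case by (auto simp: zeta_reg_partial_def)
next
  case (Suc j)
  have pw: "((\<lambda>s. of_nat n powr (c - s)) has_field_derivative
              of_real (- ln (real n)) * of_nat n powr (c - s)) (at s)" if "n > 0" for n and c s :: complex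
  proof -
    have eq: "(\<lambda>s. (of_nat n :: complex) powr (c - s)) = (\<lambda>s. exp ((c - s) * of_real (ln (real n))))"
      using that by (auto simp: powr_def Ln_of_nat)
    show ?thesis unfolding eq
      using that by (auto intro!: derivative_eq_intros simp: powr_def Ln_of_nat)
  qed
  show ?case
  proof
    fix s :: complex
    define T where "T = (\<lambda>j s. \<Sum>n=1..Suc N. of_real ((- ln (real n)) ^ j) * (of_nat n :: complex) powr (-s))"
    have T: "(T i has_field_derivative T (Suc i) s) (at s)" for i
    proof -
      have "((\<lambda>s. of_real ((- ln (real n)) ^ i) * (of_nat n :: complex) powr (-s)) has_field_derivative
             of_real ((- ln (real n)) ^ Suc i) * of_nat n powr (-s)) (at s)" if "n > 0" for n
        using DERIV_cmult[OF pw[OF that, of 0 s], of "of_real ((- ln (real n)) ^ i)"]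
        by (simp add: mult_ac)
      thus ?thesis unfolding T_def by (intro DERIV_sum) auto
    qed
    have "((\<lambda>s. s - 1) has_field_derivative 1) (at s)"
      by (auto intro!: derivative_eq_intros)
    from DERIV_mult[OF this T] have Tm: "((\<lambda>s. (s - 1) * T j s) has_field_derivative (s - 1) * T (Suc j) s + 1 * T j s) (at s)"
      by (simp add: algebra_simps)
    have "((\<lambda>s. (s - 1) * T j s + of_nat j * T (j - 1) s
        + of_real ((- ln (real (Suc N))) ^ j) * of_nat (Suc N) powr (1 - s)) has_field_derivative
         ((s - 1) * T (Suc j) s + 1 * T j s) + of_nat j * T (Suc (j - 1)) s
        + of_real ((- ln (real (Suc N))) ^ j) * (of_real (- ln (real (Suc N))) * of_nat (Suc N) powr (1 - s))) (at s)"
      by (rule DERIV_add[OF DERIV_add[OF Tm DERIV_cmult[OF T]] DERIV_cmult[OF pw]]) simp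
    also have "((s - 1) * T (Suc j) s + 1 * T j s) + of_nat j * T (Suc (j - 1)) s
       = (s - 1) * T (Suc j) s + of_nat (Suc j) * T j s"
      by (cases j) (auto simp: algebra_simps)
    finally have "deriv (\<lambda>s. (s - 1) * T j s + of_nat j * T (j - 1) s
        + of_real ((- ln (real (Suc N))) ^ j) * of_nat (Suc N) powr (1 - s)) s
       = (s - 1) * T (Suc j) s + of_nat (Suc j) * T j s
        + of_real ((- ln (real (Suc N))) ^ Suc j) * of_nat (Suc N) powr (1 - s)"
      by (intro DERIV_imp_deriv) (simp add: mult_ac)
    thus "(deriv ^^ Suc j) (zeta_reg_partial (Suc N)) s =
       (s - 1) * (\<Sum>n=1..Suc N. of_real ((- ln (real n)) ^ Suc j) * of_nat n powr (-s))
        + of_nat (Suc j) * (\<Sum>n=1..Suc N. of_real ((- ln (real n)) ^ (Suc j - 1)) * of_nat n powr (-s))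
        + of_real ((- ln (real (Suc N))) ^ Suc j) * of_nat (Suc N) powr (1 - s)"
      unfolding funpow.simps comp_def Suc.IH T_def by simp
  qed
qed

text \<open>Locally uniform limits of holomorphic functions commute with derivatives. At
  \<open>s = 1\<close> the sum multiplied by \<open>s - 1\<close> drops out, and the signs from
  \<open>(- ln n) ^ k\<close> cancel against the normalising \<open>(-1) ^ k\<close>.\<close>

theorem stieltjes_LIMSEQ:
  "(\<lambda>N. (\<Sum>n=1..Suc N. ln (real n) ^ k / real n) - ln (real (Suc N)) ^ Suc k / real (Suc k))
     \<longlonglongrightarrow> stieltjes k"
proof -
  define U where "U = {s. Re s > 1 / 2 \<and> norm s < 2}"
  have "(\<lambda>N. (deriv ^^ Suc k) (zeta_reg_partial (Suc N)) 1) \<longlonglongrightarrow> (deriv ^^ Suc k) zeta_reg 1"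
  proof (rule higher_deriv_complex_uniform_limit[where A = U])
    show "uniform_limit U (\<lambda>N. zeta_reg_partial (Suc N)) zeta_reg sequentially"
      unfolding U_def by (rule uniform_limit_zeta_reg) auto
    show "open U" unfolding U_def by (rule open_half_plane_ball)
  qed (auto simp: U_def intro!: always_eventually holomorphic_zeta_reg_partial)
  hence "(\<lambda>N. Re ((-1) ^ k * (deriv ^^ Suc k) (zeta_reg_partial (Suc N)) 1 / of_nat (Suc k))) \<longlonglongrightarrow> stieltjes k"
    unfolding stieltjes_eq by (intro tendsto_intros) (simp_all del: of_nat_Suc)
  also have "(\<lambda>N. Re ((-1) ^ k * (deriv ^^ Suc k) (zeta_reg_partial (Suc N)) 1 / of_nat (Suc k)))
    = (\<lambda>N. (\<Sum>n=1..Suc N. ln (real n) ^ k / real n) - ln (real (Suc N)) ^ Suc k / real (Suc k))"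
  proof
    fix N
    define L where "L = (\<Sum>n=1..Suc N. ln (real n) ^ k / real n)"
    have "(\<Sum>n=1..Suc N. of_real ((- ln (real n)) ^ k) * (of_nat n :: complex) powr (-1))
        = (\<Sum>n=1..Suc N. of_real ((-1) ^ k * (ln (real n) ^ k / real n)))"
      by (intro sum.cong refl) (simp add: powr_minus divide_inverse power_minus[of "ln (real _)"])
    also have "\<dots> = of_real ((-1) ^ k * L)"
      unfolding L_def sum_distrib_left by simp
    finally have S: "(\<Sum>n=1..Suc N. of_real ((- ln (real n)) ^ k) * (of_nat n :: complex) powr (-1))
        = of_real ((-1) ^ k * L)" .
    have "(deriv ^^ Suc k) (zeta_reg_partial (Suc N)) 1
      = of_real (real (Suc k) * ((-1) ^ k * L) + (- ln (real (Suc N))) ^ Suc k)"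
      unfolding higher_deriv_zeta_reg_partial diff_Suc_1 S
      by (simp del: of_nat_Suc sum.cl_ivl_Suc)
    hence E: "(-1) ^ k * (deriv ^^ Suc k) (zeta_reg_partial (Suc N)) 1 / of_nat (Suc k)
      = of_real ((-1) ^ k * (real (Suc k) * ((-1) ^ k * L) + (- ln (real (Suc N))) ^ Suc k) / real (Suc k))"
      by (simp del: funpow.simps of_nat_Suc)
    also have "(-1) ^ k * (real (Suc k) * ((-1) ^ k * L) + (- ln (real (Suc N))) ^ Suc k) / real (Suc k)
      = L - ln (real (Suc N)) ^ Suc k / real (Suc k)"
    proof -
      have "((-1) ^ k * (-1) ^ k :: real) = 1" by (simp flip: power_add power_mult_distrib)
      hence e: "(-1) ^ k * (real (Suc k) * ((-1) ^ k * L) + (- 1) ^ Suc k * ln (real (Suc N)) ^ Suc k)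
           = real (Suc k) * L - ln (real (Suc N)) ^ Suc k"
        by (simp add: algebra_simps)
      show ?thesis unfolding power_minus[of "ln (real (Suc N))"] e by (simp add: field_simps del: of_nat_Suc)
    qed
    finally show "Re ((-1) ^ k * (deriv ^^ Suc k) (zeta_reg_partial (Suc N)) 1 / of_nat (Suc k))
       = (\<Sum>n=1..Suc N. ln (real n) ^ k / real n) - ln (real (Suc N)) ^ Suc k / real (Suc k)"
      by (simp only: L_def Re_complex_of_real)
  qed
  finally show ?thesis .
qed

section \<open>Sums of powers of logarithms\<close>

text \<open>Apply \<open>ln u \<le> u\<close> to the root \<open>u = t powr (1 / (2 * j))\<close>
  and raise to the power \<open>j\<close>.\<close>

lemma ln_power_le_sqrt:
  assumes "t \<ge> 1"
  shows "ln t ^ j \<le> (2 * real j) ^ j * sqrt t"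
proof (cases "j = 0")
  case False
  have "ln t = 2 * real j * ln (t powr (1 / (2 * real j)))"
    using assms False by (simp add: ln_powr)
  also have "\<dots> \<le> 2 * real j * t powr (1 / (2 * real j))"
    using assms by (intro mult_left_mono ln_bound) auto
  finally have "ln t ^ j \<le> (2 * real j * t powr (1 / (2 * real j))) ^ j"
    using assms by (intro power_mono) auto
  also have "\<dots> = (2 * real j) ^ j * (t powr (1 / (2 * real j))) ^ j"
    by (simp add: power_mult_distrib)
  also have "(t powr (1 / (2 * real j))) ^ j = t powr (1 / 2)"
    using assms False by (simp add: powr_power)
  also have "\<dots> = sqrt t" using assms by (simp add: powr_half_sqrt)
  finally show ?thesis .
qed (use assms in auto)

definition ln_power_sum :: "nat \<Rightarrow> real \<Rightarrow> real" where
  "ln_power_sum j = summatory (\<lambda>n. ln (real n) ^ j / real n)"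

definition ln_power_sum_err :: "nat \<Rightarrow> real \<Rightarrow> real" where
  "ln_power_sum_err j y = ln_power_sum j y - (ln y ^ Suc j / real (Suc j) + stieltjes j)"

lemma summatory_one: "0 \<le> t \<Longrightarrow> summatory (\<lambda>_. 1) t = real_of_int \<lfloor>t\<rfloor>"
  by (simp add: summatory_def pos_upto_eq)

lemma abs_summatory_one_diff_le: "0 \<le> t \<Longrightarrow> \<bar>summatory (\<lambda>_. 1) t - t\<bar> \<le> 1"
  unfolding summatory_one by linarith

lemma DERIV_ln_power_div:
  assumes "t > 0"
  shows "((\<lambda>t. ln t ^ j / t) has_real_derivative (real j * ln t ^ (j - 1) - ln t ^ j) / t ^ 2) (at t)"
  using assms by (auto intro!: derivative_eq_intros simp: power2_eq_square field_simps)

text \<open>The limit of \<open>R\<close> has to be known only along one sequence \<open>u\<close>.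
  This permits integers below and squares of integers later.\<close>

lemma increment_bound_LIMSEQ:
  fixes R G :: "real \<Rightarrow> real"
  assumes "\<And>z. y \<le> z \<Longrightarrow> \<bar>R z - R y\<bar> \<le> G z - G y"
    and "(\<lambda>N. R (u N)) \<longlonglongrightarrow> L" and "(\<lambda>N. G (u N)) \<longlonglongrightarrow> l"
    and "filterlim u at_top sequentially"
  shows "\<bar>L - R y\<bar> \<le> l - G y"
proof (rule tendsto_le)
  show "eventually (\<lambda>N. \<bar>R (u N) - R y\<bar> \<le> G (u N) - G y) sequentially"
    using filterlim_at_top[THEN iffD1, rule_format, OF assms(4), of y] assms(1)
    by (auto elim: eventually_mono)
qed (use assms(2,3) in \<open>auto intro!: tendsto_intros\<close>)

text \<open>Abel summation with summatory function \<open>\<lfloor>t\<rfloor>\<close> against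
  \<open>t\<close>. The bound is used only inside limits, so powers of \<open>ln\<close> are
  absorbed crudely into \<open>sqrt\<close>; a power saving is all that is needed.\<close>

lemma ln_power_sum_err_bound:
  "\<exists>C\<ge>0. \<forall>y\<ge>1. \<bar>ln_power_sum_err j y\<bar> \<le> C / sqrt y"
proof -
  define K where "K = real j * (2 * real (j - 1)) ^ (j - 1) + (2 * real j) ^ j"
  have K0: "K \<ge> 0" unfolding K_def by simp
  have Kj: "(2 * real j) ^ j \<le> K" unfolding K_def by simp
  define f where "f = (\<lambda>t::real. ln t ^ j / t)"
  define F where "F = (\<lambda>t::real. ln t ^ Suc j / real (Suc j))"
  define G where "G = (\<lambda>t. - (2 * K / sqrt t))"
  define R where "R = abel_rest (\<lambda>_. 1) f F (\<lambda>t. t)"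
  have R_diff: "\<bar>R z - R y\<bar> \<le> G z - G y" if y: "1 \<le> y" and yz: "y \<le> z" for y z
    unfolding R_def
  proof (rule abel_rest_diff_le[OF yz])
    fix t assume "y \<le> t" "t \<le> z"
    hence t: "t \<ge> 1" using y by simp
    define f' where "f' = (\<lambda>t::real. (real j * ln t ^ (j - 1) - ln t ^ j) / t ^ 2)"
    show "(f has_real_derivative f' t) (at t)"
      unfolding f_def f'_def by (rule DERIV_ln_power_div) (use t in auto)
    show "((\<lambda>t. t) has_real_derivative 1) (at t)" by simp
    have "(F has_real_derivative (real (Suc j) * (1 / t * ln t ^ j)) / real (Suc j)) (at t)"
      unfolding F_def using t by (intro DERIV_cdivide DERIV_power_Suc[THEN DERIV_cong]) (auto intro!: DERIV_ln_divide)
    thus "(F has_real_derivative f t * 1) (at t)"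
      by (rule DERIV_cong) (simp add: f_def del: of_nat_Suc)
    have sq: "t ^ 2 = t * sqrt t * sqrt t" using t by (simp add: power2_eq_square)
    show "(G has_real_derivative K * sqrt t / t ^ 2) (at t)"
      unfolding G_def using t unfolding sq
      by (auto intro!: derivative_eq_intros simp: field_simps power2_eq_square)
    have "\<bar>real j * ln t ^ (j - 1) - ln t ^ j\<bar> \<le> real j * ln t ^ (j - 1) + ln t ^ j"
      using t by (simp add: abs_le_iff)
    also have "\<dots> \<le> real j * ((2 * real (j - 1)) ^ (j - 1) * sqrt t) + (2 * real j) ^ j * sqrt t"
      using t by (intro add_mono mult_left_mono ln_power_le_sqrt) auto
    also have "\<dots> = K * sqrt t" by (simp add: K_def algebra_simps)
    finally have "\<bar>f' t\<bar> \<le> K * sqrt t / t ^ 2"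
      using t by (simp add: f'_def divide_right_mono)
    moreover have "\<bar>summatory (\<lambda>_. 1) t - t\<bar> \<le> 1" using t by (intro abs_summatory_one_diff_le) auto
    ultimately show "\<bar>f' t\<bar> * \<bar>summatory (\<lambda>_. 1) t - t\<bar> \<le> K * sqrt t / t ^ 2"
      using mult_mono[of "\<bar>f' t\<bar>" "K * sqrt t / t ^ 2" "\<bar>summatory (\<lambda>_. 1) t - t\<bar>" 1] t K0 by simp
  qed
  have lim: "filterlim (\<lambda>N. real (Suc N)) at_top sequentially"
    by (intro filterlim_compose[OF filterlim_real_sequentially filterlim_Suc])
  have R_lim: "(\<lambda>N. R (real (Suc N))) \<longlonglongrightarrow> stieltjes j"
    using stieltjes_LIMSEQ[of j]
    by (simp add: R_def abel_rest_def summatory_def f_def F_def del: of_nat_Suc sum.cl_ivl_Suc power_Suc)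
  have G_lim: "(\<lambda>N. G (real (Suc N))) \<longlonglongrightarrow> - 0"
    unfolding G_def by (intro tendsto_minus tendsto_divide_0[OF tendsto_const]
        filterlim_at_top_imp_at_infinity filterlim_compose[OF sqrt_at_top lim])
  have R_bound: "\<bar>stieltjes j - R y\<bar> \<le> 2 * K / sqrt y" if "y \<ge> 1" for y
    using increment_bound_LIMSEQ[OF R_diff[OF that] R_lim G_lim lim] by (simp add: G_def)
  have "\<bar>ln_power_sum_err j y\<bar> \<le> 3 * K / sqrt y" if y: "y \<ge> 1" for y
  proof -
    have "ln_power_sum_err j y = R y - stieltjes j + f y * (summatory (\<lambda>_. 1) y - y)"
      by (simp add: ln_power_sum_err_def ln_power_sum_def R_def abel_rest_def f_def F_def summatory_def del: of_nat_Suc)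
    hence "\<bar>ln_power_sum_err j y\<bar> \<le> \<bar>stieltjes j - R y\<bar> + \<bar>f y\<bar> * \<bar>summatory (\<lambda>_. 1) y - y\<bar>"
      by (simp flip: abs_mult)
    also have "\<bar>f y\<bar> * \<bar>summatory (\<lambda>_. 1) y - y\<bar> \<le> (K * sqrt y / y) * 1"
    proof (intro mult_mono)
      have "ln y ^ j \<le> K * sqrt y"
        by (rule order.trans[OF ln_power_le_sqrt[OF y] mult_right_mono[OF Kj]]) (use y in simp)
      thus "\<bar>f y\<bar> \<le> K * sqrt y / y" using y by (simp add: f_def divide_right_mono)
      show "\<bar>summatory (\<lambda>_. 1) y - y\<bar> \<le> 1" using y by (intro abs_summatory_one_diff_le) auto
    qed (use y K0 in auto)
    also have "K * sqrt y / y * 1 = K / sqrt y"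
      using y by (simp add: field_simps)
    finally show ?thesis using R_bound[OF y] by simp
  qed
  thus ?thesis using K0 by (intro exI[of _ "3 * K"]) auto
qed

lemma stieltjes_0: "stieltjes 0 = euler_mascheroni"
proof (rule LIMSEQ_unique)
  show "(\<lambda>N. harm (Suc N) - ln (real (Suc N))) \<longlonglongrightarrow> euler_mascheroni"
    using euler_mascheroni_LIMSEQ by (rule LIMSEQ_Suc)
  show "(\<lambda>N. harm (Suc N) - ln (real (Suc N))) \<longlonglongrightarrow> stieltjes 0"
    using stieltjes_LIMSEQ[of 0] by (simp add: harm_def inverse_eq_divide)
qed

section \<open>Euler-Maclaurin summation with an explicit remainder\<close>

lemma nonpos_from_deriv_nonpos:
  fixes w w' :: "real \<Rightarrow> real"
  assumes "w 0 = 0" "0 \<le> h" "h \<le> 1"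
    and "\<And>t. 0 \<le> t \<Longrightarrow> t \<le> 1 \<Longrightarrow> (w has_real_derivative w' t) (at t)"
    and "\<And>t. 0 \<le> t \<Longrightarrow> t \<le> 1 \<Longrightarrow> w' t \<le> 0"
  shows "w h \<le> 0"
  using DERIV_nonpos_imp_nonincreasing[of 0 h w] assms by force

text \<open>As a function of the step length, the error of the corrected trapezoidal rule vanishes to
  third order at 0 and has third derivative \<open>- h\<^sup>2 * f4 / 12\<close>.\<close>

lemma corrected_trapezoid_le:
  fixes f F f1 f2 f3 f4 :: "real \<Rightarrow> real"
  assumes F: "\<And>t. a \<le> t \<Longrightarrow> t \<le> a + 1 \<Longrightarrow> (F has_real_derivative f t) (at t)"
    and f: "\<And>t. a \<le> t \<Longrightarrow> t \<le> a + 1 \<Longrightarrow> (f has_real_derivative f1 t) (at t)"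
    and f1: "\<And>t. a \<le> t \<Longrightarrow> t \<le> a + 1 \<Longrightarrow> (f1 has_real_derivative f2 t) (at t)"
    and f2: "\<And>t. a \<le> t \<Longrightarrow> t \<le> a + 1 \<Longrightarrow> (f2 has_real_derivative f3 t) (at t)"
    and f3: "\<And>t. a \<le> t \<Longrightarrow> t \<le> a + 1 \<Longrightarrow> (f3 has_real_derivative f4 t) (at t)"
    and L: "\<And>t. a \<le> t \<Longrightarrow> t \<le> a + 1 \<Longrightarrow> L \<le> f4 t"
  shows "(f a + f (a + 1)) / 2 - (F (a + 1) - F a) - (f1 (a + 1) - f1 a) / 12 \<le> - L / 720"
proof -
  \<comment> \<open>\<open>e1\<close> and \<open>e2\<close> are the first and second derivatives of
    \<open>e\<close> in the step length. Their last terms are iterated integrals of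
    \<open>h ^ 2 * L / 12\<close>, whence 36, 144 and 720.\<close>
  define e2 where "e2 = (\<lambda>h. h * f2 (a + h) / 6 - (f1 (a + h) - f1 a) / 6 - h ^ 2 * f3 (a + h) / 12 + L * h ^ 3 / 36)"
  define e1 where "e1 = (\<lambda>h. (f a - f (a + h)) / 2 + h * f1 (a + h) / 2 - h * (f1 (a + h) - f1 a) / 6
      - h ^ 2 * f2 (a + h) / 12 + L * h ^ 4 / 144)"
  define e where "e = (\<lambda>h. h * (f a + f (a + h)) / 2 - (F (a + h) - F a) - h ^ 2 * (f1 (a + h) - f1 a) / 12
      + L * h ^ 5 / 720)"
  have D: "((\<lambda>h. F (a + h)) has_real_derivative f (a + h)) (at h)"
    "((\<lambda>h. f (a + h)) has_real_derivative f1 (a + h)) (at h)"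
    "((\<lambda>h. f1 (a + h)) has_real_derivative f2 (a + h)) (at h)"
    "((\<lambda>h. f2 (a + h)) has_real_derivative f3 (a + h)) (at h)"
    "((\<lambda>h. f3 (a + h)) has_real_derivative f4 (a + h)) (at h)"
    if "0 \<le> h" "h \<le> 1" for h
    using F[of "a + h"] f[of "a + h"] f1[of "a + h"] f2[of "a + h"] f3[of "a + h"] that
    by (simp_all add: DERIV_shift add.commute[of a])
  have e2: "e2 h \<le> 0" if "0 \<le> h" "h \<le> 1" for h
  proof (rule nonpos_from_deriv_nonpos[OF _ that, where w' = "\<lambda>h. h ^ 2 * (L - f4 (a + h)) / 12"])
    fix t :: real assume t: "0 \<le> t" "t \<le> 1"
    show "(e2 has_real_derivative t ^ 2 * (L - f4 (a + t)) / 12) (at t)"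
      unfolding e2_def by (rule derivative_eq_intros D[OF t] refl | simp add: field_simps power2_eq_square power3_eq_cube)+
    show "t ^ 2 * (L - f4 (a + t)) / 12 \<le> 0" using L[of "a + t"] t by (simp add: mult_nonneg_nonpos)
  qed (simp add: e2_def)
  have e1: "e1 h \<le> 0" if "0 \<le> h" "h \<le> 1" for h
  proof (rule nonpos_from_deriv_nonpos[OF _ that _ e2])
    fix t :: real assume t: "0 \<le> t" "t \<le> 1"
    show "(e1 has_real_derivative e2 t) (at t)"
      unfolding e1_def e2_def
      by (rule derivative_eq_intros D[OF t] refl | simp add: field_simps power2_eq_square power3_eq_cube)+
  qed (simp_all add: e1_def)
  have "e 1 \<le> 0"
  proof (rule nonpos_from_deriv_nonpos[where w = e and h = 1, OF _ _ _ _ e1])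
    fix t :: real assume t: "0 \<le> t" "t \<le> 1"
    show "(e has_real_derivative e1 t) (at t)"
      unfolding e_def e1_def
      by (rule derivative_eq_intros D[OF t] refl | simp add: field_simps power2_eq_square power3_eq_cube eval_nat_numeral)+
  qed (simp_all add: e_def)
  thus ?thesis by (simp add: e_def)
qed

lemma corrected_trapezoid_ge:
  fixes f F f1 f2 f3 f4 :: "real \<Rightarrow> real"
  assumes "\<And>t. a \<le> t \<Longrightarrow> t \<le> a + 1 \<Longrightarrow> (F has_real_derivative f t) (at t)"
    and "\<And>t. a \<le> t \<Longrightarrow> t \<le> a + 1 \<Longrightarrow> (f has_real_derivative f1 t) (at t)"
    and "\<And>t. a \<le> t \<Longrightarrow> t \<le> a + 1 \<Longrightarrow> (f1 has_real_derivative f2 t) (at t)"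
    and "\<And>t. a \<le> t \<Longrightarrow> t \<le> a + 1 \<Longrightarrow> (f2 has_real_derivative f3 t) (at t)"
    and "\<And>t. a \<le> t \<Longrightarrow> t \<le> a + 1 \<Longrightarrow> (f3 has_real_derivative f4 t) (at t)"
    and "\<And>t. a \<le> t \<Longrightarrow> t \<le> a + 1 \<Longrightarrow> f4 t \<le> K"
  shows "(f a + f (a + 1)) / 2 - (F (a + 1) - F a) - (f1 (a + 1) - f1 a) / 12 \<ge> - K / 720"
  using corrected_trapezoid_le[of a "\<lambda>t. - F t" "\<lambda>t. - f t" "\<lambda>t. - f1 t" "\<lambda>t. - f2 t" "\<lambda>t. - f3 t" "\<lambda>t. - f4 t" "- K"] assms
  by (auto simp: DERIV_minus field_simps)

text \<open>With \<open>F\<close> an antiderivative and \<open>f1\<close> the derivative of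
  \<open>f\<close>, the end corrections 1/2 and 1/12 make each increment an error of the corrected
  trapezoidal rule, while they vanish in the limit for the functions used here.\<close>

definition euler_maclaurin ::
  "(real \<Rightarrow> real) \<Rightarrow> (real \<Rightarrow> real) \<Rightarrow> (real \<Rightarrow> real) \<Rightarrow> nat \<Rightarrow> real" where
  "euler_maclaurin f F f1 n = (\<Sum>k=1..n. f (real k)) - F (real n) - f (real n) / 2 - f1 (real n) / 12"

lemma euler_maclaurin_Suc_diff:
  "euler_maclaurin f F f1 (Suc n) - euler_maclaurin f F f1 n =
     (f (real n) + f (real n + 1)) / 2 - (F (real n + 1) - F (real n)) - (f1 (real n + 1) - f1 (real n)) / 12"
proof -
  have Suc: "real (Suc n) = real n + 1" by simp
  have "(\<Sum>k=1..Suc n. f (real k)) = (\<Sum>k=1..n. f (real k)) + f (real n + 1)"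
    unfolding Suc[symmetric] by simp
  thus ?thesis unfolding euler_maclaurin_def Suc by (simp add: field_simps)
qed

text \<open>A telescoping majorant for the increments: the factor 30 is 720 / 24, matching a fourth
  derivative of size at most \<open>24 * K / t ^ 4\<close>.\<close>

lemma inverse_fourth_power_le_telescope:
  fixes x :: real
  assumes "x \<ge> 2"
  shows "1 / (30 * x ^ 4) \<le> 1 / (90 * (x - 1) ^ 3) - 1 / (90 * x ^ 3)"
proof -
  have "x * (x ^ 3 - (x - 1) ^ 3) - 3 * (x - 1) ^ 3 = 6 * (x - 2 / 3) ^ 2 + 1 / 3"
    by (simp add: power2_eq_square power3_eq_cube field_simps)
  also have "\<dots> \<ge> 0" by simp
  finally have "3 * (x - 1) ^ 3 \<le> x * (x ^ 3 - (x - 1) ^ 3)" by simp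
  hence "3 * (x - 1) ^ 3 / (90 * x ^ 4 * (x - 1) ^ 3) \<le> x * (x ^ 3 - (x - 1) ^ 3) / (90 * x ^ 4 * (x - 1) ^ 3)"
    using assms by (intro divide_right_mono) auto
  also have "3 * (x - 1) ^ 3 / (90 * x ^ 4 * (x - 1) ^ 3) = 1 / (30 * x ^ 4)"
    using assms by simp
  also have "x * (x ^ 3 - (x - 1) ^ 3) / (90 * x ^ 4 * (x - 1) ^ 3) = (x ^ 3 - (x - 1) ^ 3) / (90 * x ^ 3 * (x - 1) ^ 3)"
    using assms by (simp add: power4_eq_xxxx power3_eq_cube)
  also have "\<dots> = 1 / (90 * (x - 1) ^ 3) - 1 / (90 * x ^ 3)"
    using assms by (simp add: diff_divide_distrib)
  finally show ?thesis .
qed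

text \<open>Functions \<open>P (ln t) / t ^ k\<close> are closed under differentiation, with
  \<open>P\<close> passing to \<open>P' - k * P\<close>. Iterating this produces all derivative
  formulas in the three interpretations below.\<close>

lemma DERIV_fun_ln_div_power:
  assumes "t > 0" "(P has_real_derivative p) (at (ln t))" "n = Suc k"
  shows "((\<lambda>t. P (ln t) / t ^ k) has_real_derivative (p - real k * P (ln t)) / t ^ n) (at t)"
proof -
  have 1: "((\<lambda>t. P (ln t)) has_real_derivative p * (1 / t)) (at t)"
    by (rule DERIV_chain2[OF assms(2) DERIV_ln_divide[OF assms(1)]])
  have 2: "((\<lambda>t. t ^ k) has_real_derivative real k * t ^ (k - 1)) (at t)"
    by (rule DERIV_cong[OF DERIV_pow]) simp
  have "t ^ k \<noteq> 0" using assms by simp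
  from DERIV_divide[OF 1 2 this]
  have "((\<lambda>t. P (ln t) / t ^ k) has_real_derivative
      (p * (1 / t) * t ^ k - P (ln t) * (real k * t ^ (k - 1))) / (t ^ k * t ^ k)) (at t)" .
  also have "(p * (1 / t) * t ^ k - P (ln t) * (real k * t ^ (k - 1))) / (t ^ k * t ^ k) =
      (p - real k * P (ln t)) / t ^ n"
    using assms(1) unfolding assms(3) by (cases k) (simp_all add: field_simps)
  finally show ?thesis .
qed

locale euler_maclaurin_limit =
  fixes f F f1 f2 f3 f4 :: "real \<Rightarrow> real" and c :: real
  assumes F: "\<And>t. t > 0 \<Longrightarrow> (F has_real_derivative f t) (at t)"
    and f: "\<And>t. t > 0 \<Longrightarrow> (f has_real_derivative f1 t) (at t)"
    and f1: "\<And>t. t > 0 \<Longrightarrow> (f1 has_real_derivative f2 t) (at t)"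
    and f2: "\<And>t. t > 0 \<Longrightarrow> (f2 has_real_derivative f3 t) (at t)"
    and f3: "\<And>t. t > 0 \<Longrightarrow> (f3 has_real_derivative f4 t) (at t)"
    and lim: "euler_maclaurin f F f1 \<longlonglongrightarrow> c"
begin

text \<open>A nonnegative fourth derivative makes the Euler-Maclaurin sequence nonincreasing from
  \<open>N\<close> on, so each of its values bounds the limit from above.\<close>

lemma limit_le:
  assumes "N > 0" and "\<And>t. t \<ge> real N \<Longrightarrow> f4 t \<ge> 0"
  shows "c \<le> euler_maclaurin f F f1 N"
proof (rule LIMSEQ_le_const2[OF lim], intro exI allI impI)
  fix n assume "N \<le> n"
  thus "euler_maclaurin f F f1 n \<le> euler_maclaurin f F f1 N"
  proof (induction rule: dec_induct)
    case (step n)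
    have "euler_maclaurin f F f1 (Suc n) - euler_maclaurin f F f1 n \<le> - 0 / 720"
      unfolding euler_maclaurin_Suc_diff
      by (rule corrected_trapezoid_le[OF F f f1 f2 f3]) (use step assms in auto)
    thus ?case using step by simp
  qed simp
qed

text \<open>Each increment is at most \<open>K / (30 * n ^ 4)\<close> in absolute value, and these
  bounds telescope from \<open>N\<close> to infinity.\<close>

lemma limit_approx:
  assumes "N \<ge> 2" and f4: "\<And>t. t \<ge> real N \<Longrightarrow> \<bar>f4 t\<bar> \<le> 24 * K / t ^ 4"
  shows "\<bar>c - euler_maclaurin f F f1 N\<bar> \<le> K * (1 / (90 * (real N - 1) ^ 3))"
proof -
  have "0 \<le> 24 * K / real N ^ 4" using f4[of "real N"] abs_ge_zero order.trans by blast
  hence K: "K \<ge> 0" using assms(1) by (simp add: zero_le_divide_iff)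
  have "\<bar>euler_maclaurin f F f1 n - euler_maclaurin f F f1 N\<bar>
      \<le> K * (1 / (90 * (real N - 1) ^ 3) - 1 / (90 * (real n - 1) ^ 3))" if "N \<le> n" for n
    using that
  proof (induction rule: dec_induct)
    case (step n)
    have n: "real n \<ge> 2" using step assms by linarith
    have b: "- (24 * K / real n ^ 4) \<le> f4 t \<and> f4 t \<le> 24 * K / real n ^ 4" if "real n \<le> t" for t
    proof -
      have "\<bar>f4 t\<bar> \<le> 24 * K / t ^ 4" using that step by (intro f4) auto
      also have "\<dots> \<le> 24 * K / real n ^ 4" using that n K by (intro divide_left_mono power_mono mult_pos_pos) auto
      finally show ?thesis by linarith
    qed
    have "euler_maclaurin f F f1 (Suc n) - euler_maclaurin f F f1 n \<le> - (- (24 * K / real n ^ 4)) / 720"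
      unfolding euler_maclaurin_Suc_diff
      by (rule corrected_trapezoid_le[OF F f f1 f2 f3]) (use n b in auto)
    moreover have "euler_maclaurin f F f1 (Suc n) - euler_maclaurin f F f1 n \<ge> - (24 * K / real n ^ 4) / 720"
      unfolding euler_maclaurin_Suc_diff
      by (rule corrected_trapezoid_ge[OF F f f1 f2 f3]) (use n b in auto)
    ultimately have "\<bar>euler_maclaurin f F f1 (Suc n) - euler_maclaurin f F f1 n\<bar> \<le> K * (1 / (30 * real n ^ 4))"
      by (simp add: abs_le_iff)
    also have "\<dots> \<le> K * (1 / (90 * (real n - 1) ^ 3) - 1 / (90 * (real (Suc n) - 1) ^ 3))"
      using inverse_fourth_power_le_telescope[OF n] K by (intro mult_left_mono) auto
    finally show ?case using step.IH unfolding right_diff_distrib by linarith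
  qed simp
  hence le: "eventually (\<lambda>n. \<bar>euler_maclaurin f F f1 n - euler_maclaurin f F f1 N\<bar>
      \<le> K * (1 / (90 * (real N - 1) ^ 3) - 1 / (90 * (real n - 1) ^ 3))) sequentially"
    by (auto simp: eventually_at_top_linorder)
  have "\<bar>c - euler_maclaurin f F f1 N\<bar> \<le> K * (1 / (90 * (real N - 1) ^ 3) - 0)"
  proof (rule tendsto_le[OF _ _ _ le])
    show "(\<lambda>n. K * (1 / (90 * (real N - 1) ^ 3) - 1 / (90 * (real n - 1) ^ 3))) \<longlonglongrightarrow> K * (1 / (90 * (real N - 1) ^ 3) - 0)"
      by (intro tendsto_mult tendsto_diff tendsto_const) real_asymp
  qed (auto intro!: tendsto_intros lim)
  thus ?thesis by simp
qed

end

lemma euler_maclaurin_LIMSEQ_stieltjes: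
  assumes "f = (\<lambda>t. ln t ^ j / t)" "F = (\<lambda>t. ln t ^ Suc j / real (Suc j))"
    and "(\<lambda>n. f (real n)) \<longlonglongrightarrow> 0" "(\<lambda>n. f1 (real n)) \<longlonglongrightarrow> 0"
  shows "euler_maclaurin f F f1 \<longlonglongrightarrow> stieltjes j"
proof -
  have "(\<lambda>n. (\<Sum>k=1..n. ln (real k) ^ j / real k) - ln (real n) ^ Suc j / real (Suc j)) \<longlonglongrightarrow> stieltjes j"
    using stieltjes_LIMSEQ[of j] by (subst filterlim_sequentially_Suc[symmetric])
  from tendsto_diff[OF tendsto_diff[OF this tendsto_divide[OF assms(3) tendsto_const[of 2]]]
      tendsto_divide[OF assms(4) tendsto_const[of 12]]]
  show ?thesis unfolding euler_maclaurin_def assms(1,2) by simp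
qed

interpretation em0: euler_maclaurin_limit "\<lambda>t. 1 / t" "ln"
  "\<lambda>t. (- 1) / t ^ 2" "\<lambda>t. (2) / t ^ 3" "\<lambda>t. (- 6) / t ^ 4" "\<lambda>t. (24) / t ^ 5" "euler_mascheroni"
proof
  fix t :: real assume t: "t > 0"
  show "(ln has_real_derivative 1 / t) (at t)"
    using t by (auto intro!: derivative_eq_intros)
  have "((\<lambda>l. 1) has_real_derivative 0) (at (ln t))"
    by (auto intro!: derivative_eq_intros)
  from DERIV_fun_ln_div_power[OF t this, of 2 1]
  show "((\<lambda>t. 1 / t) has_real_derivative (- 1) / t ^ 2) (at t)"
    by (simp add: algebra_simps)
  have "((\<lambda>l. - 1) has_real_derivative 0) (at (ln t))"
    by (auto intro!: derivative_eq_intros)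
  from DERIV_fun_ln_div_power[OF t this, of 3 2]
  show "((\<lambda>t. (- 1) / t ^ 2) has_real_derivative (2) / t ^ 3) (at t)"
    by (simp add: algebra_simps)
  have "((\<lambda>l. 2) has_real_derivative 0) (at (ln t))"
    by (auto intro!: derivative_eq_intros)
  from DERIV_fun_ln_div_power[OF t this, of 4 3]
  show "((\<lambda>t. (2) / t ^ 3) has_real_derivative (- 6) / t ^ 4) (at t)"
    by (simp add: algebra_simps)
  have "((\<lambda>l. - 6) has_real_derivative 0) (at (ln t))"
    by (auto intro!: derivative_eq_intros)
  from DERIV_fun_ln_div_power[OF t this, of 5 4]
  show "((\<lambda>t. (- 6) / t ^ 4) has_real_derivative (24) / t ^ 5) (at t)"
    by (simp add: algebra_simps)
next
  show "euler_maclaurin (\<lambda>t. 1 / t) ln (\<lambda>t. (- 1) / t ^ 2) \<longlonglongrightarrow> euler_mascheroni"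
    unfolding stieltjes_0[symmetric] by (rule euler_maclaurin_LIMSEQ_stieltjes) (simp, simp, real_asymp, real_asymp)
qed

interpretation em1: euler_maclaurin_limit "\<lambda>t. ln t / t" "\<lambda>t. ln t ^ 2 / 2"
  "\<lambda>t. (1 - ln t) / t ^ 2" "\<lambda>t. (2 * ln t - 3) / t ^ 3" "\<lambda>t. (11 - 6 * ln t) / t ^ 4" "\<lambda>t. (24 * ln t - 50) / t ^ 5" "stieltjes 1"
proof
  fix t :: real assume t: "t > 0"
  show "((\<lambda>t. ln t ^ 2 / 2) has_real_derivative ln t / t) (at t)"
    using t by (auto intro!: derivative_eq_intros)
  have "((\<lambda>l. l) has_real_derivative 1) (at (ln t))"
    by (auto intro!: derivative_eq_intros)
  from DERIV_fun_ln_div_power[OF t this, of 2 1]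
  show "((\<lambda>t. ln t / t) has_real_derivative (1 - ln t) / t ^ 2) (at t)"
    by (simp add: algebra_simps)
  have "((\<lambda>l. 1 - l) has_real_derivative - 1) (at (ln t))"
    by (auto intro!: derivative_eq_intros)
  from DERIV_fun_ln_div_power[OF t this, of 3 2]
  show "((\<lambda>t. (1 - ln t) / t ^ 2) has_real_derivative (2 * ln t - 3) / t ^ 3) (at t)"
    by (simp add: algebra_simps)
  have "((\<lambda>l. 2 * l - 3) has_real_derivative 2) (at (ln t))"
    by (auto intro!: derivative_eq_intros)
  from DERIV_fun_ln_div_power[OF t this, of 4 3]
  show "((\<lambda>t. (2 * ln t - 3) / t ^ 3) has_real_derivative (11 - 6 * ln t) / t ^ 4) (at t)"
    by (simp add: algebra_simps)
  have "((\<lambda>l. 11 - 6 * l) has_real_derivative - 6) (at (ln t))"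
    by (auto intro!: derivative_eq_intros)
  from DERIV_fun_ln_div_power[OF t this, of 5 4]
  show "((\<lambda>t. (11 - 6 * ln t) / t ^ 4) has_real_derivative (24 * ln t - 50) / t ^ 5) (at t)"
    by (simp add: algebra_simps)
next
  show "euler_maclaurin (\<lambda>t. ln t / t) (\<lambda>t. ln t ^ 2 / 2) (\<lambda>t. (1 - ln t) / t ^ 2) \<longlonglongrightarrow> stieltjes 1"
    by (rule euler_maclaurin_LIMSEQ_stieltjes) (simp, simp add: power2_eq_square, real_asymp, real_asymp)
qed

interpretation em2: euler_maclaurin_limit "\<lambda>t. ln t ^ 2 / t" "\<lambda>t. ln t ^ 3 / 3"
  "\<lambda>t. (2 * ln t - ln t ^ 2) / t ^ 2" "\<lambda>t. (2 - 6 * ln t + 2 * ln t ^ 2) / t ^ 3" "\<lambda>t. (- 12 + 22 * ln t - 6 * ln t ^ 2) / t ^ 4" "\<lambda>t. (70 - 100 * ln t + 24 * ln t ^ 2) / t ^ 5" "stieltjes 2"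
proof
  fix t :: real assume t: "t > 0"
  show "((\<lambda>t. ln t ^ 3 / 3) has_real_derivative ln t ^ 2 / t) (at t)"
    using t by (auto intro!: derivative_eq_intros)
  have "((\<lambda>l. l ^ 2) has_real_derivative 2 * ln t) (at (ln t))"
    by (auto intro!: derivative_eq_intros)
  from DERIV_fun_ln_div_power[OF t this, of 2 1]
  show "((\<lambda>t. ln t ^ 2 / t) has_real_derivative (2 * ln t - ln t ^ 2) / t ^ 2) (at t)"
    by (simp add: algebra_simps)
  have "((\<lambda>l. 2 * l - l ^ 2) has_real_derivative 2 - 2 * ln t) (at (ln t))"
    by (auto intro!: derivative_eq_intros)
  from DERIV_fun_ln_div_power[OF t this, of 3 2]
  show "((\<lambda>t. (2 * ln t - ln t ^ 2) / t ^ 2) has_real_derivative (2 - 6 * ln t + 2 * ln t ^ 2) / t ^ 3) (at t)"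
    by (simp add: algebra_simps)
  have "((\<lambda>l. 2 - 6 * l + 2 * l ^ 2) has_real_derivative - 6 + 4 * ln t) (at (ln t))"
    by (auto intro!: derivative_eq_intros)
  from DERIV_fun_ln_div_power[OF t this, of 4 3]
  show "((\<lambda>t. (2 - 6 * ln t + 2 * ln t ^ 2) / t ^ 3) has_real_derivative (- 12 + 22 * ln t - 6 * ln t ^ 2) / t ^ 4) (at t)"
    by (simp add: algebra_simps)
  have "((\<lambda>l. - 12 + 22 * l - 6 * l ^ 2) has_real_derivative 22 - 12 * ln t) (at (ln t))"
    by (auto intro!: derivative_eq_intros)
  from DERIV_fun_ln_div_power[OF t this, of 5 4]
  show "((\<lambda>t. (- 12 + 22 * ln t - 6 * ln t ^ 2) / t ^ 4) has_real_derivative (70 - 100 * ln t + 24 * ln t ^ 2) / t ^ 5) (at t)"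
    by (simp add: algebra_simps)
next
  show "euler_maclaurin (\<lambda>t. ln t ^ 2 / t) (\<lambda>t. ln t ^ 3 / 3) (\<lambda>t. (2 * ln t - ln t ^ 2) / t ^ 2) \<longlonglongrightarrow> stieltjes 2"
    by (rule euler_maclaurin_LIMSEQ_stieltjes)
       (simp, simp add: power2_eq_square power3_eq_cube, real_asymp, real_asymp)
qed

section \<open>Rational bounds for logarithms of small integers\<close>

lemma ln_4_div_3_bounds: "0.2876820723 \<le> ln (4/3::real)" "ln (4/3::real) \<le> 0.287682073"
  using ln_approx_bounds[of "4/3" 5] by (simp_all add: eval_nat_numeral)

lemma ln_3_div_2_bounds: "0.4054651079 \<le> ln (3/2::real)" "ln (3/2::real) \<le> 0.40546511"
  using ln_approx_bounds[of "3/2" 6] by (simp_all add: eval_nat_numeral)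

text \<open>Splitting 2 as 4/3 * 3/2 moves the series evaluations to arguments near 1, where a few
  terms suffice; the logarithms of 3, 5 and 7 follow by similar ratios.\<close>

lemma ln_2_bounds: "0.69314718 \<le> ln (2::real)" "ln (2::real) \<le> 0.69314719"
proof -
  have "ln (2::real) = ln (4/3) + ln (3/2)" using ln_mult[of "4/3" "3/2::real"] by simp
  thus "0.69314718 \<le> ln (2::real)" "ln (2::real) \<le> 0.69314719"
    using ln_4_div_3_bounds ln_3_div_2_bounds by simp_all
qed

lemma ln_3_bounds: "1.09861228 \<le> ln (3::real)" "ln (3::real) \<le> 1.0986123"
proof -
  have "ln (3::real) = ln 2 + ln (3/2)" by (simp add: ln_div)
  thus "1.09861228 \<le> ln (3::real)" "ln (3::real) \<le> 1.0986123"
    using ln_2_bounds ln_3_div_2_bounds by simp_all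
qed

lemma ln_5_bounds: "1.6094379 \<le> ln (5::real)" "ln (5::real) \<le> 1.60943795"
proof -
  have "ln (5::real) = ln (2 ^ 2) + ln (5/4)" by (simp add: ln_div)
  hence "ln (5::real) = 2 * ln 2 + ln (5/4)" by (subst (asm) ln_realpow) auto
  moreover have "0.22314355 \<le> ln (5/4::real) \<and> ln (5/4::real) \<le> 0.22314356"
    using ln_approx_bounds[of "5/4" 5] by (simp add: eval_nat_numeral)
  ultimately show "1.6094379 \<le> ln (5::real)" "ln (5::real) \<le> 1.60943795" using ln_2_bounds by auto
qed

lemma ln_7_bounds: "1.9459101 \<le> ln (7::real)" "ln (7::real) \<le> 1.9459102"
proof -
  have "ln (7::real) = ln (2 ^ 3) - ln (8/7)" by (simp add: ln_div)
  hence "ln (7::real) = 3 * ln 2 - ln (8/7)" by (subst (asm) ln_realpow) auto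
  moreover have "0.13353139 \<le> ln (8/7::real) \<and> ln (8/7::real) \<le> 0.1335314"
    using ln_approx_bounds[of "8/7" 4] by (simp add: eval_nat_numeral)
  ultimately show "1.9459101 \<le> ln (7::real)" "ln (7::real) \<le> 1.9459102" using ln_2_bounds by auto
qed

lemma ln_4_eq: "ln 4 = 2 * ln (2::real)"
  using ln_realpow[of 2 2] by simp
lemma ln_8_eq: "ln 8 = 3 * ln (2::real)"
  using ln_realpow[of 2 3] by simp
lemma ln_9_eq: "ln 9 = 2 * ln (3::real)"
  using ln_realpow[of 3 2] by simp
lemma ln_6_eq: "ln 6 = ln 2 + ln (3::real)"
  using ln_mult[of 2 3] by simp
lemma ln_10_eq: "ln 10 = ln 2 + ln (5::real)"
  using ln_mult[of 2 5] by simp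

lemmas ln_small_eqs = ln_4_eq ln_6_eq ln_8_eq ln_9_eq ln_10_eq
lemmas ln_small_bounds = ln_2_bounds ln_3_bounds ln_5_bounds ln_7_bounds

lemma sum_1_10: "(\<Sum>k=1..10. g k) = g 1 + g 2 + g 3 + g 4 + g 5 + g 6 + g 7 + g 8 + g 9 + g (10::nat)"
  for g :: "nat \<Rightarrow> real"
  by (simp add: eval_nat_numeral)

lemma abs_diff_leD:
  fixes a b d :: real
  assumes "\<bar>a - b\<bar> \<le> d"
  shows "b - d \<le> a" "a \<le> b + d"
  using assms by linarith+

section \<open>Numerical values of the constants\<close>

text \<open>Evaluation at \<open>N = 10\<close> involves only integers whose prime factors are 2, 3,
  5 and 7. The fraction 7381 / 2520 is the tenth harmonic number.\<close>

lemma em_eval_eqs: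
  "euler_maclaurin (\<lambda>t. 1 / t) ln (\<lambda>t. (- 1) / t ^ 2) 10
     = 7381 / 2520 - ln 10 - 1 / 20 + 1 / 1200"
  "euler_maclaurin (\<lambda>t. ln t / t) (\<lambda>t. ln t ^ 2 / 2) (\<lambda>t. (1 - ln t) / t ^ 2) 10
     = (ln 2 / 2 + ln 3 / 3 + ln 4 / 4 + ln 5 / 5 + ln 6 / 6 + ln 7 / 7 + ln 8 / 8 + ln 9 / 9 + ln 10 / 10)
       - ln 10 ^ 2 / 2 - ln 10 / 20 - (1 - ln 10) / 1200"
  "euler_maclaurin (\<lambda>t. ln t ^ 2 / t) (\<lambda>t. ln t ^ 3 / 3) (\<lambda>t. (2 * ln t - ln t ^ 2) / t ^ 2) 10
     = (ln 2 ^ 2 / 2 + ln 3 ^ 2 / 3 + ln 4 ^ 2 / 4 + ln 5 ^ 2 / 5 + ln 6 ^ 2 / 6 + ln 7 ^ 2 / 7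
         + ln 8 ^ 2 / 8 + ln 9 ^ 2 / 9 + ln 10 ^ 2 / 10)
       - ln 10 ^ 3 / 3 - ln 10 ^ 2 / 20 - (2 * ln 10 - ln 10 ^ 2) / 1200"
  unfolding euler_maclaurin_def sum_1_10 by simp_all

lemma euler_mascheroni_bounds_5:
  "0.57721 \<le> (euler_mascheroni :: real)" "(euler_mascheroni :: real) \<le> 0.57722"
proof -
  show "(euler_mascheroni :: real) \<le> 0.57722"
    using em0.limit_le[of 10] ln_small_bounds unfolding em_eval_eqs by (simp add: ln_10_eq)
  \<comment> \<open>For \<open>t \<ge> 10\<close> one factor \<open>1 / t\<close> is traded for
    1/10, so \<open>limit_approx\<close> applies with \<open>K = 1 / 10\<close>.\<close>
  have "\<bar>24 / t ^ 5\<bar> \<le> 24 * (1 / 10) / t ^ 4" if "t \<ge> 10" for t :: real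
    using that by (simp add: field_simps eval_nat_numeral)
  hence "\<bar>euler_mascheroni - euler_maclaurin (\<lambda>t. 1 / t) ln (\<lambda>t. (- 1) / t ^ 2) 10\<bar> \<le> 1 / 10 * (1 / (90 * (real 10 - 1) ^ 3))"
    by (intro em0.limit_approx) auto
  from abs_diff_leD[OF this] show "0.57721 \<le> (euler_mascheroni :: real)"
    using ln_small_bounds unfolding em_eval_eqs by (simp add: ln_10_eq)
qed

lemma power_bounds:
  fixes x :: real
  assumes "a \<le> x" "x \<le> b" "0 \<le> a"
  shows "a ^ n \<le> x ^ n" "x ^ n \<le> b ^ n"
  using assms by (auto intro!: power_mono)

lemma ln_6_bounds: "1.79175946 \<le> ln (6::real)" "ln (6::real) \<le> 1.79175949"
  and ln_10_bounds: "2.30258508 \<le> ln (10::real)" "ln (10::real) \<le> 2.30258514"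
  and ln_4_bounds: "1.38629436 \<le> ln (4::real)" "ln (4::real) \<le> 1.38629438"
  and ln_8_bounds: "2.07944154 \<le> ln (8::real)" "ln (8::real) \<le> 2.07944157"
  and ln_9_bounds: "2.19722456 \<le> ln (9::real)" "ln (9::real) \<le> 2.1972246"
  using ln_small_bounds unfolding ln_small_eqs by simp_all

text \<open>The tangent at 2 together with \<open>ln 2 < 1\<close> gives
  \<open>ln u \<le> u / 2\<close>, taken at \<open>u = sqrt t\<close>. It controls the quadratic in
  \<open>ln t\<close> in the fourth derivative for the second Stieltjes constant.\<close>

lemma ln_square_le_self:
  fixes t :: real
  assumes "t \<ge> 1"
  shows "ln t ^ 2 \<le> t"
proof -
  have "ln (sqrt t) \<le> ln 2 + ln (sqrt t / 2)" using assms by (simp add: ln_div)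
  also have "ln (sqrt t / 2) \<le> sqrt t / 2 - 1" using assms by (intro ln_le_minus_one) auto
  finally have "ln (sqrt t) \<le> sqrt t / 2" using ln_2_bounds by simp
  hence "ln t \<le> sqrt t" using assms by (simp add: ln_sqrt)
  hence "ln t ^ 2 \<le> sqrt t ^ 2" using assms by (intro power_mono) auto
  thus ?thesis using assms by simp
qed

lemma stieltjes_1_bounds: "- 0.072832 \<le> stieltjes 1" "stieltjes 1 \<le> - 0.072799"
proof -
  have "\<bar>(24 * ln t - 50) / t ^ 5\<bar> \<le> 24 / t ^ 4" if t: "t \<ge> 10" for t :: real
  proof -
    have "ln t \<le> t - 1" using t by (intro ln_le_minus_one) auto
    moreover have "ln t \<ge> 0" using t by simp
    ultimately have "\<bar>24 * ln t - 50\<bar> \<le> 24 * t" using t by linarith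
    hence "\<bar>24 * ln t - 50\<bar> / t ^ 5 \<le> 24 * t / t ^ 5" using t by (intro divide_right_mono) auto
    also have "\<dots> = 24 / t ^ 4" using t by (simp add: eval_nat_numeral)
    finally show ?thesis using t by simp
  qed
  hence "\<bar>stieltjes 1 - euler_maclaurin (\<lambda>t. ln t / t) (\<lambda>t. ln t ^ 2 / 2) (\<lambda>t. (1 - ln t) / t ^ 2) 10\<bar>
      \<le> 1 * (1 / (90 * (real 10 - 1) ^ 3))"
    by (intro em1.limit_approx) auto
  \<comment> \<open>Here 65610 is 90 * 9 ^ 3; this truncation error accounts for most of the width
    of the final enclosure.\<close>
  hence "\<bar>stieltjes 1 - euler_maclaurin (\<lambda>t. ln t / t) (\<lambda>t. ln t ^ 2 / 2) (\<lambda>t. (1 - ln t) / t ^ 2) 10\<bar>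
      \<le> 1 / 65610" by simp
  note b = abs_diff_leD[OF this[unfolded em_eval_eqs]]
  have "(5.301897::real) \<le> ln 10 ^ 2" "ln 10 ^ 2 \<le> (5.3018985 :: real)"
    using power_bounds[OF ln_10_bounds, of 2] by (simp_all add: power_divide)
  note bounds = this[simplified] ln_small_bounds[simplified] ln_6_bounds[simplified] ln_10_bounds[simplified]
    ln_4_bounds[simplified] ln_8_bounds[simplified] ln_9_bounds[simplified]
  have "- (72832 / 1000000) \<le> stieltjes 1" "stieltjes 1 \<le> - (72799 / 1000000)"
    using b bounds by argo+
  thus "- 0.072832 \<le> stieltjes 1" "stieltjes 1 \<le> - 0.072799" by simp_all
qed

lemma stieltjes_2_bounds: "- 0.009708 \<le> stieltjes 2" "stieltjes 2 \<le> - 0.009674"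
proof -
  have "\<bar>(70 - 100 * ln t + 24 * ln t ^ 2) / t ^ 5\<bar> \<le> 24 / t ^ 4" if t: "t \<ge> 10" for t :: real
  proof -
    have "ln 10 \<le> ln t" using t by simp
    hence l: "ln t \<ge> 2" using ln_10_bounds by simp
    have "ln t ^ 2 \<le> t" using t by (intro ln_square_le_self) auto
    moreover have "0 \<le> 24 * (ln t - 25 / 12) ^ 2" by simp
    hence "100 * ln t - 24 * ln t ^ 2 \<le> 105" by (simp add: power2_eq_square algebra_simps)
    ultimately have "\<bar>70 - 100 * ln t + 24 * ln t ^ 2\<bar> \<le> 24 * t"
      using t l by (auto simp: abs_le_iff)
    hence "\<bar>70 - 100 * ln t + 24 * ln t ^ 2\<bar> / t ^ 5 \<le> 24 * t / t ^ 5" using t by (intro divide_right_mono) auto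
    also have "\<dots> = 24 / t ^ 4" using t by (simp add: eval_nat_numeral)
    finally show ?thesis using t by simp
  qed
  hence "\<bar>stieltjes 2 - euler_maclaurin (\<lambda>t. ln t ^ 2 / t) (\<lambda>t. ln t ^ 3 / 3) (\<lambda>t. (2 * ln t - ln t ^ 2) / t ^ 2) 10\<bar>
      \<le> 1 * (1 / (90 * (real 10 - 1) ^ 3))"
    by (intro em2.limit_approx) auto
  hence "\<bar>stieltjes 2 - euler_maclaurin (\<lambda>t. ln t ^ 2 / t) (\<lambda>t. ln t ^ 3 / 3) (\<lambda>t. (2 * ln t - ln t ^ 2) / t ^ 2) 10\<bar>
      \<le> 1 / 65610" by simp
  note b = abs_diff_leD[OF this[unfolded em_eval_eqs]]
  have "(0.4804530::real) \<le> ln 2 ^ 2" "ln 2 ^ 2 \<le> (0.4804531 :: real)"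
    "(1.2069489::real) \<le> ln 3 ^ 2" "ln 3 ^ 2 \<le> (1.2069490 :: real)"
    "(1.9218120::real) \<le> ln 4 ^ 2" "ln 4 ^ 2 \<le> (1.9218122 :: real)"
    "(2.5902903::real) \<le> ln 5 ^ 2" "ln 5 ^ 2 \<le> (2.5902906 :: real)"
    "(3.2104019::real) \<le> ln 6 ^ 2" "ln 6 ^ 2 \<le> (3.2104021 :: real)"
    "(3.7865661::real) \<le> ln 7 ^ 2" "ln 7 ^ 2 \<le> (3.7865666 :: real)"
    "(4.3240771::real) \<le> ln 8 ^ 2" "ln 8 ^ 2 \<le> (4.3240773 :: real)"
    "(4.8277957::real) \<le> ln 9 ^ 2" "ln 9 ^ 2 \<le> (4.8277960 :: real)"
    "(5.301897::real) \<le> ln 10 ^ 2" "ln 10 ^ 2 \<le> (5.3018985 :: real)"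
    "(12.208071::real) \<le> ln 10 ^ 3" "ln 10 ^ 3 \<le> (12.208073 :: real)"
    using power_bounds[OF ln_2_bounds, of 2] power_bounds[OF ln_3_bounds, of 2]
    power_bounds[OF ln_4_bounds, of 2] power_bounds[OF ln_5_bounds, of 2]
    power_bounds[OF ln_6_bounds, of 2] power_bounds[OF ln_7_bounds, of 2]
    power_bounds[OF ln_8_bounds, of 2] power_bounds[OF ln_9_bounds, of 2]
    power_bounds[OF ln_10_bounds, of 2] power_bounds[OF ln_10_bounds, of 3]
    by (simp_all add: power_divide)
  note bounds = this[simplified] ln_10_bounds[simplified]
  have "- (9708 / 1000000) \<le> stieltjes 2" "stieltjes 2 \<le> - (9674 / 1000000)"
    using b bounds by argo+
  thus "- 0.009708 \<le> stieltjes 2" "stieltjes 2 \<le> - 0.009674" by simp_all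
qed

lemma main_term_coefficient_bounds:
  fixes \<gamma> \<gamma>\<^sub>1 \<gamma>\<^sub>2 :: real
  assumes "\<gamma> = euler_mascheroni" "\<gamma>\<^sub>1 = stieltjes 1" "\<gamma>\<^sub>2 = stieltjes 2"
  shows "0.654 \<le> 2 * \<gamma> - 1 / 2" "2 * \<gamma> - 1 / 2 < 0.655"
    and "0.981 \<le> 6 * \<gamma>^2 - 4 * \<gamma> - 4 * \<gamma>\<^sub>1 + 1" "6 * \<gamma>^2 - 4 * \<gamma> - 4 * \<gamma>\<^sub>1 + 1 < 0.982"
    and "0.272 \<le> 4 * \<gamma>^3 - 6 * \<gamma>^2 + 4 * \<gamma> - 12 * \<gamma> * \<gamma>\<^sub>1 + 4 * \<gamma>\<^sub>1 + 2 * \<gamma>\<^sub>2 - 1"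
    and "4 * \<gamma>^3 - 6 * \<gamma>^2 + 4 * \<gamma> - 12 * \<gamma> * \<gamma>\<^sub>1 + 4 * \<gamma>\<^sub>1 + 2 * \<gamma>\<^sub>2 - 1 < 0.273"
proof -
  have g: "0.57721 \<le> \<gamma>" "\<gamma> \<le> 0.57722" using euler_mascheroni_bounds_5 assms by auto
  have g1: "0.072799 \<le> - \<gamma>\<^sub>1" "- \<gamma>\<^sub>1 \<le> 0.072832" using stieltjes_1_bounds assms by auto
  have g2: "- 0.009708 \<le> \<gamma>\<^sub>2" "\<gamma>\<^sub>2 \<le> - 0.009674" using stieltjes_2_bounds assms by auto
  note sq = power_bounds[OF g, of 2] and cu = power_bounds[OF g, of 3]
  have "0.072799 * (12 * 0.57721 - 4) \<le> (- \<gamma>\<^sub>1) * (12 * \<gamma> - 4)" using g g1 by (intro mult_mono) auto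
  moreover have "(- \<gamma>\<^sub>1) * (12 * \<gamma> - 4) \<le> 0.072832 * (12 * 0.57722 - 4)" using g g1 by (intro mult_mono) auto
  ultimately have p: "0.21304 \<le> 4 * \<gamma>\<^sub>1 - 12 * (\<gamma> * \<gamma>\<^sub>1)" "4 * \<gamma>\<^sub>1 - 12 * (\<gamma> * \<gamma>\<^sub>1) \<le> 0.21316"
    by (simp_all add: algebra_simps)
  show "0.654 \<le> 2 * \<gamma> - 1 / 2" "2 * \<gamma> - 1 / 2 < 0.655" using g by simp_all
  show "0.981 \<le> 6 * \<gamma>^2 - 4 * \<gamma> - 4 * \<gamma>\<^sub>1 + 1" "6 * \<gamma>^2 - 4 * \<gamma> - 4 * \<gamma>\<^sub>1 + 1 < 0.982"
    using g g1 sq by (simp_all add: power_divide)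
  show "0.272 \<le> 4 * \<gamma>^3 - 6 * \<gamma>^2 + 4 * \<gamma> - 12 * \<gamma> * \<gamma>\<^sub>1 + 4 * \<gamma>\<^sub>1 + 2 * \<gamma>\<^sub>2 - 1"
    "4 * \<gamma>^3 - 6 * \<gamma>^2 + 4 * \<gamma> - 12 * \<gamma> * \<gamma>\<^sub>1 + 4 * \<gamma>\<^sub>1 + 2 * \<gamma>\<^sub>2 - 1 < 0.273"
    using g g2 sq cu p by (simp_all add: power_divide mult.assoc)
qed

section \<open>The Dirichlet divisor problem\<close>

definition hyperbola_region :: "real \<Rightarrow> (nat \<times> nat) set" where
  "hyperbola_region x = {(u, v). 1 \<le> u \<and> 1 \<le> v \<and> real u * real v \<le> x}"

lemma hyperbola_region_eq_Sigma: "hyperbola_region x = Sigma (pos_upto x) (\<lambda>u. pos_upto (x / real u))"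
proof -
  have "real u \<le> x" if "1 \<le> v" "real u * real v \<le> x" for u v :: nat
    using that mult_left_mono[of 1 "real v" "real u"] by simp
  thus ?thesis by (auto simp: hyperbola_region_def pos_upto_iff field_simps)
qed

lemma finite_hyperbola_region [simp, intro]: "finite (hyperbola_region x)"
  unfolding hyperbola_region_eq_Sigma by auto

text \<open>If \<open>u * v \<le> y * y\<close> then \<open>u \<le> y\<close> or
  \<open>v \<le> y\<close>, and both together describe a square: inclusion-exclusion. Neither
  symmetry nor a product form of \<open>F\<close> is assumed, so weights such as
  \<open>ln (u * v)\<close> are covered.\<close>

lemma dirichlet_hyperbola:
  fixes F :: "nat \<Rightarrow> nat \<Rightarrow> real"
  assumes y: "0 \<le> y" and x: "x = y * y"
  shows "(\<Sum>(u, v)\<in>hyperbola_region x. F u v) =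
           (\<Sum>u\<in>pos_upto y. \<Sum>v\<in>pos_upto (x / real u). F u v)
         + (\<Sum>v\<in>pos_upto y. \<Sum>u\<in>pos_upto (x / real v). F u v)
         - (\<Sum>u\<in>pos_upto y. \<Sum>v\<in>pos_upto y. F u v)"
proof -
  define A where "A = Sigma (pos_upto y) (\<lambda>u. pos_upto (x / real u))"
  define B where "B = prod.swap ` Sigma (pos_upto y) (\<lambda>v. pos_upto (x / real v))"
  have fin: "finite A" "finite B" by (auto simp: A_def B_def)
  have cover: "real u \<le> y \<or> real v \<le> y" if "real u * real v \<le> x" for u v :: nat
    using that y unfolding x by (meson mult_strict_mono not_le order_le_less_trans of_nat_0_le_iff)
  have "A \<union> B = hyperbola_region x"
    unfolding A_def B_def hyperbola_region_def
    by (auto simp: pos_upto_iff field_simps image_iff dest: cover)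
  moreover have "A \<inter> B = pos_upto y \<times> pos_upto y"
  proof -
    have "real u * real v \<le> x" if "real u \<le> y" "real v \<le> y" for u v :: nat
      unfolding x using that y by (intro mult_mono) auto
    thus ?thesis unfolding A_def B_def
      by (auto simp: pos_upto_iff field_simps image_iff)
  qed
  moreover have "(\<Sum>(u, v)\<in>B. F u v) = (\<Sum>v\<in>pos_upto y. \<Sum>u\<in>pos_upto (x / real v). F u v)"
    unfolding B_def
    by (subst sum.reindex) (auto simp: inj_on_def sum.Sigma case_prod_unfold intro!: sum.cong)
  moreover have "(\<Sum>(u, v)\<in>A. F u v) = (\<Sum>u\<in>pos_upto y. \<Sum>v\<in>pos_upto (x / real u). F u v)"
    unfolding A_def by (subst sum.Sigma) auto
  moreover have "(\<Sum>(u, v)\<in>pos_upto y \<times> pos_upto y. F u v) = (\<Sum>u\<in>pos_upto y. \<Sum>v\<in>pos_upto y. F u v)"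
    by (subst sum.cartesian_product) auto
  ultimately show ?thesis
    using sum.union_inter[OF fin, of "\<lambda>(u, v). F u v"] by simp
qed

definition divisor_pairs :: "nat \<Rightarrow> (nat \<times> nat) set" where
  "divisor_pairs n = {(u, v). u > 0 \<and> v > 0 \<and> u * v = n}"

lemma finite_divisor_pairs [simp, intro]: "finite (divisor_pairs n)"
proof -
  have "divisor_pairs n \<subseteq> {..n} \<times> {..n}" by (auto simp: divisor_pairs_def)
  thus ?thesis using finite_subset by blast
qed

lemma sum_hyperbola_region:
  fixes F :: "nat \<Rightarrow> nat \<Rightarrow> real"
  shows "(\<Sum>n\<in>pos_upto x. \<Sum>(u, v)\<in>divisor_pairs n. F u v) = (\<Sum>(u, v)\<in>hyperbola_region x. F u v)"
proof -
  have "divisor_pairs n = {p \<in> hyperbola_region x. (\<lambda>(u, v). u * v) p = n}" if "n \<in> pos_upto x" for n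
    using that by (auto simp: divisor_pairs_def hyperbola_region_def pos_upto_iff simp flip: of_nat_mult)
  hence "(\<Sum>n\<in>pos_upto x. \<Sum>(u, v)\<in>divisor_pairs n. F u v)
     = (\<Sum>n\<in>pos_upto x. \<Sum>(u, v)\<in>{p \<in> hyperbola_region x. (\<lambda>(u, v). u * v) p = n}. F u v)"
    by (intro sum.cong) auto
  also have "\<dots> = (\<Sum>(u, v)\<in>hyperbola_region x. F u v)"
    by (rule sum.group, simp, simp) (auto simp: hyperbola_region_def pos_upto_iff simp flip: of_nat_mult)
  finally show ?thesis .
qed

definition d2 :: "nat \<Rightarrow> nat" where
  "d2 n = card (divisor_pairs n)"

lemma sum_d2_mult:
  "(\<Sum>n\<in>pos_upto x. real (d2 n) * g n) = (\<Sum>(u, v)\<in>hyperbola_region x. g (u * v))"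
proof -
  have "(\<Sum>(u, v)\<in>divisor_pairs n. g (u * v)) = (\<Sum>p\<in>divisor_pairs n. g n)" for n
    by (intro sum.cong) (auto simp: divisor_pairs_def)
  hence "real (d2 n) * g n = (\<Sum>(u, v)\<in>divisor_pairs n. g (u * v))" for n
    by (simp add: d2_def)
  thus ?thesis using sum_hyperbola_region[of "\<lambda>u v. g (u * v)"] by simp
qed

text \<open>Group the four factors as \<open>(a * b) * (c * d)\<close>: a quadruple is a
  factorisation \<open>n = u * v\<close> together with factorisations of \<open>u\<close> and of
  \<open>v\<close>.\<close>

lemma d4_eq_sum: "d4 n = (\<Sum>(u, v)\<in>divisor_pairs n. d2 u * d2 v)"
proof -
  have "bij_betw (\<lambda>(a, b, c, d). ((a * b, c * d), ((a, b), (c, d))))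
          {(a, b, c, d). a > 0 \<and> b > 0 \<and> c > 0 \<and> d > 0 \<and> a * b * c * d = n}
          (Sigma (divisor_pairs n) (\<lambda>(u, v). divisor_pairs u \<times> divisor_pairs v))"
    by (rule bij_betwI[where g = "\<lambda>(_, ((a, b), (c, d))). (a, b, c, d)"])
       (auto simp: divisor_pairs_def mult.assoc)
  hence "d4 n = card (Sigma (divisor_pairs n) (\<lambda>(u, v). divisor_pairs u \<times> divisor_pairs v))"
    unfolding d4_def by (rule bij_betw_same_card)
  also have "\<dots> = (\<Sum>(u, v)\<in>divisor_pairs n. d2 u * d2 v)"
    by (subst card_SigmaI) (auto simp: d2_def card_cartesian_product intro!: sum.cong)
  finally show ?thesis .
qed

definition D2 :: "real \<Rightarrow> real" where "D2 = summatory (\<lambda>n. real (d2 n))"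
definition D4 :: "real \<Rightarrow> real" where "D4 = summatory (\<lambda>n. real (d4 n))"

lemma D2_hyperbola:
  assumes "0 \<le> y" "x = y * y"
  shows "D2 x = 2 * (\<Sum>u\<in>pos_upto y. real_of_int \<lfloor>x / real u\<rfloor>) - real_of_int \<lfloor>y\<rfloor> ^ 2"
proof -
  have x: "x \<ge> 0" using assms by simp
  have card: "real (card (pos_upto t)) = real_of_int \<lfloor>t\<rfloor>" if "t \<ge> 0" for t
    using that by (simp add: pos_upto_eq)
  have "D2 x = (\<Sum>(u, v)\<in>hyperbola_region x. 1)"
    using sum_d2_mult[where g = "\<lambda>_. 1"] by (simp add: D2_def summatory_def case_prod_unfold)
  also have "\<dots> = 2 * (\<Sum>u\<in>pos_upto y. real_of_int \<lfloor>x / real u\<rfloor>) - real_of_int \<lfloor>y\<rfloor> ^ 2"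
    using x assms(1) by (subst dirichlet_hyperbola[OF assms]) (simp add: card power2_eq_square)
  finally show ?thesis .
qed

lemma D4_hyperbola:
  assumes "0 \<le> y" "x = y * y"
  shows "D4 x = 2 * (\<Sum>u\<in>pos_upto y. real (d2 u) * D2 (x / real u)) - D2 y ^ 2"
proof -
  have "D4 x = (\<Sum>(u, v)\<in>hyperbola_region x. real (d2 u) * real (d2 v))"
    using sum_hyperbola_region[of "\<lambda>u v. real (d2 u) * real (d2 v)" x]
    by (simp add: D4_def summatory_def d4_eq_sum case_prod_unfold)
  also have "\<dots> = 2 * (\<Sum>u\<in>pos_upto y. real (d2 u) * D2 (x / real u)) - D2 y ^ 2"
    by (subst dirichlet_hyperbola[OF assms])
       (simp add: D2_def summatory_def power2_eq_square sum_product sum_distrib_left mult.commute)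
  finally show ?thesis .
qed

definition D2_main :: "real \<Rightarrow> real" where
  "D2_main t = t * ln t + (2 * euler_mascheroni - 1) * t"

text \<open>The lower bound is \<open>limit_le\<close> for \<open>1 / t\<close>, whose fourth
  derivative is positive; keeping the term \<open>1 / (2 * m)\<close> on both sides is essential,
  since it is later multiplied by \<open>2 * t\<close>.\<close>

lemma harm_bounds:
  assumes "m \<ge> 2"
  shows "harm m \<le> ln (real m) + euler_mascheroni + 1 / (2 * real m)"
    and "harm m \<ge> ln (real m) + euler_mascheroni + 1 / (2 * real m) - 1 / (12 * real m ^ 2)"
proof -
  obtain n where m: "m = Suc (Suc n)" using assms by (metis Suc_le_D numeral_2_eq_2 Suc_le_mono)
  have "harm m = harm (Suc n) + 1 / real m" by (simp add: m harm_Suc inverse_eq_divide)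
  moreover have "harm (Suc n) - ln (real m) + 1 / (2 * real m) \<le> euler_mascheroni"
    using euler_mascheroni_lower[of n] by (simp add: m)
  ultimately show "harm m \<le> ln (real m) + euler_mascheroni + 1 / (2 * real m)"
    by (simp add: field_simps)
  have "euler_mascheroni \<le> euler_maclaurin (\<lambda>t. 1 / t) ln (\<lambda>t. (- 1) / t ^ 2) m"
    by (rule em0.limit_le) (use assms in auto)
  thus "harm m \<ge> ln (real m) + euler_mascheroni + 1 / (2 * real m) - 1 / (12 * real m ^ 2)"
    by (simp add: euler_maclaurin_def harm_def inverse_eq_divide mult.commute)
qed

lemma ln_1_plus_ge: "0 \<le> u \<Longrightarrow> u - u ^ 2 / 2 \<le> ln (1 + u)" for u :: real
proof -
  assume u: "0 \<le> u"
  have "(\<lambda>t. ln (1 + t) - (t - t ^ 2 / 2)) 0 \<le> (\<lambda>t. ln (1 + t) - (t - t ^ 2 / 2)) u"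
  proof (rule DERIV_nonneg_imp_nondecreasing[OF u])
    fix t :: real assume t: "0 \<le> t"
    have "((\<lambda>t. ln (1 + t) - (t - t ^ 2 / 2)) has_real_derivative 1 / (1 + t) - (1 - t)) (at t)"
      using t by (auto intro!: derivative_eq_intros)
    moreover have "1 / (1 + t) - (1 - t) = t ^ 2 / (1 + t)"
      using t by (simp add: field_simps power2_eq_square)
    ultimately show "\<exists>y. ((\<lambda>t. ln (1 + t) - (t - t ^ 2 / 2)) has_real_derivative y) (at t) \<and> 0 \<le> y"
      using t by (intro exI[of _ "t ^ 2 / (1 + t)"]) auto
  qed
  thus ?thesis by simp
qed

lemma ln_1_plus_le: "0 \<le> u \<Longrightarrow> ln (1 + u) \<le> u - u ^ 2 / 2 + u ^ 3 / 3" for u :: real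
proof -
  assume u: "0 \<le> u"
  have "(\<lambda>t. t - t ^ 2 / 2 + t ^ 3 / 3 - ln (1 + t)) 0 \<le> (\<lambda>t. t - t ^ 2 / 2 + t ^ 3 / 3 - ln (1 + t)) u"
  proof (rule DERIV_nonneg_imp_nondecreasing[OF u])
    fix t :: real assume t: "0 \<le> t"
    have "((\<lambda>t. t - t ^ 2 / 2 + t ^ 3 / 3 - ln (1 + t)) has_real_derivative 1 - t + t ^ 2 - 1 / (1 + t)) (at t)"
      using t by (auto intro!: derivative_eq_intros)
    moreover have "1 - t + t ^ 2 - 1 / (1 + t) = t ^ 3 / (1 + t)"
      using t by (simp add: field_simps power2_eq_square power3_eq_cube)
    ultimately show "\<exists>y. ((\<lambda>t. t - t ^ 2 / 2 + t ^ 3 / 3 - ln (1 + t)) has_real_derivative y) (at t) \<and> 0 \<le> y"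
      using t by (intro exI[of _ "t ^ 3 / (1 + t)"]) auto
  qed
  thus ?thesis by simp
qed

text \<open>Write \<open>t = (m + \<theta>)\<^sup>2\<close> with \<open>m = \<lfloor>sqrt t\<rfloor>\<close>. The hyperbola method leaves an error of at most
  \<open>m\<close> from the fractional parts, plus a bounded amount that the factor \<open>1.1\<close> absorbs once \<open>m \<ge> 2\<close>.\<close>

lemma D2_error_bound_large:
  assumes m: "m \<ge> 2" and th: "0 \<le> \<theta>" "\<theta> < 1" and t: "t = (real m + \<theta>) ^ 2"
  shows "\<bar>D2 t - D2_main t\<bar> \<le> 1.1 * (real m + \<theta>)"
proof -
  define u where "u = \<theta> / real m"
  define M where "M = real m"
  have M: "M \<ge> 2" using m by (simp add: M_def)
  have th_eq: "\<theta> = M * u" using M by (simp add: u_def M_def)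
  have u: "0 \<le> u" "u \<le> 1 / 2"
    using th M by (auto simp: u_def M_def[symmetric] field_simps)
  define y where "y = M + \<theta>"
  have y: "y = M * (1 + u)" by (simp add: y_def th_eq algebra_simps)
  have y0: "y > 0" using th M by (simp add: y_def)
  have ty: "t = y * y" by (simp add: t y_def M_def power2_eq_square)
  have fl: "\<lfloor>y\<rfloor> = int m" unfolding y_def M_def using th by linarith
  have py: "pos_upto y = {1..m}" unfolding y_def M_def by (rule pos_upto_eq_step) (use th in auto)
  have harm_eq: "(\<Sum>k\<in>{1..m}. t / real k) = t * harm m"
    by (simp add: harm_def sum_distrib_left divide_inverse)
  have D: "D2 t = 2 * (\<Sum>k\<in>{1..m}. real_of_int \<lfloor>t / real k\<rfloor>) - M ^ 2"
    using D2_hyperbola[of y t] y0 by (simp add: ty fl py M_def)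
  have "(\<Sum>k\<in>{1..m}. real_of_int \<lfloor>t / real k\<rfloor>) \<le> (\<Sum>k\<in>{1..m}. t / real k)"
    by (intro sum_mono) auto
  hence up: "D2 t \<le> 2 * t * harm m - M ^ 2" unfolding D harm_eq by simp
  have "(\<Sum>k\<in>{1..m}. t / real k - 1) \<le> (\<Sum>k\<in>{1..m}. real_of_int \<lfloor>t / real k\<rfloor>)"
    by (intro sum_mono) linarith
  hence "t * harm m - M \<le> (\<Sum>k\<in>{1..m}. real_of_int \<lfloor>t / real k\<rfloor>)"
    unfolding sum_subtractf harm_eq by (simp add: M_def)
  hence lo: "D2 t \<ge> 2 * t * harm m - 2 * M - M ^ 2" unfolding D by simp
  have t0: "t \<ge> 0" by (simp add: t)
  have lny: "ln t = 2 * ln M + 2 * ln (1 + u)"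
    unfolding ty y using M u by (simp add: ln_mult)
  have main: "D2_main t = t * (2 * ln M + 2 * euler_mascheroni + 2 * ln (1 + u) - 1)"
    unfolding D2_main_def lny by (simp add: algebra_simps)
  have tu: "t = M ^ 2 * (1 + u) ^ 2" unfolding ty y by (simp add: power2_eq_square)
  have h: "harm m \<le> ln M + euler_mascheroni + 1 / (2 * M)"
    "harm m \<ge> ln M + euler_mascheroni + 1 / (2 * M) - 1 / (12 * M ^ 2)"
    using harm_bounds[OF m] by (simp_all add: M_def)
  have Mth: "\<theta> ^ 2 / M \<le> \<theta> ^ 2 / 2" "\<theta> ^ 4 / M ^ 2 \<le> \<theta> ^ 2 / 4"
  proof -
    show "\<theta> ^ 2 / M \<le> \<theta> ^ 2 / 2" using M by (intro divide_left_mono) auto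
    have "\<theta> ^ 4 \<le> \<theta> ^ 2" using th by (intro power_decreasing) auto
    hence "\<theta> ^ 4 / M ^ 2 \<le> \<theta> ^ 2 / M ^ 2" using M by (intro divide_right_mono) auto
    also have "\<dots> \<le> \<theta> ^ 2 / 2 ^ 2" using M by (intro divide_left_mono power_mono mult_pos_pos) auto
    finally show "\<theta> ^ 4 / M ^ 2 \<le> \<theta> ^ 2 / 4" by simp
  qed
  have "D2 t - D2_main t \<le> 2 * t * (ln M + euler_mascheroni + 1 / (2 * M)) - M ^ 2 - D2_main t"
    using up mult_left_mono[OF h(1), of "2 * t"] t0 by simp
  also have "\<dots> = t + t / M - M ^ 2 - 2 * t * ln (1 + u)"
    unfolding main by (simp add: algebra_simps)
  also have "\<dots> \<le> t + t / M - M ^ 2 - 2 * t * (u - u ^ 2 / 2)"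
    using mult_left_mono[OF ln_1_plus_ge[OF u(1)], of "2 * t"] t0 by simp
  also have "\<dots> = M + 2 * \<theta> + \<theta> ^ 2 / M - 2 * \<theta> ^ 2 + \<theta> ^ 4 / M ^ 2"
    unfolding tu th_eq using M by (simp add: field_simps eval_nat_numeral)
  \<comment> \<open>With \<open>M \<ge> 2\<close> the coefficients combine to 1/2 - 2 + 1/4 =
    -5/4.\<close>
  also have "\<dots> \<le> M + 2 * \<theta> - 5 / 4 * \<theta> ^ 2" using Mth by linarith
  also have "\<dots> \<le> 1.1 * (M + \<theta>)"
  proof -
    \<comment> \<open>The excess \<open>0.9 * \<theta> - 1.25 * \<theta> ^ 2\<close> is largest at
      9/25, where it is 0.162, below \<open>0.1 * M\<close> because
      \<open>M \<ge> 2\<close>.\<close>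
    have "0 \<le> 5 / 4 * (\<theta> - 9 / 25) ^ 2" by simp
    thus ?thesis using M by (simp add: power2_eq_square algebra_simps)
  qed
  finally have 1: "D2 t - D2_main t \<le> 1.1 * (M + \<theta>)" .

  have "D2_main t - D2 t \<le> D2_main t - (2 * t * (ln M + euler_mascheroni + 1 / (2 * M) - 1 / (12 * M ^ 2)) - 2 * M - M ^ 2)"
    using lo mult_left_mono[OF h(2), of "2 * t"] t0 by simp
  also have "\<dots> = 2 * t * ln (1 + u) + 2 * M + M ^ 2 - t - t / M + t / (6 * M ^ 2)"
    unfolding main by (simp add: algebra_simps)
  also have "\<dots> \<le> 2 * t * (u - u ^ 2 / 2 + u ^ 3 / 3) + 2 * M + M ^ 2 - t - t / M + t / (6 * M ^ 2)"
    using mult_left_mono[OF ln_1_plus_le[OF u(1)], of "2 * t"] t0 by simp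
  also have "\<dots> = M - 2 * \<theta> - \<theta> ^ 2 / M + 2 * \<theta> ^ 2 - \<theta> ^ 4 / M ^ 2 + 2 / 3 * (\<theta> ^ 3 / M) * (1 + u) ^ 2 + (1 + u) ^ 2 / 6"
    unfolding tu th_eq using M by (simp add: field_simps eval_nat_numeral)
  \<comment> \<open>The cubic term costs at most \<open>3 / 2 * (\<theta> ^ 2 / M)\<close>; after
    \<open>- \<theta> ^ 2 / M\<close> there remains at most \<open>\<theta> ^ 2 / 4\<close>. The
    other new terms bound \<open>(1 + u) ^ 2 / 6\<close>.\<close>
  also have "\<dots> \<le> M - 2 * \<theta> + 9 / 4 * \<theta> ^ 2 + 1 / 6 + \<theta> / 6 + \<theta> / 24"
  proof -
    have u': "u \<le> \<theta> / 2" unfolding u_def M_def[symmetric] using M th by (intro divide_left_mono) auto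
    have "(1 + u) ^ 2 \<le> (1 + \<theta> / 2) ^ 2" using u' u by (intro power_mono) auto
    also have "\<dots> = 1 + \<theta> + \<theta> * \<theta> / 4" by (simp add: power2_eq_square algebra_simps)
    also have "\<theta> * \<theta> \<le> \<theta> * 1" using th by (intro mult_left_mono) auto
    finally have a: "(1 + u) ^ 2 \<le> 1 + \<theta> + \<theta> / 4" by simp
    hence "(1 + u) ^ 2 \<le> 9 / 4" using th by simp
    hence "\<theta> ^ 3 / M * (1 + u) ^ 2 \<le> \<theta> ^ 3 / M * (9 / 4)" using th M by (intro mult_left_mono) auto
    also have "\<theta> ^ 3 / M \<le> \<theta> ^ 2 / M" using th M by (intro divide_right_mono power_decreasing) auto
    finally have "2 / 3 * (\<theta> ^ 3 / M) * (1 + u) ^ 2 \<le> 3 / 2 * (\<theta> ^ 2 / M)" by simp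
    moreover have "\<theta> ^ 4 / M ^ 2 \<ge> 0" by simp
    ultimately show ?thesis using a Mth(1) by argo
  qed
  also have "\<dots> \<le> 1.1 * (M + \<theta>)"
  proof -
    have "\<theta> * \<theta> \<le> \<theta> * 1" using th by (intro mult_left_mono) auto
    thus ?thesis using M th by (simp add: power2_eq_square)
  qed
  finally have "D2_main t - D2 t \<le> 1.1 * (M + \<theta>)" .
  with 1 show ?thesis unfolding M_def by (intro abs_leI) simp_all
qed

text \<open>Here \<open>\<lfloor>sqrt t\<rfloor>\<close> is 1, outside the range of
  \<open>harm_bounds\<close>, but then \<open>D2 t = 2 * \<lfloor>t\<rfloor> - 1\<close> is
  explicit.\<close>

lemma D2_error_bound_small:
  assumes t: "1 \<le> t" "t < 4"
  shows "\<bar>D2 t - D2_main t\<bar> \<le> 1.1 * sqrt t"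
proof -
  define s where "s = sqrt t"
  have ts: "t = s * s" using t by (simp add: s_def)
  have s: "1 \<le> s" "s < 2" using t real_sqrt_less_mono[of t 4] by (auto simp: s_def)
  have fl: "\<lfloor>s\<rfloor> = 1" using s by linarith
  have p: "pos_upto s = {1..1}" by (rule pos_upto_eq_step) (use s in auto)
  have D: "D2 t = 2 * real_of_int \<lfloor>t\<rfloor> - 1"
    using D2_hyperbola[OF _ ts] s by (simp add: fl p)
  note g = euler_mascheroni_bounds_5[simplified]
  have lns: "ln t = 2 * ln s" using s by (simp add: ts ln_mult)
  \<comment> \<open>From \<open>ln v \<le> v - 1\<close> at \<open>v = 3 / 2 / s\<close>, with
    81/200 just below \<open>ln (3 / 2)\<close>; the point 3/2 lies in the middle of the range of
    \<open>s\<close>.\<close>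
  have "ln s \<ge> 81 / 200 + 1 - 3 / 2 / s"
  proof -
    have "ln (3 / 2 / s) \<le> 3 / 2 / s - 1" using s by (intro ln_le_minus_one) auto
    moreover have "ln (3 / 2 / s) = ln (3 / 2) - ln s" by (rule ln_divide_pos) (use s in auto)
    ultimately show ?thesis using ln_3_div_2_bounds by simp
  qed
  hence "2 * t * ln s \<ge> 2 * t * (81 / 200 + 1 - 3 / 2 / s)" using t by (intro mult_left_mono) auto
  also have "2 * t * (81 / 200 + 1 - 3 / 2 / s) = 281 / 100 * t - 3 * s" using s by (simp add: ts field_simps)
  finally have l: "t * ln t \<ge> 281 / 100 * t - 3 * s" by (simp add: lns)
  have "D2 t - D2_main t \<le> 2 * t - 1 - t * ln t - (2 * euler_mascheroni - 1) * t"
    unfolding D D2_main_def by simp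
  also have "\<dots> = t * (3 - 2 * euler_mascheroni) - t * ln t - 1" by (simp add: algebra_simps)
  also have "\<dots> \<le> t * (1.8456) - (281 / 100 * t - 3 * s) - 1"
    using t g l by (intro diff_right_mono diff_mono mult_left_mono) auto
  also have "\<dots> \<le> 1.1 * s"
  proof -
    have "0 \<le> 0.95 * (s - 1) ^ 2" by simp
    moreover have "t \<ge> 1" by fact
    ultimately show ?thesis by (simp add: ts power2_eq_square algebra_simps)
  qed
  finally have 1: "D2 t - D2_main t \<le> 1.1 * s" .
  \<comment> \<open>For the other sign, each unit interval takes the main term at its right end and
    \<open>sqrt t\<close> at its left end.\<close>
  have bound: "D2_main t \<le> b * ln b + 0.15445 * b" if "t \<le> b" "b > 0" for b
    unfolding D2_main_def using that t g by (intro add_mono mult_mono) auto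
  consider "t < 2" | "2 \<le> t" "t < 3" | "3 \<le> t" by linarith
  hence "D2_main t - D2 t \<le> 1.1 * s"
  proof cases
    case 1
    hence "\<lfloor>t\<rfloor> = 1" using t by linarith
    thus ?thesis using bound[of 2] 1 ln_2_bounds s by (simp add: D)
  next
    case 2
    hence "\<lfloor>t\<rfloor> = 2" by linarith
    moreover have "1.4 \<le> s" unfolding s_def using 2 by (intro real_le_rsqrt) (simp add: power2_eq_square)
    ultimately show ?thesis using bound[of 3] 2 ln_3_bounds by (simp add: D)
  next
    case 3
    hence "\<lfloor>t\<rfloor> = 3" using t by linarith
    moreover have "1.7 \<le> s" unfolding s_def using 3 by (intro real_le_rsqrt) (simp add: power2_eq_square)
    ultimately show ?thesis using bound[of 4] t ln_4_bounds by (simp add: D)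
  qed
  with 1 show ?thesis unfolding s_def by (intro abs_leI) simp_all
qed

lemma D2_error_bound:
  assumes "t \<ge> 1"
  shows "\<bar>D2 t - D2_main t\<bar> \<le> 1.1 * sqrt t"
proof (cases "t < 4")
  case False
  define m where "m = nat \<lfloor>sqrt t\<rfloor>"
  have "sqrt 4 \<le> sqrt t" using False by (intro real_sqrt_le_mono) auto
  hence s2: "sqrt t \<ge> 2" by simp
  hence "real m = real_of_int \<lfloor>sqrt t\<rfloor>" "m \<ge> 2" unfolding m_def by linarith+
  hence "\<bar>D2 t - D2_main t\<bar> \<le> 1.1 * (real m + (sqrt t - real m))"
    using assms by (intro D2_error_bound_large) (auto, linarith+)
  thus ?thesis by simp
qed (use D2_error_bound_small assms in auto)

section \<open>Weighted sums of the divisor function\<close>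

lemma ln_power_sum_eq:
  "ln_power_sum j y = ln y ^ Suc j / real (Suc j) + stieltjes j + ln_power_sum_err j y"
  by (simp add: ln_power_sum_err_def)

lemma ln_power_mult_err_LIMSEQ:
  assumes "k \<le> 2"
  shows "(\<lambda>w. ln (real w) ^ k * ln_power_sum_err j (real w)) \<longlonglongrightarrow> 0"
proof -
  obtain C where C: "\<And>y. y \<ge> 1 \<Longrightarrow> \<bar>ln_power_sum_err j y\<bar> \<le> C / sqrt y"
    using ln_power_sum_err_bound by blast
  have "(\<lambda>w. ln (real w) ^ k * (C / sqrt (real w))) \<longlonglongrightarrow> 0"
  proof -
    consider "k = 0" | "k = 1" | "k = 2" using assms by linarith
    thus ?thesis by cases (simp_all, (real_asymp)+)
  qed
  thus ?thesis
  proof (rule Lim_null_comparison[rotated])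
    show "eventually (\<lambda>w. norm (ln (real w) ^ k * ln_power_sum_err j (real w))
             \<le> ln (real w) ^ k * (C / sqrt (real w))) sequentially"
      using eventually_ge_at_top[of 1]
    proof eventually_elim
      case (elim w)
      have "ln (real w) ^ k \<ge> 0" using elim by simp
      hence "norm (ln (real w) ^ k * ln_power_sum_err j (real w)) = ln (real w) ^ k * \<bar>ln_power_sum_err j (real w)\<bar>"
        by (simp only: real_norm_def abs_mult abs_of_nonneg)
      also have "\<dots> \<le> ln (real w) ^ k * (C / sqrt (real w))"
        using elim by (intro mult_left_mono C) auto
      finally show ?case .
    qed
  qed
qed

text \<open>Total error from replacing the inner sums over \<open>v \<le> w * w / u\<close> by their
  expansions, with outer weight \<open>ln u ^ k / u\<close>.\<close>

definition hyperbola_err :: "nat \<Rightarrow> nat \<Rightarrow> nat \<Rightarrow> real" where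
  "hyperbola_err k j w = (\<Sum>u=1..w. ln (real u) ^ k / real u * ln_power_sum_err j (real w * real w / real u))"

text \<open>Since \<open>u \<le> w\<close>, every inner range has length at least \<open>w\<close>,
  so each error is at most \<open>C / sqrt w\<close>; the outer weights sum to only a power of
  \<open>ln w\<close>.\<close>

lemma hyperbola_err_LIMSEQ:
  assumes "k \<le> 1"
  shows "hyperbola_err k j \<longlonglongrightarrow> 0"
proof -
  obtain C where C: "C \<ge> 0" "\<And>y. y \<ge> 1 \<Longrightarrow> \<bar>ln_power_sum_err j y\<bar> \<le> C / sqrt y"
    using ln_power_sum_err_bound by blast
  have bound: "norm (hyperbola_err k j w) \<le> C / sqrt (real w) * ln_power_sum k (real w)" for w
  proof -
    have "norm (hyperbola_err k j w) \<le> (\<Sum>u=1..w. ln (real u) ^ k / real u * (C / sqrt (real w)))"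
      unfolding hyperbola_err_def
    proof (intro sum_norm_le)
      fix u assume u: "u \<in> {1..w}"
      have le: "real w \<le> real w * real w / real u" using u by (simp add: field_simps)
      have "\<bar>ln_power_sum_err j (real w * real w / real u)\<bar> \<le> C / sqrt (real w * real w / real u)"
        using u by (intro C order.trans[OF _ le]) auto
      also have "\<dots> \<le> C / sqrt (real w)"
        using u by (intro divide_left_mono real_sqrt_le_mono mult_pos_pos C le) auto
      finally show "norm (ln (real u) ^ k / real u * ln_power_sum_err j (real w * real w / real u))
          \<le> ln (real u) ^ k / real u * (C / sqrt (real w))"
        using u unfolding real_norm_def abs_mult by (intro mult_mono) auto
    qed
    thus ?thesis by (simp add: ln_power_sum_def summatory_def sum_distrib_left mult_ac)
  qed
  have "(\<lambda>w. C * (ln (real w) ^ Suc k / sqrt (real w) / real (Suc k) + stieltjes k / sqrt (real w)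
          + ln (real w) ^ 0 * ln_power_sum_err k (real w) * (1 / sqrt (real w)))) \<longlonglongrightarrow> C * (0 / real (Suc k) + 0 + 0 * 0)"
  proof (intro tendsto_mult tendsto_const tendsto_add tendsto_divide ln_power_mult_err_LIMSEQ)
    have "k = 0 \<or> k = 1" using assms by linarith
    thus "(\<lambda>w. ln (real w) ^ Suc k / sqrt (real w)) \<longlonglongrightarrow> 0" by (elim disjE; simp; real_asymp)
    show "(\<lambda>w. stieltjes k / sqrt (real w)) \<longlonglongrightarrow> 0" by real_asymp
    show "(\<lambda>w. 1 / sqrt (real w)) \<longlonglongrightarrow> 0" by real_asymp
  qed auto
  also have "(\<lambda>w. C * (ln (real w) ^ Suc k / sqrt (real w) / real (Suc k) + stieltjes k / sqrt (real w)
          + ln (real w) ^ 0 * ln_power_sum_err k (real w) * (1 / sqrt (real w))))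
     = (\<lambda>w. C / sqrt (real w) * ln_power_sum k (real w))"
    by (auto simp: ln_power_sum_eq add_divide_distrib algebra_simps simp del: of_nat_Suc)
  finally have "(\<lambda>w. C / sqrt (real w) * ln_power_sum k (real w)) \<longlonglongrightarrow> 0" by simp
  thus ?thesis using bound by (intro Lim_null_comparison[of "hyperbola_err k j"]) auto
qed

definition d2_div_sum :: "real \<Rightarrow> real" where
  "d2_div_sum = summatory (\<lambda>n. real (d2 n) * (1 / real n))"

definition d2_ln_div_sum :: "real \<Rightarrow> real" where
  "d2_ln_div_sum = summatory (\<lambda>n. real (d2 n) * (ln (real n) / real n))"

lemma inner_ln_power_sum_eq:
  assumes "u \<in> {1..w}"
  shows "ln_power_sum j (real w * real w / real u) =
     (2 * ln (real w) - ln (real u)) ^ Suc j / real (Suc j) + stieltjes j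
       + ln_power_sum_err j (real w * real w / real u)"
proof -
  have "ln (real w * real w / real u) = 2 * ln (real w) - ln (real u)"
    using assms by (simp add: ln_divide_pos ln_mult_pos)
  thus ?thesis by (simp add: ln_power_sum_eq)
qed

text \<open>An exact identity at \<open>x = w * w\<close>: the polynomial part is written in
  \<open>2 * l = ln x\<close>, and the last bracket collects everything that tends to 0.\<close>

lemma d2_div_sum_square_eq:
  assumes w: "w \<ge> 1"
  defines "l \<equiv> ln (real w)" and "a \<equiv> ln_power_sum_err 0 (real w)" and "b \<equiv> ln_power_sum_err 1 (real w)"
  shows "d2_div_sum (real w * real w) =
     (2 * l) ^ 2 / 2 + 2 * stieltjes 0 * (2 * l) + (stieltjes 0 ^ 2 - 2 * stieltjes 1)
       + (2 * (l * a) - 2 * b - a ^ 2 + 2 * hyperbola_err 0 0 w)"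
proof -
  define H where "H = ln_power_sum 0 (real w)"
  define L where "L = ln_power_sum 1 (real w)"
  have H_sum: "H = (\<Sum>u=1..w. 1 / real u)" by (simp add: H_def ln_power_sum_def summatory_def)
  have L_sum: "L = (\<Sum>u=1..w. ln (real u) / real u)" by (simp add: L_def ln_power_sum_def summatory_def)
  have inner: "(\<Sum>v\<in>pos_upto t. 1 / real (u * v)) = 1 / real u * ln_power_sum 0 t" for u t
    by (simp add: ln_power_sum_def summatory_def sum_distrib_left)
  have "d2_div_sum (real w * real w) =
      2 * (\<Sum>u=1..w. 1 / real u * ln_power_sum 0 (real w * real w / real u)) - H * H"
  proof -
    have comm: "(\<Sum>v\<in>pos_upto t. 1 / real (v * u)) = 1 / real u * ln_power_sum 0 t" for u t
      using inner[of u t] by (simp add: mult.commute)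
    have "d2_div_sum (real w * real w) =
        (\<Sum>u\<in>pos_upto (real w). 1 / real u * ln_power_sum 0 (real w * real w / real u))
      + (\<Sum>u\<in>pos_upto (real w). 1 / real u * ln_power_sum 0 (real w * real w / real u))
      - (\<Sum>u\<in>pos_upto (real w). 1 / real u * ln_power_sum 0 (real w))"
      unfolding d2_div_sum_def summatory_def sum_d2_mult
      by (subst dirichlet_hyperbola[of "real w"]) (simp_all only: inner comm of_nat_0_le_iff)
    also have "(\<Sum>u\<in>pos_upto (real w). 1 / real u * ln_power_sum 0 (real w)) = H * H"
      unfolding sum_distrib_right[symmetric] pos_upto_of_nat H_sum[symmetric] H_def[symmetric] ..
    finally show ?thesis by simp
  qed
  also have "(\<Sum>u=1..w. 1 / real u * ln_power_sum 0 (real w * real w / real u))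
     = (\<Sum>u=1..w. (2 * l + stieltjes 0) * (1 / real u) - ln (real u) / real u
          + ln (real u) ^ 0 / real u * ln_power_sum_err 0 (real w * real w / real u))"
    by (intro sum.cong refl, subst inner_ln_power_sum_eq) (auto simp: l_def add_divide_distrib diff_divide_distrib)
  also have "\<dots> = (2 * l + stieltjes 0) * H - L + hyperbola_err 0 0 w"
    unfolding sum.distrib sum_subtractf sum_distrib_left[symmetric] hyperbola_err_def H_sum L_sum ..
  also have "H = l + stieltjes 0 + a" by (simp add: H_def ln_power_sum_eq l_def a_def)
  also have "L = l ^ 2 / 2 + stieltjes 1 + b" by (simp add: L_def ln_power_sum_eq l_def b_def power2_eq_square)
  finally show ?thesis by (simp add: algebra_simps power2_eq_square)
qed

text \<open>Because \<open>ln (u * v) = ln u + ln v\<close>, the inner sums split into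
  \<open>ln_power_sum 0\<close> and \<open>ln_power_sum 1\<close>, and expanding them brings in
  \<open>ln_power_sum 2\<close>; this is how the second Stieltjes constant enters.\<close>

lemma d2_ln_div_sum_square_eq:
  assumes w: "w \<ge> 1"
  defines "l \<equiv> ln (real w)" and "a \<equiv> ln_power_sum_err 0 (real w)" and "b \<equiv> ln_power_sum_err 1 (real w)"
    and "c \<equiv> ln_power_sum_err 2 (real w)"
  shows "d2_ln_div_sum (real w * real w) =
     (2 * l) ^ 3 / 3 + stieltjes 0 * (2 * l) ^ 2 + (2 * stieltjes 0 * stieltjes 1 - stieltjes 2)
       + (3 * (l ^ 2 * a) - c - 2 * (l * b) - 2 * (a * b) + 2 * hyperbola_err 1 0 w + 2 * hyperbola_err 0 1 w)"
proof -
  define H where "H = ln_power_sum 0 (real w)"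
  define L where "L = ln_power_sum 1 (real w)"
  define Q where "Q = ln_power_sum 2 (real w)"
  have H_sum: "H = (\<Sum>u=1..w. 1 / real u)" by (simp add: H_def ln_power_sum_def summatory_def)
  have L_sum: "L = (\<Sum>u=1..w. ln (real u) / real u)" by (simp add: L_def ln_power_sum_def summatory_def)
  have Q_sum: "Q = (\<Sum>u=1..w. ln (real u) ^ 2 / real u)" by (simp add: Q_def ln_power_sum_def summatory_def)
  have inner: "(\<Sum>v\<in>pos_upto t. ln (real (u * v)) / real (u * v))
      = ln (real u) / real u * ln_power_sum 0 t + 1 / real u * ln_power_sum 1 t" if "u \<in> {1..w}" for u t
  proof -
    have "(\<Sum>v\<in>pos_upto t. ln (real (u * v)) / real (u * v))
       = (\<Sum>v\<in>pos_upto t. ln (real u) / real u * (1 / real v) + 1 / real u * (ln (real v) / real v))"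
      using that by (intro sum.cong refl) (auto simp: pos_upto_iff ln_mult_pos add_divide_distrib)
    also have "\<dots> = ln (real u) / real u * (\<Sum>v\<in>pos_upto t. 1 / real v)
        + 1 / real u * (\<Sum>v\<in>pos_upto t. ln (real v) / real v)"
      unfolding sum.distrib sum_distrib_left ..
    finally show ?thesis by (simp add: ln_power_sum_def summatory_def)
  qed
  have "d2_ln_div_sum (real w * real w) =
      2 * (\<Sum>u=1..w. ln (real u) / real u * ln_power_sum 0 (real w * real w / real u)
                     + 1 / real u * ln_power_sum 1 (real w * real w / real u))
        - (\<Sum>u=1..w. ln (real u) / real u * H + 1 / real u * L)"
  proof -
    have comm: "(\<Sum>v\<in>pos_upto t. ln (real (v * u)) / real (v * u))
      = ln (real u) / real u * ln_power_sum 0 t + 1 / real u * ln_power_sum 1 t" if "u \<in> {1..w}" for u t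
      using inner[OF that, of t] by (simp add: mult.commute)
    have "d2_ln_div_sum (real w * real w) =
        (\<Sum>u=1..w. \<Sum>v\<in>pos_upto (real w * real w / real u). ln (real (u * v)) / real (u * v))
      + (\<Sum>u=1..w. \<Sum>v\<in>pos_upto (real w * real w / real u). ln (real (v * u)) / real (v * u))
      - (\<Sum>u=1..w. \<Sum>v\<in>pos_upto (real w). ln (real (u * v)) / real (u * v))"
      unfolding d2_ln_div_sum_def summatory_def sum_d2_mult
      by (subst dirichlet_hyperbola[of "real w"]) (simp_all only: of_nat_0_le_iff pos_upto_of_nat)
    also have "(\<Sum>u=1..w. \<Sum>v\<in>pos_upto (real w). ln (real (u * v)) / real (u * v))
      = (\<Sum>u=1..w. ln (real u) / real u * H + 1 / real u * L)"
      unfolding H_def L_def by (intro sum.cong refl inner)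
    also have "(\<Sum>u=1..w. \<Sum>v\<in>pos_upto (real w * real w / real u). ln (real (v * u)) / real (v * u))
      = (\<Sum>u=1..w. ln (real u) / real u * ln_power_sum 0 (real w * real w / real u)
                     + 1 / real u * ln_power_sum 1 (real w * real w / real u))"
      by (intro sum.cong refl comm)
    also have "(\<Sum>u=1..w. \<Sum>v\<in>pos_upto (real w * real w / real u). ln (real (u * v)) / real (u * v))
      = (\<Sum>u=1..w. ln (real u) / real u * ln_power_sum 0 (real w * real w / real u)
                     + 1 / real u * ln_power_sum 1 (real w * real w / real u))"
      by (intro sum.cong refl inner)
    finally show ?thesis by simp
  qed
  also have "(\<Sum>u=1..w. ln (real u) / real u * ln_power_sum 0 (real w * real w / real u)
                     + 1 / real u * ln_power_sum 1 (real w * real w / real u))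
     = (\<Sum>u=1..w. stieltjes 0 * (ln (real u) / real u) - 1 / 2 * (ln (real u) ^ 2 / real u)
          + (2 * l ^ 2 + stieltjes 1) * (1 / real u)
          + ln (real u) ^ 1 / real u * ln_power_sum_err 0 (real w * real w / real u)
          + ln (real u) ^ 0 / real u * ln_power_sum_err 1 (real w * real w / real u))"
    by (intro sum.cong refl, subst (1 2) inner_ln_power_sum_eq)
       (auto simp: l_def add_divide_distrib diff_divide_distrib algebra_simps power2_eq_square)
  also have "\<dots> = stieltjes 0 * L - 1 / 2 * Q + (2 * l ^ 2 + stieltjes 1) * H + hyperbola_err 1 0 w + hyperbola_err 0 1 w"
    unfolding sum.distrib sum_subtractf sum_distrib_left[symmetric] hyperbola_err_def H_sum L_sum Q_sum ..
  also have "(\<Sum>u=1..w. ln (real u) / real u * H + 1 / real u * L) = 2 * L * H"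
    unfolding sum.distrib sum_distrib_right[symmetric] H_sum[symmetric] L_sum[symmetric] by simp
  also have "H = l + stieltjes 0 + a" by (simp add: H_def ln_power_sum_eq l_def a_def)
  also have "L = l ^ 2 / 2 + stieltjes 1 + b" by (simp add: L_def ln_power_sum_eq l_def b_def power2_eq_square)
  also have "Q = l ^ 3 / 3 + stieltjes 2 + c" by (simp add: Q_def ln_power_sum_eq l_def c_def power3_eq_cube power2_eq_square)
  finally show ?thesis by (simp add: algebra_simps power2_eq_square power3_eq_cube)
qed

lemma d2_div_sum_LIMSEQ:
  "(\<lambda>w. d2_div_sum (real w * real w)
      - ((2 * ln (real w)) ^ 2 / 2 + 2 * stieltjes 0 * (2 * ln (real w)))) \<longlonglongrightarrow> stieltjes 0 ^ 2 - 2 * stieltjes 1"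
proof -
  \<comment> \<open>The powers \<open>^ 0\<close> and \<open>^ 1\<close> only bring the terms into
    the form of \<open>ln_power_mult_err_LIMSEQ\<close>.\<close>
  have "(\<lambda>w. (stieltjes 0 ^ 2 - 2 * stieltjes 1) + (2 * (ln (real w) ^ 1 * ln_power_sum_err 0 (real w))
       - 2 * (ln (real w) ^ 0 * ln_power_sum_err 1 (real w)) - (ln (real w) ^ 0 * ln_power_sum_err 0 (real w)) ^ 2
       + 2 * hyperbola_err 0 0 w)) \<longlonglongrightarrow> (stieltjes 0 ^ 2 - 2 * stieltjes 1) + (2 * 0 - 2 * 0 - 0 ^ 2 + 2 * 0)"
    by (intro tendsto_intros ln_power_mult_err_LIMSEQ hyperbola_err_LIMSEQ) auto
  moreover have "eventually (\<lambda>w. (stieltjes 0 ^ 2 - 2 * stieltjes 1) + (2 * (ln (real w) ^ 1 * ln_power_sum_err 0 (real w))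
       - 2 * (ln (real w) ^ 0 * ln_power_sum_err 1 (real w)) - (ln (real w) ^ 0 * ln_power_sum_err 0 (real w)) ^ 2
       + 2 * hyperbola_err 0 0 w)
     = d2_div_sum (real w * real w) - ((2 * ln (real w)) ^ 2 / 2 + 2 * stieltjes 0 * (2 * ln (real w)))) sequentially"
    using eventually_ge_at_top[of 1] by eventually_elim (simp add: d2_div_sum_square_eq)
  ultimately show ?thesis by (subst (asm) tendsto_cong) simp_all
qed

lemma d2_ln_div_sum_LIMSEQ:
  "(\<lambda>w. d2_ln_div_sum (real w * real w)
      - ((2 * ln (real w)) ^ 3 / 3 + stieltjes 0 * (2 * ln (real w)) ^ 2))
     \<longlonglongrightarrow> 2 * stieltjes 0 * stieltjes 1 - stieltjes 2"
proof -
  define R where "R = (\<lambda>w. (2 * stieltjes 0 * stieltjes 1 - stieltjes 2)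
       + (3 * (ln (real w) ^ 2 * ln_power_sum_err 0 (real w)) - ln (real w) ^ 0 * ln_power_sum_err 2 (real w)
          - 2 * (ln (real w) ^ 1 * ln_power_sum_err 1 (real w))
          - 2 * ((ln (real w) ^ 0 * ln_power_sum_err 0 (real w)) * (ln (real w) ^ 0 * ln_power_sum_err 1 (real w)))
          + 2 * hyperbola_err 1 0 w + 2 * hyperbola_err 0 1 w))"
  have "R \<longlonglongrightarrow> (2 * stieltjes 0 * stieltjes 1 - stieltjes 2) + (3 * 0 - 0 - 2 * 0 - 2 * (0 * 0) + 2 * 0 + 2 * 0)"
    unfolding R_def by (intro tendsto_intros ln_power_mult_err_LIMSEQ hyperbola_err_LIMSEQ) auto
  moreover have "eventually (\<lambda>w. R w
     = d2_ln_div_sum (real w * real w) - ((2 * ln (real w)) ^ 3 / 3 + stieltjes 0 * (2 * ln (real w)) ^ 2)) sequentially"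
    using eventually_ge_at_top[of 1] by eventually_elim (simp add: R_def d2_ln_div_sum_square_eq)
  ultimately show ?thesis by (subst (asm) tendsto_cong) simp_all
qed

section \<open>The error term for large arguments\<close>

definition D4_main :: "real \<Rightarrow> real" where
  "D4_main x = (let \<gamma> = euler_mascheroni; \<gamma>\<^sub>1 = stieltjes 1; \<gamma>\<^sub>2 = stieltjes 2 in
     1 / 6 * x * ln x ^ 3 + (2 * \<gamma> - 1 / 2) * x * ln x ^ 2 + (6 * \<gamma>^2 - 4 * \<gamma> - 4 * \<gamma>\<^sub>1 + 1) * x * ln x
     + (4 * \<gamma>^3 - 6 * \<gamma>^2 + 4 * \<gamma> - 12 * \<gamma> * \<gamma>\<^sub>1 + 4 * \<gamma>\<^sub>1 + 2 * \<gamma>\<^sub>2 - 1) * x)"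

lemma DERIV_D2_main:
  "t > 0 \<Longrightarrow> (D2_main has_real_derivative ln t + 2 * euler_mascheroni) (at t)"
  unfolding D2_main_def by (auto intro!: derivative_eq_intros)

lemma DERIV_inverse_sqrt:
  "t > 0 \<Longrightarrow> ((\<lambda>t. 1 / sqrt t) has_real_derivative - (1 / (2 * (t * sqrt t)))) (at t)"
  by (auto intro!: derivative_eq_intros simp: field_simps)

lemma filterlim_square_at_top: "filterlim (\<lambda>w. real w * real w) at_top sequentially"
  by real_asymp

text \<open>This weight arises when the errors \<open>1.1 * sqrt (x / u)\<close> are summed against
  \<open>d2 u\<close>. The integral of the error gives \<open>0.55 * ln y\<close>; the constant is
  \<open>R 1 = 3 - 2 * euler_mascheroni\<close> plus 1.1 from the boundary term.\<close>

lemma d2_sqrt_sum_le: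
  assumes y: "y \<ge> 1"
  shows "summatory (\<lambda>n. real (d2 n) * (1 / sqrt (real n))) y
    \<le> sqrt y * (2 * ln y + 4 * euler_mascheroni - 4) + (4.1 - 2 * euler_mascheroni) + 0.55 * ln y"
proof -
  define f :: "real \<Rightarrow> real" where "f = (\<lambda>t. 1 / sqrt t)"
  define F where "F = (\<lambda>t. sqrt t * (2 * ln t + 4 * euler_mascheroni - 4))"
  define R where "R = abel_rest (\<lambda>n. real (d2 n)) f F D2_main"
  have "\<bar>R y - R 1\<bar> \<le> 0.55 * ln y - 0.55 * ln 1"
    unfolding R_def
  proof (rule abel_rest_diff_le[OF y])
    fix t assume "1 \<le> t" "t \<le> y"
    hence t: "t \<ge> 1" by simp
    show "(f has_real_derivative - (1 / (2 * (t * sqrt t)))) (at t)"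
      unfolding f_def by (rule DERIV_inverse_sqrt) (use t in auto)
    show "(D2_main has_real_derivative ln t + 2 * euler_mascheroni) (at t)"
      by (rule DERIV_D2_main) (use t in auto)
    show "((\<lambda>t. 0.55 * ln t) has_real_derivative 0.55 / t) (at t)"
      using t by (auto intro!: derivative_eq_intros)
    have "(sqrt has_real_derivative 1 / (2 * sqrt t)) (at t)"
      by (rule DERIV_cong[OF DERIV_real_sqrt]) (use t in \<open>simp_all add: inverse_eq_divide\<close>)
    moreover have "((\<lambda>t. 2 * ln t + 4 * euler_mascheroni - 4) has_real_derivative 2 * (1 / t)) (at t)"
      using t by (auto intro!: derivative_eq_intros)
    ultimately have "(F has_real_derivative (1 / (2 * sqrt t)) * (2 * ln t + 4 * euler_mascheroni - 4) + 2 * (1 / t) * sqrt t) (at t)"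
      unfolding F_def by (rule DERIV_mult)
    also have "(1 / (2 * sqrt t)) * (2 * ln t + 4 * euler_mascheroni - 4) + 2 * (1 / t) * sqrt t
        = f t * (ln t + 2 * euler_mascheroni)"
    proof -
      have "1 / t * sqrt t = 1 / sqrt t" using t by (simp add: field_simps)
      thus ?thesis by (simp add: f_def add_divide_distrib diff_divide_distrib)
    qed
    finally show "(F has_real_derivative f t * (ln t + 2 * euler_mascheroni)) (at t)" .
    have "\<bar>- (1 / (2 * (t * sqrt t)))\<bar> * \<bar>summatory (\<lambda>n. real (d2 n)) t - D2_main t\<bar>
        \<le> 1 / (2 * (t * sqrt t)) * (1.1 * sqrt t)"
      using D2_error_bound[OF t] t by (intro mult_mono) (auto simp: D2_def)
    also have "\<dots> = 0.55 / t" using t by (simp add: field_simps)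
    finally show "\<bar>- (1 / (2 * (t * sqrt t)))\<bar> * \<bar>summatory (\<lambda>n. real (d2 n)) t - D2_main t\<bar> \<le> 0.55 / t" .
  qed
  hence "\<bar>R y - R 1\<bar> \<le> 0.55 * ln y" by simp
  hence "R y \<le> R 1 + 0.55 * ln y" by linarith
  moreover have "R 1 = 3 - 2 * euler_mascheroni"
  proof -
    have "divisor_pairs 1 = {(1, 1)}" by (auto simp: divisor_pairs_def)
    hence "d2 1 = 1" by (simp add: d2_def)
    moreover have "pos_upto 1 = {1}" using pos_upto_of_nat[of 1] by simp
    ultimately show ?thesis by (simp add: R_def abel_rest_def summatory_def f_def F_def D2_main_def)
  qed
  moreover have "f y * (D2 y - D2_main y) \<le> 1.1"
  proof -
    have "D2 y - D2_main y \<le> 1.1 * sqrt y" using D2_error_bound[OF y] by linarith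
    hence "f y * (D2 y - D2_main y) \<le> f y * (1.1 * sqrt y)"
      using y by (intro mult_left_mono) (auto simp: f_def)
    thus ?thesis using y by (simp add: f_def)
  qed
  moreover have "summatory (\<lambda>n. real (d2 n) * (1 / sqrt (real n))) y = R y + F y + f y * (D2 y - D2_main y)"
    by (simp add: R_def abel_rest_def f_def D2_def)
  ultimately show ?thesis unfolding F_def by linarith
qed

text \<open>The constant is \<open>(X + 2 * \<gamma> - 1) * s0 - s1\<close>, where \<open>s0\<close> and \<open>s1\<close> are the constant terms in the
  expansions of the partial sums of \<open>d2 n / n\<close> and \<open>d2 n * ln n / n\<close>. The integrand changes sign at
  \<open>exp (X + 2 * \<gamma>)\<close>, so the tail is estimated separately on both sides.\<close>

lemma weighted_d2_sum_tail:
  fixes X y :: real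
  defines "g \<equiv> euler_mascheroni :: real"
  defines "f \<equiv> \<lambda>t. (X - ln t + 2 * g - 1) / t"
    and "F \<equiv> \<lambda>t. (X + 2 * g - 1) * (ln t ^ 2 / 2 + 2 * g * ln t) - ln t ^ 3 / 3 - g * ln t ^ 2"
    and "K \<equiv> (X + 2 * g - 1) * (g ^ 2 - 2 * stieltjes 1) - (2 * g * stieltjes 1 - stieltjes 2)"
  assumes y: "1 \<le> y" "ln y \<le> X + 2 * g"
  shows "\<bar>K - abel_rest (\<lambda>n. real (d2 n)) f F D2_main y\<bar>
     \<le> 1.1 * ((2 * (X + 2 * g - ln y) - 4) / sqrt y + 8 / sqrt (exp (X + 2 * g)))"
proof -
  define R where "R = abel_rest (\<lambda>n. real (d2 n)) f F D2_main"
  \<comment> \<open>An antiderivative of the error bound without absolute value: valid as a majorant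
    up to \<open>z\<close>, where \<open>X + 2 * g - ln t\<close> changes sign, and with the
    opposite sign beyond.\<close>
  define G where "G = (\<lambda>t. 1.1 * ((4 - 2 * (X + 2 * g - ln t)) * (1 / sqrt t)))"
  define z where "z = exp (X + 2 * g)"
  have yz: "y \<le> z" using y unfolding z_def by (simp add: ln_le_cancel_iff[symmetric] ln_ge_iff)
  have der: "(f has_real_derivative - ((X + 2 * g - ln t) / t ^ 2)) (at t)"
    "(D2_main has_real_derivative ln t + 2 * g) (at t)"
    "(F has_real_derivative f t * (ln t + 2 * g)) (at t)"
    "(G has_real_derivative 1.1 * ((X + 2 * g - ln t) / (t * sqrt t))) (at t)"
    if t: "t > 0" for t
  proof -
    show "(f has_real_derivative - ((X + 2 * g - ln t) / t ^ 2)) (at t)"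
      unfolding f_def using t by (auto intro!: derivative_eq_intros simp: field_simps power2_eq_square)
    show "(D2_main has_real_derivative ln t + 2 * g) (at t)"
      unfolding g_def by (rule DERIV_D2_main[OF t])
    have "(F has_real_derivative (X + 2 * g - 1) * (ln t * (1 / t) + 2 * g * (1 / t)) - ln t ^ 2 * (1 / t) - g * (2 * ln t * (1 / t))) (at t)"
      unfolding F_def using t by (auto intro!: derivative_eq_intros simp: field_simps)
    thus "(F has_real_derivative f t * (ln t + 2 * g)) (at t)"
      by (rule DERIV_cong) (use t in \<open>simp add: f_def field_simps power2_eq_square\<close>)
    have "(G has_real_derivative 1.1 * ((2 * (1 / t)) * (1 / sqrt t)
        + - (1 / (2 * (t * sqrt t))) * (4 - 2 * (X + 2 * g - ln t)))) (at t)"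
      unfolding G_def
      by (intro DERIV_cmult DERIV_mult DERIV_inverse_sqrt t) (use t in \<open>auto intro!: derivative_eq_intros\<close>)
    thus "(G has_real_derivative 1.1 * ((X + 2 * g - ln t) / (t * sqrt t))) (at t)"
      by (rule DERIV_cong) (use t in \<open>simp add: field_simps\<close>)
  qed
  have err: "\<bar>- ((X + 2 * g - ln t) / t ^ 2)\<bar> * \<bar>summatory (\<lambda>n. real (d2 n)) t - D2_main t\<bar>
      \<le> 1.1 * (\<bar>X + 2 * g - ln t\<bar> / (t * sqrt t))" if t: "t \<ge> 1" for t
  proof -
    have "\<bar>- ((X + 2 * g - ln t) / t ^ 2)\<bar> * \<bar>summatory (\<lambda>n. real (d2 n)) t - D2_main t\<bar>
        \<le> \<bar>X + 2 * g - ln t\<bar> / t ^ 2 * (1.1 * sqrt t)"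
      using D2_error_bound[OF t] t by (intro mult_mono) (auto simp: D2_def)
    also have "\<dots> = 1.1 * (\<bar>X + 2 * g - ln t\<bar> / (t * sqrt t))"
    proof -
      define s where "s = sqrt t"
      have "t ^ 2 = t * (s * s)" "s \<noteq> 0" using t by (auto simp: s_def power2_eq_square)
      thus ?thesis unfolding s_def[symmetric] by simp
    qed
    finally show ?thesis .
  qed
  have 1: "\<bar>R z - R y\<bar> \<le> G z - G y" unfolding R_def
  proof (rule abel_rest_diff_le[OF yz der(1,2,3,4)])
    fix t assume t: "y \<le> t" "t \<le> z"
    have "ln t \<le> ln z" using t y by simp
    hence "\<bar>X + 2 * g - ln t\<bar> = X + 2 * g - ln t" by (simp add: z_def)
    thus "\<bar>- ((X + 2 * g - ln t) / t ^ 2)\<bar> * \<bar>summatory (\<lambda>n. real (d2 n)) t - D2_main t\<bar>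
      \<le> 1.1 * ((X + 2 * g - ln t) / (t * sqrt t))"
      using err[of t] t y by simp
  qed (use y in auto)
  have 2: "\<bar>R v - R z\<bar> \<le> - G v - - G z" if zv: "z \<le> v" for v unfolding R_def
  proof (rule abel_rest_diff_le[OF zv der(1,2,3) DERIV_minus[OF der(4)]])
    fix t assume t: "z \<le> t" "t \<le> v"
    have t1: "t \<ge> 1" using t yz y by linarith
    have "z > 0" by (simp add: z_def)
    hence "ln z \<le> ln t" using t by simp
    hence "\<bar>X + 2 * g - ln t\<bar> = - (X + 2 * g - ln t)" by (simp add: z_def)
    thus "\<bar>- ((X + 2 * g - ln t) / t ^ 2)\<bar> * \<bar>summatory (\<lambda>n. real (d2 n)) t - D2_main t\<bar>
      \<le> - (1.1 * ((X + 2 * g - ln t) / (t * sqrt t)))"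
      using err[OF t1] by (simp add: minus_divide_left)
  qed (use y yz in auto)
  have R_lim: "(\<lambda>w. R (real w * real w)) \<longlonglongrightarrow> K"
  proof -
    have sum_eq: "summatory (\<lambda>n. real (d2 n) * f (real n)) t = (X + 2 * g - 1) * d2_div_sum t - d2_ln_div_sum t" for t
      unfolding summatory_def d2_div_sum_def d2_ln_div_sum_def sum_distrib_left sum_subtractf[symmetric]
      by (intro sum.cong) (auto simp: f_def algebra_simps add_divide_distrib diff_divide_distrib)
    have "(\<lambda>w. f (real w * real w) * (D2 (real w * real w) - D2_main (real w * real w))) \<longlonglongrightarrow> 0"
    proof (rule Lim_null_comparison)
      show "eventually (\<lambda>w. norm (f (real w * real w) * (D2 (real w * real w) - D2_main (real w * real w)))
         \<le> \<bar>f (real w * real w)\<bar> * (1.1 * real w)) sequentially"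
        using eventually_ge_at_top[of 1]
      proof eventually_elim
        case (elim w)
        have "1 \<le> real w * real w" using elim mult_mono[of 1 "real w" 1 "real w"] by simp
        from D2_error_bound[OF this] have "\<bar>D2 (real w * real w) - D2_main (real w * real w)\<bar> \<le> 1.1 * real w"
          by (simp add: real_sqrt_mult)
        thus ?case unfolding real_norm_def abs_mult by (rule mult_left_mono) auto
      qed
      show "(\<lambda>w. \<bar>f (real w * real w)\<bar> * (1.1 * real w)) \<longlonglongrightarrow> 0"
        unfolding f_def by real_asymp
    qed
    note lim0 = this
    have "(\<lambda>w. (X + 2 * g - 1) * (d2_div_sum (real w * real w)
        - ((2 * ln (real w)) ^ 2 / 2 + 2 * stieltjes 0 * (2 * ln (real w))))
       - (d2_ln_div_sum (real w * real w) - ((2 * ln (real w)) ^ 3 / 3 + stieltjes 0 * (2 * ln (real w)) ^ 2)))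
      \<longlonglongrightarrow> (X + 2 * g - 1) * (stieltjes 0 ^ 2 - 2 * stieltjes 1) - (2 * stieltjes 0 * stieltjes 1 - stieltjes 2)"
      by (intro tendsto_intros d2_div_sum_LIMSEQ d2_ln_div_sum_LIMSEQ)
    from tendsto_diff[OF this lim0] have "(\<lambda>w. ((X + 2 * g - 1) * (d2_div_sum (real w * real w)
        - ((2 * ln (real w)) ^ 2 / 2 + 2 * stieltjes 0 * (2 * ln (real w))))
       - (d2_ln_div_sum (real w * real w) - ((2 * ln (real w)) ^ 3 / 3 + stieltjes 0 * (2 * ln (real w)) ^ 2)))
       - f (real w * real w) * (D2 (real w * real w) - D2_main (real w * real w)))
      \<longlonglongrightarrow> ((X + 2 * g - 1) * (stieltjes 0 ^ 2 - 2 * stieltjes 1) - (2 * stieltjes 0 * stieltjes 1 - stieltjes 2)) - 0" .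
    moreover have "eventually (\<lambda>w. ((X + 2 * g - 1) * (d2_div_sum (real w * real w)
        - ((2 * ln (real w)) ^ 2 / 2 + 2 * stieltjes 0 * (2 * ln (real w))))
       - (d2_ln_div_sum (real w * real w) - ((2 * ln (real w)) ^ 3 / 3 + stieltjes 0 * (2 * ln (real w)) ^ 2)))
       - f (real w * real w) * (D2 (real w * real w) - D2_main (real w * real w)) = R (real w * real w)) sequentially"
      using eventually_ge_at_top[of 1]
    proof eventually_elim
      case (elim w)
      have "ln (real w * real w) = 2 * ln (real w)" using elim by (simp add: ln_mult_pos)
      thus ?case
        by (simp add: R_def abel_rest_def sum_eq F_def D2_def stieltjes_0 flip: g_def) (simp add: algebra_simps)
    qed
    ultimately show ?thesis by (subst (asm) tendsto_cong) (simp_all add: K_def stieltjes_0 g_def)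
  qed
  have G_lim: "(\<lambda>w. - G (real w * real w)) \<longlonglongrightarrow> 0"
    unfolding G_def by real_asymp
  \<comment> \<open>The part beyond \<open>z\<close> costs \<open>G z\<close>, the part before it
    \<open>G z - G y\<close>; together \<open>2 * G z - G y\<close>, whence the 8.\<close>
  have "\<bar>K - R z\<bar> \<le> 0 - - G z"
    by (rule increment_bound_LIMSEQ[OF 2 R_lim G_lim filterlim_square_at_top])
  moreover have "G z = 1.1 * (4 / sqrt z)" by (simp add: G_def z_def)
  moreover have "G y = - (1.1 * ((2 * (X + 2 * g - ln y) - 4) / sqrt y))"
    by (simp add: G_def diff_divide_distrib)
  moreover have "8 / sqrt z = 2 * (4 / sqrt z)" by simp
  ultimately have "\<bar>K - R y\<bar> \<le> 1.1 * ((2 * (X + 2 * g - ln y) - 4) / sqrt y + 8 / sqrt z)"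
    using 1 by argo
  thus ?thesis unfolding R_def z_def .
qed

text \<open>The cubic terms in \<open>q\<close> are 2.2 from the tail of the partial summation and
  2.2 from the errors of \<open>D2 (x / u)\<close>. The constant 20.34 rounds up 2.2 * 4.592 + 1.21
  + 2.2 * 4.1.\<close>

lemma D4_error_bound_explicit:
  assumes x: "x \<ge> 1"
  defines "q \<equiv> sqrt (sqrt x)"
  shows "\<bar>D4 x - D4_main x\<bar> \<le> 4.4 * q ^ 3 * (ln x + 4 * euler_mascheroni - 4)
      + q ^ 2 * (20.34 - 4.4 * euler_mascheroni + 0.605 * ln x)"
proof -
  define g :: real where "g = euler_mascheroni"
  define X where "X = ln x"
  define y where "y = sqrt x"
  define f where "f = (\<lambda>t. (X - ln t + 2 * g - 1) / t)"
  define F where "F = (\<lambda>t. (X + 2 * g - 1) * (ln t ^ 2 / 2 + 2 * g * ln t) - ln t ^ 3 / 3 - g * ln t ^ 2)"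
  define K where "K = (X + 2 * g - 1) * (g ^ 2 - 2 * stieltjes 1) - (2 * g * stieltjes 1 - stieltjes 2)"
  define R where "R = abel_rest (\<lambda>n. real (d2 n)) f F D2_main y"
  define E where "E = (\<lambda>t. D2 t - D2_main t)"
  have y: "y \<ge> 1" "x = y * y" using x by (auto simp: y_def)
  have q: "q > 0" "y = q * q" "sqrt y = q" using x by (simp_all add: q_def y_def)
  have X0: "X \<ge> 0" using x by (simp add: X_def)
  have lny: "ln y = X / 2" using x by (simp add: y_def X_def ln_sqrt)
  have g0: "g \<ge> 0.57721" "g \<le> 0.57722" using euler_mascheroni_bounds_5 by (auto simp: g_def)
  have main_n: "D2_main (x / real n) = x * f (real n)" if "n \<in> pos_upto y" for n
    using that x by (simp add: D2_main_def f_def X_def g_def pos_upto_iff ln_divide_pos field_simps)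
  have "D4 x = 2 * (\<Sum>u\<in>pos_upto y. real (d2 u) * D2 (x / real u)) - D2 y ^ 2"
    by (rule D4_hyperbola) (use y in auto)
  also have "(\<Sum>u\<in>pos_upto y. real (d2 u) * D2 (x / real u))
      = (\<Sum>u\<in>pos_upto y. x * (real (d2 u) * f (real u)) + real (d2 u) * E (x / real u))"
    by (intro sum.cong) (auto simp: E_def main_n[symmetric] algebra_simps)
  also have "\<dots> = x * summatory (\<lambda>n. real (d2 n) * f (real n)) y + (\<Sum>u\<in>pos_upto y. real (d2 u) * E (x / real u))"
    by (simp add: summatory_def sum.distrib sum_distrib_left)
  also have "summatory (\<lambda>n. real (d2 n) * f (real n)) y = R + F y + f y * E y"
    by (simp add: R_def abel_rest_def E_def D2_def)
  also have "D2 y = D2_main y + E y" by (simp add: E_def)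
  also have "2 * (x * (R + F y + f y * E y) + (\<Sum>u\<in>pos_upto y. real (d2 u) * E (x / real u))) - (D2_main y + E y) ^ 2
     = (2 * x * (K + F y) - D2_main y ^ 2) + (2 * x * (R - K) - E y ^ 2 + 2 * (\<Sum>u\<in>pos_upto y. real (d2 u) * E (x / real u)))"
  proof -
    \<comment> \<open>This makes the boundary term \<open>2 * x * f y * E y\<close> equal to the
      cross term of \<open>(D2_main y + E y) ^ 2\<close>, so both disappear.\<close>
    have "x * f y = D2_main y"
      using y by (simp add: f_def D2_main_def lny g_def field_simps)
    thus ?thesis by (simp add: power2_eq_square algebra_simps)
  qed
  \<comment> \<open>The stated coefficients emerge here: all smooth contributions combine exactly to
    the cubic in \<open>ln x\<close>.\<close>
  also have "2 * x * (K + F y) - D2_main y ^ 2 = D4_main x"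
  proof -
    have "D2_main y ^ 2 = x * (X / 2 + 2 * g - 1) ^ 2"
      by (simp add: D2_main_def lny y(2) g_def power2_eq_square algebra_simps)
    thus ?thesis unfolding D4_main_def Let_def K_def F_def lny X_def[symmetric] g_def[symmetric]
      by (simp add: power2_eq_square power3_eq_cube field_simps)
  qed
  finally have "\<bar>D4 x - D4_main x\<bar> = \<bar>2 * x * (R - K) - E y ^ 2 + 2 * (\<Sum>u\<in>pos_upto y. real (d2 u) * E (x / real u))\<bar>"
    by simp
  also have "\<dots> \<le> 2 * x * \<bar>K - R\<bar> + \<bar>E y\<bar> ^ 2 + 2 * \<bar>\<Sum>u\<in>pos_upto y. real (d2 u) * E (x / real u)\<bar>"
  proof -
    have eq: "\<bar>2 * x * (R - K)\<bar> = 2 * x * \<bar>K - R\<bar>" using x by (simp add: abs_mult abs_minus_commute)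
    have tri: "\<bar>a - b + 2 * s\<bar> \<le> \<bar>a\<bar> + b + 2 * \<bar>s\<bar>" if "b \<ge> 0" for a b s :: real
      using that by linarith
    show ?thesis unfolding power2_abs eq[symmetric] by (rule tri) simp
  qed
  also have "\<dots> \<le> 2 * x * (1.1 * ((X + 4 * g - 4) / q + 4.592 / y)) + 1.21 * y
      + 2 * (1.1 * y * (q * (X + 4 * g - 4) + (4.1 - 2 * g) + 0.275 * X))"
  proof (intro add_mono mult_left_mono)
    have "\<bar>K - R\<bar> \<le> 1.1 * ((2 * (X + 2 * g - ln y) - 4) / sqrt y + 8 / sqrt (exp (X + 2 * g)))"
      unfolding K_def R_def f_def F_def g_def
      by (rule weighted_d2_sum_tail) (use y X0 lny g0 in \<open>auto simp: g_def\<close>)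
    also have "2 * (X + 2 * g - ln y) - 4 = X + 4 * g - 4" by (simp add: lny)
    also have "8 / sqrt (exp (X + 2 * g)) \<le> 4.592 / y"
    proof -
      have "exp (X + 2 * g) = (y * exp g) ^ 2"
        using x by (simp add: exp_add X_def y power2_eq_square mult_exp_exp)
      hence "sqrt (exp (X + 2 * g)) = y * exp g" using y by (simp add: real_sqrt_mult)
      \<comment> \<open>Gives exp g >= 1.7437, and 8 / 1.7437 is below 4.592.\<close>
      moreover have "1 + g + g ^ 2 / 2 \<le> exp g" using g0 by (intro exp_lower_Taylor_quadratic) auto
      moreover have "0.57721 ^ 2 \<le> g ^ 2" using g0 by (intro power_mono) auto
      ultimately have "1.7437 * y \<le> sqrt (exp (X + 2 * g))" using g0 y by (simp add: power2_eq_square)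
      hence "8 / sqrt (exp (X + 2 * g)) \<le> 8 / (1.7437 * y)" using y by (intro divide_left_mono mult_pos_pos) auto
      also have "\<dots> \<le> 4.592 / y" using y by (simp add: field_simps)
      finally show ?thesis .
    qed
    finally show "\<bar>K - R\<bar> \<le> 1.1 * ((X + 4 * g - 4) / q + 4.592 / y)" unfolding q(3) by simp
    have "\<bar>E y\<bar> ^ 2 \<le> (1.1 * sqrt y) ^ 2"
      using D2_error_bound[OF y(1)] by (intro power_mono) (auto simp: E_def)
    thus "\<bar>E y\<bar> ^ 2 \<le> 1.21 * y" using y by (simp add: power_mult_distrib power2_eq_square)
    have "\<bar>\<Sum>u\<in>pos_upto y. real (d2 u) * E (x / real u)\<bar> \<le> (\<Sum>u\<in>pos_upto y. 1.1 * y * (real (d2 u) * (1 / sqrt (real u))))"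
    proof (intro order.trans[OF sum_abs] sum_mono)
      fix u assume u: "u \<in> pos_upto y"
      have "real u \<le> x" using u y mult_mono[of 1 y "real u" y] by (auto simp: pos_upto_iff)
      hence "x / real u \<ge> 1" using u by (auto simp: pos_upto_iff)
      hence "\<bar>E (x / real u)\<bar> \<le> 1.1 * sqrt (x / real u)" unfolding E_def by (rule D2_error_bound)
      hence "\<bar>real (d2 u) * E (x / real u)\<bar> \<le> real (d2 u) * (1.1 * sqrt (x / real u))"
        unfolding abs_mult by (intro mult_mono) auto
      thus "\<bar>real (d2 u) * E (x / real u)\<bar> \<le> 1.1 * y * (real (d2 u) * (1 / sqrt (real u)))"
        by (simp add: real_sqrt_divide y_def mult_ac)
    qed
    also have "\<dots> = 1.1 * y * summatory (\<lambda>n. real (d2 n) * (1 / sqrt (real n))) y"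
      by (simp add: summatory_def sum_distrib_left)
    also have "\<dots> \<le> 1.1 * y * (sqrt y * (2 * ln y + 4 * euler_mascheroni - 4) + (4.1 - 2 * euler_mascheroni) + 0.55 * ln y)"
      using y by (intro mult_left_mono d2_sqrt_sum_le) auto
    also have "\<dots> = 1.1 * y * (q * (X + 4 * g - 4) + (4.1 - 2 * g) + 0.275 * X)"
      unfolding lny q(3) g_def by simp
    finally show "\<bar>\<Sum>u\<in>pos_upto y. real (d2 u) * E (x / real u)\<bar>
        \<le> 1.1 * y * (q * (X + 4 * g - 4) + (4.1 - 2 * g) + 0.275 * X)" .
  qed (use x in auto)
  also have "\<dots> = 4.4 * q ^ 3 * (X + 4 * g - 4) + q ^ 2 * (20.3324 - 4.4 * g + 0.605 * X)"
    unfolding y(2) q(2) using q(1) by (simp add: field_simps power2_eq_square power3_eq_cube)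
  also have "\<dots> \<le> 4.4 * q ^ 3 * (X + 4 * g - 4) + q ^ 2 * (20.34 - 4.4 * g + 0.605 * X)"
    by (intro add_left_mono mult_left_mono) auto
  finally show ?thesis unfolding X_def g_def .
qed

text \<open>Since \<gamma> < 1, the cubic term has a surplus
  \<open>4.4 * q ^ 3 * (4 - 4 * g)\<close>, which exceeds the quadratic terms once
  \<open>q \<ge> 2.78\<close>; this is where 60 comes from.\<close>

lemma D4_error_bound_large:
  assumes x: "x \<ge> 60"
  shows "\<bar>D4 x - D4_main x\<bar> \<le> 4.4 * sqrt (sqrt x) ^ 3 * ln x"
proof -
  define q where "q = sqrt (sqrt x)"
  define g :: real where "g = euler_mascheroni"
  have g: "g \<ge> 0.57721" "g \<le> 0.57722" using euler_mascheroni_bounds_5 by (auto simp: g_def)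
  have q: "q \<ge> 2.78"
    unfolding q_def using x by (intro real_le_rsqrt) (simp add: power2_eq_square)
  \<comment> \<open>Tangent at 5/2; since \<open>ln (5 / 2) < 1\<close> it lies below the line
    \<open>0.4 * q\<close>.\<close>
  have "ln q = ln (5 / 2) + ln (q / (5 / 2))" using ln_mult_pos[of "5 / 2" "q / (5 / 2)"] q by simp
  also have "ln (q / (5 / 2)) \<le> q / (5 / 2) - 1" using q by (intro ln_le_minus_one) auto
  also have "ln (5 / 2 :: real) = ln 5 - ln 2" by (simp add: ln_div)
  finally have "ln q \<le> 0.4 * q" using ln_5_bounds ln_2_bounds by simp
  moreover have "ln x = 4 * ln q" using x by (simp add: q_def ln_sqrt)
  ultimately have X: "ln x \<le> 1.6 * q" by simp
  have "20.34 - 4.4 * g + 0.605 * ln x \<le> 7.44 * q" using X q g by simp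
  also have "\<dots> = 4.4 * q * (7.44 / 4.4)" by simp
  also have "\<dots> \<le> 4.4 * q * (4 - 4 * g)" using q g by (intro mult_left_mono) auto
  finally have "20.34 - 4.4 * g + 0.605 * ln x \<le> 4.4 * q * (4 - 4 * g)" .
  hence "q ^ 2 * (20.34 - 4.4 * g + 0.605 * ln x) \<le> q ^ 2 * (4.4 * q * (4 - 4 * g))"
    by (intro mult_left_mono) auto
  also have "\<dots> = 4.4 * q ^ 3 * (4 - 4 * g)" by (simp add: power2_eq_square power3_eq_cube)
  finally have "q ^ 2 * (20.34 - 4.4 * g + 0.605 * ln x) \<le> 4.4 * q ^ 3 * (4 - 4 * g)" .
  moreover have "\<bar>D4 x - D4_main x\<bar> \<le> 4.4 * q ^ 3 * (ln x + 4 * g - 4) + q ^ 2 * (20.34 - 4.4 * g + 0.605 * ln x)"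
    unfolding q_def g_def by (rule D4_error_bound_explicit) (use x in auto)
  moreover have "4.4 * q ^ 3 * (ln x + 4 * g - 4) = 4.4 * q ^ 3 * ln x - 4.4 * q ^ 3 * (4 - 4 * g)"
  proof -
    have "ln x + 4 * g - 4 = ln x - (4 - 4 * g)" by simp
    thus ?thesis unfolding right_diff_distrib[symmetric] by simp
  qed
  ultimately show ?thesis unfolding q_def[symmetric] by linarith
qed

section \<open>Bounded ranges\<close>

text \<open>Summing \<open>h u * h v\<close> over \<open>u * v \<le> m\<close> row by row, with \<open>A\<close> the summatory function of \<open>h\<close>: the row
  \<open>u\<close> contributes the pair \<open>(u, u)\<close> once and the pairs \<open>(u, v)\<close> with \<open>u < v\<close> twice. Truncated
  subtraction makes the terms with \<open>u * u > m\<close> vanish, so any \<open>R \<ge> sqrt m\<close> can serve as the range.\<close>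

definition hyperbola_eval :: "(nat \<Rightarrow> nat) \<Rightarrow> (nat \<Rightarrow> nat) \<Rightarrow> nat \<Rightarrow> nat \<Rightarrow> nat" where
  "hyperbola_eval h A R m = (\<Sum>u=1..R. h u * (2 * A (m div u) + h u - 2 * A u))"

lemma pos_upto_divide: "u > 0 \<Longrightarrow> pos_upto (real m / real u) = {1..m div u}"
  by (subst pos_upto_eq) (auto simp: floor_divide_of_nat_eq)

lemma hyperbola_eval_correct:
  fixes h A :: "nat \<Rightarrow> nat"
  assumes A: "\<And>m. A m = (\<Sum>k=1..m. h k)" and m: "m < (R + 1) ^ 2"
  shows "(\<Sum>(u, v)\<in>hyperbola_region (real m). real (h u) * real (h v)) = real (hyperbola_eval h A R m)"
proof -
  define r where "r = nat \<lfloor>sqrt (real m)\<rfloor>"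
  have "real r = real_of_int \<lfloor>sqrt (real m)\<rfloor>" by (simp add: r_def)
  hence r: "real r \<le> sqrt (real m)" "sqrt (real m) < real r + 1" by linarith+
  have "real r ^ 2 \<le> sqrt (real m) ^ 2" using r by (intro power_mono) auto
  hence r1: "r ^ 2 \<le> m" by (simp flip: of_nat_power)
  have "sqrt (real m) ^ 2 < (real r + 1) ^ 2" using r by (intro power_strict_mono) auto
  hence "real m < real ((r + 1) ^ 2)" by (simp add: add.commute)
  hence r2: "m < (r + 1) ^ 2" by (simp only: of_nat_less_iff)
  have "r ^ 2 < (R + 1) ^ 2" using r1 m by (rule le_less_trans)
  hence rR: "r \<le> R" using power_less_imp_less_base[of r 2 "R + 1"] by simp
  have mono: "A i \<le> A j" if "i \<le> j" for i j
    unfolding A using that by (intro sum_mono2) auto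
  have p: "pos_upto (sqrt (real m)) = {1..r}" using r by (intro pos_upto_eq_step) auto
  have "(\<Sum>(u, v)\<in>hyperbola_region (real m). real (h u) * real (h v)) =
      2 * (\<Sum>u=1..r. real (h u) * real (A (m div u))) - real (A r) * real (A r)"
    by (subst dirichlet_hyperbola[of "sqrt (real m)"])
       (auto simp: p A pos_upto_divide sum_product sum_distrib_left mult.commute)
  \<comment> \<open>Telescoping of squares:
    \<open>A u ^ 2 - A (u - 1) ^ 2 = h u * (2 * A u - h u)\<close>.\<close>
  also have "real (A r) * real (A r) = (\<Sum>u=1..r. real (h u) * (2 * real (A u) - real (h u)))"
  proof (induction r)
    case (Suc r)
    have "A (Suc r) = A r + h (Suc r)" by (simp add: A)
    with Suc show ?case by (simp add: algebra_simps)
  qed (simp add: A)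
  also have "2 * (\<Sum>u=1..r. real (h u) * real (A (m div u))) - (\<Sum>u=1..r. real (h u) * (2 * real (A u) - real (h u)))
     = (\<Sum>u=1..r. real (h u * (2 * A (m div u) + h u - 2 * A u)))"
    unfolding sum_distrib_left sum_subtractf[symmetric]
  proof (intro sum.cong refl)
    fix u assume u: "u \<in> {1..r}"
    have "u * u \<le> r ^ 2" using u by (simp add: power2_eq_square mult_mono)
    hence "u \<le> m div u" using u r1 by (simp add: less_eq_div_iff_mult_less_eq)
    hence "A u \<le> A (m div u)" by (rule mono)
    hence "real (2 * A (m div u) + h u - 2 * A u) = 2 * real (A (m div u)) + real (h u) - 2 * real (A u)"
      by (subst of_nat_diff) auto
    thus "2 * (real (h u) * real (A (m div u))) - real (h u) * (2 * real (A u) - real (h u))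
       = real (h u * (2 * A (m div u) + h u - 2 * A u))"
      unfolding of_nat_mult by (simp add: algebra_simps)
  qed
  also have "\<dots> = (\<Sum>u=1..R. real (h u * (2 * A (m div u) + h u - 2 * A u)))"
  proof (intro sum.mono_neutral_left ballI)
    fix u assume "u \<in> {1..R} - {1..r}"
    hence u: "r + 1 \<le> u" by auto
    have "(r + 1) ^ 2 \<le> u * u" unfolding power2_eq_square using u by (intro mult_mono) auto
    hence "m div u < u" using r2 by (simp add: less_mult_imp_div_less)
    hence "A (m div u) \<le> A (u - 1)" by (intro mono) simp
    moreover have "A u = A (u - 1) + h u" using u unfolding A by (cases u) auto
    ultimately show "real (h u * (2 * A (m div u) + h u - 2 * A u)) = 0" by simp
  qed (use rR in auto)
  finally show ?thesis by (simp add: hyperbola_eval_def)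
qed

definition D2_nat :: "nat \<Rightarrow> nat" where "D2_nat m = (\<Sum>k=1..m. d2 k)"

lemma D2_nat_eval: "m < (R + 1) ^ 2 \<Longrightarrow> D2_nat m = hyperbola_eval (\<lambda>_. 1) (\<lambda>k. k) R m"
proof -
  assume m: "m < (R + 1) ^ 2"
  have "real (D2_nat m) = (\<Sum>(u, v)\<in>hyperbola_region (real m). real 1 * real 1)"
    using sum_d2_mult[where g = "\<lambda>_. 1" and x = "real m"] by (simp add: D2_nat_def case_prod_unfold)
  also have "\<dots> = real (hyperbola_eval (\<lambda>_. 1) (\<lambda>k. k) R m)"
    by (rule hyperbola_eval_correct[OF _ m]) simp
  finally show ?thesis by (simp only: of_nat_eq_iff)
qed

lemma D4_nat_eval: "m < (R + 1) ^ 2 \<Longrightarrow> D4 (real m) = real (hyperbola_eval d2 D2_nat R m)"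
proof -
  assume m: "m < (R + 1) ^ 2"
  have "D4 (real m) = (\<Sum>(u, v)\<in>hyperbola_region (real m). real (d2 u) * real (d2 v))"
    using sum_hyperbola_region[of "\<lambda>u v. real (d2 u) * real (d2 v)" "real m"]
    by (simp add: D4_def summatory_def d4_eq_sum case_prod_unfold)
  also have "\<dots> = real (hyperbola_eval d2 D2_nat R m)"
    by (rule hyperbola_eval_correct[OF _ m]) (simp add: D2_nat_def)
  finally show ?thesis .
qed

text \<open>The range 20 serves all arguments below 21 ^ 2 = 441; the largest one evaluated is
  404.\<close>

lemma hyperbola_eval_20:
  "hyperbola_eval h A 20 m = (let f = (\<lambda>u. h u * (2 * A (m div u) + h u - 2 * A u)) in
     f 1 + f 2 + f 3 + f 4 + f 5 + f 6 + f 7 + f 8 + f 9 + f 10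
     + f 11 + f 12 + f 13 + f 14 + f 15 + f 16 + f 17 + f 18 + f 19 + f 20)"
proof -
  have "{1..20} = set [1..<21]" by auto
  also have "[1..<21] = [1, 2, 3, 4, 5, 6, 7, 8, 9, 10, 11, 12, 13, 14, 15, 16, 17, 18, 19, 20]"
    by (simp add: upt_rec)
  finally show ?thesis by (simp add: hyperbola_eval_def Let_def)
qed

lemma D2_nat_numeral:
  "(numeral k :: nat) < 441 \<Longrightarrow> D2_nat (numeral k) = hyperbola_eval (\<lambda>_. 1) (\<lambda>k. k) 20 (numeral k)"
  by (rule D2_nat_eval) simp

lemma D4_numeral:
  "(numeral k :: nat) < 441 \<Longrightarrow> D4 (numeral k) = real (hyperbola_eval d2 D2_nat 20 (numeral k))"
  using D4_nat_eval[of "numeral k" 20] by simp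

lemma D2_nat_small:
  "D2_nat 0 = 0" "D2_nat (Suc 0) = 1" "D2_nat 2 = 3" "D2_nat 3 = 5" "D2_nat 4 = 8" "D2_nat 5 = 10"
  "D2_nat 6 = 14" "D2_nat 7 = 16" "D2_nat 8 = 20" "D2_nat 9 = 23" "D2_nat 10 = 27" "D2_nat 11 = 29"
  "D2_nat 12 = 35" "D2_nat 13 = 37" "D2_nat 14 = 41" "D2_nat 15 = 45" "D2_nat 16 = 50" "D2_nat 17 = 52"
  "D2_nat 18 = 58" "D2_nat 19 = 60" "D2_nat 20 = 66"
  by (simp_all add: D2_nat_eval[of _ 20] D2_nat_numeral hyperbola_eval_20)

lemma d2_eq_diff: "n > 0 \<Longrightarrow> d2 n = D2_nat n - D2_nat (n - 1)"
  by (cases n) (auto simp: D2_nat_def)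

lemma d2_small:
  "d2 (Suc 0) = 1" "d2 2 = 2" "d2 3 = 2" "d2 4 = 3" "d2 5 = 2" "d2 6 = 4" "d2 7 = 2" "d2 8 = 4" "d2 9 = 3"
  "d2 10 = 4" "d2 11 = 2" "d2 12 = 6" "d2 13 = 2" "d2 14 = 4" "d2 15 = 4" "d2 16 = 5" "d2 17 = 2"
  "d2 18 = 6" "d2 19 = 2" "d2 20 = 6"
  by (simp_all add: d2_eq_diff D2_nat_small)

text \<open>Values at the ends of the blocks used below: both ends for the two-sided bound up to 60,
  the last integer only for the one-sided bound from 193 on.\<close>

lemma D4_values:
  "D4 2 = 5" "D4 3 = 9" "D4 4 = 19" "D4 5 = 23" "D4 6 = 39"
  "D4 7 = 43" "D4 8 = 63" "D4 10 = 89" "D4 11 = 93" "D4 13 = 137"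
  "D4 14 = 153" "D4 17 = 208" "D4 18 = 248" "D4 22 = 324" "D4 23 = 328"
  "D4 26 = 434" "D4 27 = 454" "D4 32 = 622" "D4 33 = 638" "D4 39 = 806"
  "D4 40 = 886" "D4 47 = 1058" "D4 48 = 1198" "D4 55 = 1404" "D4 56 = 1484"
  "D4 59 = 1520" "D4 194 = 9349" "D4 197 = 9517" "D4 199 = 9681" "D4 202 = 9913"
  "D4 206 = 10121" "D4 209 = 10317" "D4 215 = 10665" "D4 219 = 11113" "D4 223 = 11357"
  "D4 227 = 11701" "D4 233 = 12077" "D4 239 = 12377" "D4 245 = 13117" "D4 251 = 13377"
  "D4 259 = 14122" "D4 269 = 14802" "D4 279 = 15606" "D4 287 = 16182" "D4 299 = 17244"
  "D4 311 = 18256" "D4 324 = 19662" "D4 339 = 20822" "D4 359 = 22178" "D4 382 = 24468"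
  "D4 404 = 26594"
  by (simp_all add: D4_numeral hyperbola_eval_20 d2_small D2_nat_small D2_nat_numeral)

lemma D4_mono: "s \<le> t \<Longrightarrow> D4 s \<le> D4 t"
  unfolding D4_def summatory_def by (intro sum_mono2 pos_upto_mono) auto

lemma D4_le_D4_nat:
  assumes "x < real b + 1"
  shows "D4 x \<le> D4 (real b)"
proof -
  have "pos_upto x \<subseteq> pos_upto (real b)" using assms by (auto simp: pos_upto_def)
  thus ?thesis unfolding D4_def summatory_def by (intro sum_mono2) auto
qed

section \<open>Certified inequalities on blocks\<close>

lemma ln_smooth: "ln (2 ^ i * 3 ^ j * 5 ^ k * 7 ^ l :: real) = real i * ln 2 + real j * ln 3 + real k * ln 5 + real l * ln 7"
  by (simp add: ln_mult_pos ln_realpow)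

text \<open>A tangent at a nearby 7-smooth number reduces \<open>ln a\<close> to the logarithms of
  four primes; the loss is quadratic in the relative distance.\<close>

lemma ln_ge_smooth_approx:
  fixes a :: real
  assumes "0 < a"
  shows "real i * 0.69314718 + real j * 1.09861228 + real k * 1.6094379 + real l * 1.9459101
           + 1 - 2 ^ i * 3 ^ j * 5 ^ k * 7 ^ l / a \<le> ln a"
proof -
  define s :: real where "s = 2 ^ i * 3 ^ j * 5 ^ k * 7 ^ l"
  have s: "s > 0" by (simp add: s_def)
  have "ln (s / a) \<le> s / a - 1" using s assms by (intro ln_le_minus_one) auto
  moreover have "ln (s / a) = ln s - ln a" using s assms by (intro ln_divide_pos) auto
  moreover have "real i * 0.69314718 + real j * 1.09861228 + real k * 1.6094379 + real l * 1.9459101 \<le> ln s"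
    unfolding s_def ln_smooth using ln_small_bounds by (intro add_mono mult_left_mono) auto
  ultimately show ?thesis unfolding s_def by linarith
qed

lemma ln_le_smooth_approx:
  fixes a :: real
  assumes "0 < a"
  shows "ln a \<le> real i * 0.69314719 + real j * 1.0986123 + real k * 1.60943795 + real l * 1.9459102
           + a / (2 ^ i * 3 ^ j * 5 ^ k * 7 ^ l) - 1"
proof -
  define s :: real where "s = 2 ^ i * 3 ^ j * 5 ^ k * 7 ^ l"
  have s: "s > 0" by (simp add: s_def)
  have "ln (a / s) \<le> a / s - 1" using s assms by (intro ln_le_minus_one) auto
  moreover have "ln (a / s) = ln a - ln s" using s assms by (intro ln_divide_pos) auto
  moreover have "ln s \<le> real i * 0.69314719 + real j * 1.0986123 + real k * 1.60943795 + real l * 1.9459102"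
    unfolding s_def ln_smooth using ln_small_bounds by (intro add_mono mult_left_mono) auto
  ultimately show ?thesis unfolding s_def by linarith
qed

lemma D4_main_bounds:
  shows "0 \<le> a \<Longrightarrow> a \<le> x \<Longrightarrow> 0 \<le> L \<Longrightarrow> L \<le> ln x \<Longrightarrow>
      a * (L ^ 3 / 6 + 0.654 * L ^ 2 + 0.981 * L + 0.272) \<le> D4_main x"
    and "0 \<le> x \<Longrightarrow> x \<le> c \<Longrightarrow> 0 \<le> ln x \<Longrightarrow> ln x \<le> U \<Longrightarrow>
      D4_main x \<le> c * (U ^ 3 / 6 + 0.655 * U ^ 2 + 0.982 * U + 0.273)"
proof -
  define \<gamma> where "\<gamma> = (euler_mascheroni :: real)"
  define \<gamma>\<^sub>1 where "\<gamma>\<^sub>1 = stieltjes 1"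
  define \<gamma>\<^sub>2 where "\<gamma>\<^sub>2 = stieltjes 2"
  define c2 where "c2 = 2 * \<gamma> - 1 / 2"
  define c3 where "c3 = 6 * \<gamma>^2 - 4 * \<gamma> - 4 * \<gamma>\<^sub>1 + 1"
  define c4 where "c4 = 4 * \<gamma>^3 - 6 * \<gamma>^2 + 4 * \<gamma> - 12 * \<gamma> * \<gamma>\<^sub>1 + 4 * \<gamma>\<^sub>1 + 2 * \<gamma>\<^sub>2 - 1"
  have C: "0.654 \<le> c2" "c2 < 0.655" "0.981 \<le> c3" "c3 < 0.982" "0.272 \<le> c4" "c4 < 0.273"
    unfolding c2_def c3_def c4_def by (rule main_term_coefficient_bounds[OF \<gamma>_def \<gamma>\<^sub>1_def \<gamma>\<^sub>2_def])+
  have main: "D4_main x = x * (ln x ^ 3 / 6 + c2 * ln x ^ 2 + c3 * ln x + c4)"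
    unfolding D4_main_def Let_def \<gamma>_def[symmetric] \<gamma>\<^sub>1_def[symmetric] \<gamma>\<^sub>2_def[symmetric]
      c2_def[symmetric] c3_def[symmetric] c4_def[symmetric] by (simp add: algebra_simps)
  show "a * (L ^ 3 / 6 + 0.654 * L ^ 2 + 0.981 * L + 0.272) \<le> D4_main x"
    if "0 \<le> a" "a \<le> x" "0 \<le> L" "L \<le> ln x"
    unfolding main using that C
    by (intro mult_mono add_mono divide_right_mono power_mono add_nonneg_nonneg mult_nonneg_nonneg) auto
  show "D4_main x \<le> c * (U ^ 3 / 6 + 0.655 * U ^ 2 + 0.982 * U + 0.273)"
    if "0 \<le> x" "x \<le> c" "0 \<le> ln x" "ln x \<le> U"
    unfolding main using that C
    by (intro mult_mono add_mono divide_right_mono power_mono add_nonneg_nonneg mult_nonneg_nonneg) auto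
qed

lemma ball_atLeastLessThan_append [trans]:
  "\<forall>x\<in>{a..<b :: real}. P x \<Longrightarrow> \<forall>x\<in>{b..<c}. P x \<Longrightarrow> \<forall>x\<in>{a..<c}. P x"
  by force

lemma D4_le_on_block:
  assumes "0 < a" "c = real b + 1" "0 \<le> L"
    and "L \<le> real i * 0.69314718 + real j * 1.09861228 + real k * 1.6094379 + real l * 1.9459101
           + 1 - 2 ^ i * 3 ^ j * 5 ^ k * 7 ^ l / a"
    and "D4 (real b) \<le> 1 / 3 * a * L ^ 3"
  shows "\<forall>x\<in>{a..<c}. D4 x \<le> 1 / 3 * x * ln x ^ 3"
proof
  fix x assume x: "x \<in> {a..<c}"
  have "L \<le> ln a" using assms(4) ln_ge_smooth_approx[OF assms(1)] by (rule order.trans)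
  also have "\<dots> \<le> ln x" using x assms(1) by simp
  finally have L: "L \<le> ln x" .
  have "D4 x \<le> D4 (real b)" using x assms(2) by (intro D4_le_D4_nat) auto
  also have "\<dots> \<le> 1 / 3 * a * L ^ 3" by fact
  also have "\<dots> \<le> 1 / 3 * x * ln x ^ 3" using x L assms by (intro mult_mono power_mono) auto
  finally show "D4 x \<le> 1 / 3 * x * ln x ^ 3" .
qed

text \<open>On \<open>{a..<c}\<close> the step function lies between \<open>D4 a\<close> and
  \<open>D4 b\<close>, and the main term between its values at the two ends. \<open>L\<close> and
  \<open>U\<close> enclose \<open>ln\<close>, and \<open>Q\<close> is a lower bound for
  \<open>a powr (3 / 4)\<close>, certified by integral powers.\<close>

lemma D4_error_on_block:
  assumes "1 \<le> a" "c = real b + 1" "0 \<le> L" "0 < Q" "Q ^ 4 \<le> a ^ 3"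
    and "L \<le> real i * 0.69314718 + real j * 1.09861228 + real k * 1.6094379 + real l * 1.9459101
           + 1 - 2 ^ i * 3 ^ j * 5 ^ k * 7 ^ l / a"
    and "real i' * 0.69314719 + real j' * 1.0986123 + real k' * 1.60943795 + real l' * 1.9459102
           + c / (2 ^ i' * 3 ^ j' * 5 ^ k' * 7 ^ l') - 1 \<le> U"
    and "D4 (real b) \<le> a * (L ^ 3 / 6 + 0.654 * L ^ 2 + 0.981 * L + 0.272) + 4.48 * Q * L"
    and "c * (U ^ 3 / 6 + 0.655 * U ^ 2 + 0.982 * U + 0.273) \<le> D4 a + 4.48 * Q * L"
  shows "\<forall>x\<in>{a..<c}. \<bar>D4 x - D4_main x\<bar> \<le> 4.48 * x powr (3 / 4) * ln x"
proof
  fix x assume x: "x \<in> {a..<c}"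
  have "L \<le> ln a" by (rule order.trans[OF assms(6) ln_ge_smooth_approx]) (use assms in auto)
  also have "\<dots> \<le> ln x" using x assms(1) by simp
  finally have L: "L \<le> ln x" .
  have "ln x \<le> ln c" using x assms(1) by simp
  also have "\<dots> \<le> U" by (rule order.trans[OF ln_le_smooth_approx assms(7)]) (use assms in auto)
  finally have U: "ln x \<le> U" .
  have "Q ^ 4 = Q powr 4" "a ^ 3 = a powr 3" using assms(1,4) by (simp_all add: powr_numeral)
  hence Q4: "(Q ^ 4) powr (1 / 4) = Q" and a3: "(a ^ 3) powr (1 / 4) = a powr (3 / 4)"
    using assms(1,4) by (simp_all only: powr_powr) simp_all
  have "Q = (Q ^ 4) powr (1 / 4)" by (simp only: Q4)
  also have "\<dots> \<le> (a ^ 3) powr (1 / 4)" using assms(4,5) by (intro powr_mono2) auto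
  also have "\<dots> = a powr (3 / 4)" by (rule a3)
  also have "\<dots> \<le> x powr (3 / 4)" using x assms(1) by (intro powr_mono2) auto
  finally have Q: "Q \<le> x powr (3 / 4)" .
  have rhs: "4.48 * Q * L \<le> 4.48 * x powr (3 / 4) * ln x"
    using Q L assms by (intro mult_mono) auto
  have "D4 x \<le> D4 (real b)" using x assms(2) by (intro D4_le_D4_nat) auto
  moreover have "a * (L ^ 3 / 6 + 0.654 * L ^ 2 + 0.981 * L + 0.272) \<le> D4_main x"
    using x L assms by (intro D4_main_bounds) auto
  ultimately have 1: "D4 x - D4_main x \<le> 4.48 * x powr (3 / 4) * ln x"
    using assms(8) rhs by linarith
  have "D4 a \<le> D4 x" using x by (intro D4_mono) auto
  moreover have "D4_main x \<le> c * (U ^ 3 / 6 + 0.655 * U ^ 2 + 0.982 * U + 0.273)"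
    using x L U assms by (intro D4_main_bounds) auto
  ultimately have 2: "D4_main x - D4 x \<le> 4.48 * x powr (3 / 4) * ln x"
    using assms(9) rhs by linarith
  show "\<bar>D4 x - D4_main x\<bar> \<le> 4.48 * x powr (3 / 4) * ln x" using 1 2 by (intro abs_leI) auto
qed

text \<open>In each block the exponents name a 7-smooth number at or near the left end for
  \<open>L\<close>, and one at or near the right end for \<open>U\<close>.\<close>

lemma D4_error_small: "\<forall>x\<in>{2..<60}. \<bar>D4 x - D4_main x\<bar> \<le> 4.48 * x powr (3 / 4) * ln x"
proof -
  have "\<forall>x\<in>{2..<3}. \<bar>D4 x - D4_main x\<bar> \<le> 4.48 * x powr (3 / 4) * ln x"
    by (rule D4_error_on_block[where b = 2 and L = "0.693" and i = 1 and j = 0 and k = 0 and l = 0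
          and U = "1.099" and i' = 0 and j' = 1 and k' = 0 and l' = 0 and Q = "1.68"]) (simp_all add: D4_values power_divide)
  also have "\<forall>x\<in>{3..<4}. \<bar>D4 x - D4_main x\<bar> \<le> 4.48 * x powr (3 / 4) * ln x"
    by (rule D4_error_on_block[where b = 3 and L = "1.098" and i = 0 and j = 1 and k = 0 and l = 0
          and U = "1.387" and i' = 2 and j' = 0 and k' = 0 and l' = 0 and Q = "2.27"]) (simp_all add: D4_values power_divide)
  also have "\<forall>x\<in>{4..<6}. \<bar>D4 x - D4_main x\<bar> \<le> 4.48 * x powr (3 / 4) * ln x"
    by (rule D4_error_on_block[where b = 5 and L = "1.386" and i = 2 and j = 0 and k = 0 and l = 0
          and U = "1.792" and i' = 1 and j' = 1 and k' = 0 and l' = 0 and Q = "2.82"]) (simp_all add: D4_values power_divide)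
  also have "\<forall>x\<in>{6..<8}. \<bar>D4 x - D4_main x\<bar> \<le> 4.48 * x powr (3 / 4) * ln x"
    by (rule D4_error_on_block[where b = 7 and L = "1.791" and i = 1 and j = 1 and k = 0 and l = 0
          and U = "2.08" and i' = 3 and j' = 0 and k' = 0 and l' = 0 and Q = "3.83"]) (simp_all add: D4_values power_divide)
  also have "\<forall>x\<in>{8..<11}. \<bar>D4 x - D4_main x\<bar> \<le> 4.48 * x powr (3 / 4) * ln x"
    by (rule D4_error_on_block[where b = 10 and L = "2.079" and i = 3 and j = 0 and k = 0 and l = 0
          and U = "2.403" and i' = 1 and j' = 0 and k' = 1 and l' = 0 and Q = "4.75"]) (simp_all add: D4_values power_divide)
  also have "\<forall>x\<in>{11..<14}. \<bar>D4 x - D4_main x\<bar> \<le> 4.48 * x powr (3 / 4) * ln x"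
    by (rule D4_error_on_block[where b = 13 and L = "2.393" and i = 1 and j = 0 and k = 1 and l = 0
          and U = "2.64" and i' = 1 and j' = 0 and k' = 0 and l' = 1 and Q = "6.04"]) (simp_all add: D4_values power_divide)
  also have "\<forall>x\<in>{14..<18}. \<bar>D4 x - D4_main x\<bar> \<le> 4.48 * x powr (3 / 4) * ln x"
    by (rule D4_error_on_block[where b = 17 and L = "2.639" and i = 1 and j = 0 and k = 0 and l = 1
          and U = "2.891" and i' = 1 and j' = 2 and k' = 0 and l' = 0 and Q = "7.23"]) (simp_all add: D4_values power_divide)
  also have "\<forall>x\<in>{18..<23}. \<bar>D4 x - D4_main x\<bar> \<le> 4.48 * x powr (3 / 4) * ln x"
    by (rule D4_error_on_block[where b = 22 and L = "2.89" and i = 1 and j = 2 and k = 0 and l = 0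
          and U = "3.137" and i' = 3 and j' = 1 and k' = 0 and l' = 0 and Q = "8.73"]) (simp_all add: D4_values power_divide)
  also have "\<forall>x\<in>{23..<27}. \<bar>D4 x - D4_main x\<bar> \<le> 4.48 * x powr (3 / 4) * ln x"
    by (rule D4_error_on_block[where b = 26 and L = "3.134" and i = 3 and j = 1 and k = 0 and l = 0
          and U = "3.296" and i' = 0 and j' = 3 and k' = 0 and l' = 0 and Q = "10.5"]) (simp_all add: D4_values power_divide)
  also have "\<forall>x\<in>{27..<33}. \<bar>D4 x - D4_main x\<bar> \<le> 4.48 * x powr (3 / 4) * ln x"
    by (rule D4_error_on_block[where b = 32 and L = "3.295" and i = 0 and j = 3 and k = 0 and l = 0
          and U = "3.497" and i' = 5 and j' = 0 and k' = 0 and l' = 0 and Q = "11.84"]) (simp_all add: D4_values power_divide)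
  also have "\<forall>x\<in>{33..<40}. \<bar>D4 x - D4_main x\<bar> \<le> 4.48 * x powr (3 / 4) * ln x"
    by (rule D4_error_on_block[where b = 39 and L = "3.496" and i = 5 and j = 0 and k = 0 and l = 0
          and U = "3.689" and i' = 3 and j' = 0 and k' = 1 and l' = 0 and Q = "13.76"]) (simp_all add: D4_values power_divide)
  also have "\<forall>x\<in>{40..<48}. \<bar>D4 x - D4_main x\<bar> \<le> 4.48 * x powr (3 / 4) * ln x"
    by (rule D4_error_on_block[where b = 47 and L = "3.688" and i = 3 and j = 0 and k = 1 and l = 0
          and U = "3.872" and i' = 4 and j' = 1 and k' = 0 and l' = 0 and Q = "15.9"]) (simp_all add: D4_values power_divide)
  also have "\<forall>x\<in>{48..<56}. \<bar>D4 x - D4_main x\<bar> \<le> 4.48 * x powr (3 / 4) * ln x"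
    by (rule D4_error_on_block[where b = 55 and L = "3.871" and i = 4 and j = 1 and k = 0 and l = 0
          and U = "4.026" and i' = 3 and j' = 0 and k' = 0 and l' = 1 and Q = "18.23"]) (simp_all add: D4_values power_divide)
  also have "\<forall>x\<in>{56..<60}. \<bar>D4 x - D4_main x\<bar> \<le> 4.48 * x powr (3 / 4) * ln x"
    by (rule D4_error_on_block[where b = 59 and L = "4.025" and i = 3 and j = 0 and k = 0 and l = 1
          and U = "4.095" and i' = 2 and j' = 1 and k' = 1 and l' = 0 and Q = "20.47"]) (simp_all add: D4_values power_divide)
  finally show ?thesis .
qed

lemma D4_error_bound:
  assumes "x \<ge> 2"
  shows "\<bar>D4 x - D4_main x\<bar> \<le> 4.48 * x powr (3 / 4) * ln x"
proof (cases "x < 60")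
  case False
  have "sqrt (sqrt x) = x powr (1 / 4)" using assms by (simp add: powr_half_sqrt[symmetric] powr_powr)
  hence "sqrt (sqrt x) ^ 3 = x powr (3 / 4)" using assms by (simp add: powr_powr flip: powr_realpow)
  hence "\<bar>D4 x - D4_main x\<bar> \<le> 4.4 * x powr (3 / 4) * ln x"
    using D4_error_bound_large[of x] False by simp
  also have "\<dots> \<le> 4.48 * x powr (3 / 4) * ln x" using assms by (intro mult_right_mono) auto
  finally show ?thesis .
qed (use D4_error_small assms in auto)

text \<open>Little room is left at the start: on the first block 9349 is compared with about 9376,
  so the blocks begin very short and lengthen as the cubic term takes over.\<close>

lemma D4_le_medium: "\<forall>x\<in>{193..<405}. D4 x \<le> 1 / 3 * x * ln x ^ 3"
proof -
  have "\<forall>x\<in>{193..<195}. D4 x \<le> 1 / 3 * x * ln x ^ 3"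
    by (rule D4_le_on_block[where b = 194 and L = "5.2626" and i = 6 and j = 1 and k = 0 and l = 0]) (simp_all add: D4_values power_divide)
  also have "\<forall>x\<in>{195..<198}. D4 x \<le> 1 / 3 * x * ln x ^ 3"
    by (rule D4_le_on_block[where b = 197 and L = "5.2729" and i = 2 and j = 0 and k = 0 and l = 2]) (simp_all add: D4_values power_divide)
  also have "\<forall>x\<in>{198..<200}. D4 x \<le> 1 / 3 * x * ln x ^ 3"
    by (rule D4_le_on_block[where b = 199 and L = "5.2882" and i = 2 and j = 0 and k = 0 and l = 2]) (simp_all add: D4_values power_divide)
  also have "\<forall>x\<in>{200..<203}. D4 x \<le> 1 / 3 * x * ln x ^ 3"
    by (rule D4_le_on_block[where b = 202 and L = "5.2983" and i = 3 and j = 0 and k = 2 and l = 0]) (simp_all add: D4_values power_divide)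
  also have "\<forall>x\<in>{203..<207}. D4 x \<le> 1 / 3 * x * ln x ^ 3"
    by (rule D4_le_on_block[where b = 206 and L = "5.313" and i = 3 and j = 0 and k = 2 and l = 0]) (simp_all add: D4_values power_divide)
  also have "\<forall>x\<in>{207..<210}. D4 x \<le> 1 / 3 * x * ln x ^ 3"
    by (rule D4_le_on_block[where b = 209 and L = "5.3326" and i = 1 and j = 1 and k = 1 and l = 1]) (simp_all add: D4_values power_divide)
  also have "\<forall>x\<in>{210..<216}. D4 x \<le> 1 / 3 * x * ln x ^ 3"
    by (rule D4_le_on_block[where b = 215 and L = "5.3471" and i = 1 and j = 1 and k = 1 and l = 1]) (simp_all add: D4_values power_divide)
  also have "\<forall>x\<in>{216..<220}. D4 x \<le> 1 / 3 * x * ln x ^ 3"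
    by (rule D4_le_on_block[where b = 219 and L = "5.3752" and i = 3 and j = 3 and k = 0 and l = 0]) (simp_all add: D4_values power_divide)
  also have "\<forall>x\<in>{220..<224}. D4 x \<le> 1 / 3 * x * ln x ^ 3"
    by (rule D4_le_on_block[where b = 223 and L = "5.3934" and i = 3 and j = 3 and k = 0 and l = 0]) (simp_all add: D4_values power_divide)
  also have "\<forall>x\<in>{224..<228}. D4 x \<le> 1 / 3 * x * ln x ^ 3"
    by (rule D4_le_on_block[where b = 227 and L = "5.4116" and i = 5 and j = 0 and k = 0 and l = 1]) (simp_all add: D4_values power_divide)
  also have "\<forall>x\<in>{228..<234}. D4 x \<le> 1 / 3 * x * ln x ^ 3"
    by (rule D4_le_on_block[where b = 233 and L = "5.4292" and i = 0 and j = 2 and k = 2 and l = 0]) (simp_all add: D4_values power_divide)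
  also have "\<forall>x\<in>{234..<240}. D4 x \<le> 1 / 3 * x * ln x ^ 3"
    by (rule D4_le_on_block[where b = 239 and L = "5.4549" and i = 4 and j = 1 and k = 1 and l = 0]) (simp_all add: D4_values power_divide)
  also have "\<forall>x\<in>{240..<246}. D4 x \<le> 1 / 3 * x * ln x ^ 3"
    by (rule D4_le_on_block[where b = 245 and L = "5.4806" and i = 4 and j = 1 and k = 1 and l = 0]) (simp_all add: D4_values power_divide)
  also have "\<forall>x\<in>{246..<252}. D4 x \<le> 1 / 3 * x * ln x ^ 3"
    by (rule D4_le_on_block[where b = 251 and L = "5.5053" and i = 0 and j = 0 and k = 1 and l = 2]) (simp_all add: D4_values power_divide)
  also have "\<forall>x\<in>{252..<260}. D4 x \<le> 1 / 3 * x * ln x ^ 3"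
    by (rule D4_le_on_block[where b = 259 and L = "5.5294" and i = 2 and j = 2 and k = 0 and l = 1]) (simp_all add: D4_values power_divide)
  also have "\<forall>x\<in>{260..<270}. D4 x \<le> 1 / 3 * x * ln x ^ 3"
    by (rule D4_le_on_block[where b = 269 and L = "5.5605" and i = 8 and j = 0 and k = 0 and l = 0]) (simp_all add: D4_values power_divide)
  also have "\<forall>x\<in>{270..<280}. D4 x \<le> 1 / 3 * x * ln x ^ 3"
    by (rule D4_le_on_block[where b = 279 and L = "5.5984" and i = 1 and j = 3 and k = 1 and l = 0]) (simp_all add: D4_values power_divide)
  also have "\<forall>x\<in>{280..<288}. D4 x \<le> 1 / 3 * x * ln x ^ 3"
    by (rule D4_le_on_block[where b = 287 and L = "5.6347" and i = 3 and j = 0 and k = 1 and l = 1]) (simp_all add: D4_values power_divide)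
  also have "\<forall>x\<in>{288..<300}. D4 x \<le> 1 / 3 * x * ln x ^ 3"
    by (rule D4_le_on_block[where b = 299 and L = "5.6629" and i = 5 and j = 2 and k = 0 and l = 0]) (simp_all add: D4_values power_divide)
  also have "\<forall>x\<in>{300..<312}. D4 x \<le> 1 / 3 * x * ln x ^ 3"
    by (rule D4_le_on_block[where b = 311 and L = "5.7037" and i = 2 and j = 1 and k = 2 and l = 0]) (simp_all add: D4_values power_divide)
  also have "\<forall>x\<in>{312..<325}. D4 x \<le> 1 / 3 * x * ln x ^ 3"
    by (rule D4_le_on_block[where b = 324 and L = "5.7429" and i = 0 and j = 2 and k = 1 and l = 1]) (simp_all add: D4_values power_divide)
  also have "\<forall>x\<in>{325..<340}. D4 x \<le> 1 / 3 * x * ln x ^ 3"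
    by (rule D4_le_on_block[where b = 339 and L = "5.7838" and i = 2 and j = 4 and k = 0 and l = 0]) (simp_all add: D4_values power_divide)
  also have "\<forall>x\<in>{340..<360}. D4 x \<le> 1 / 3 * x * ln x ^ 3"
    by (rule D4_le_on_block[where b = 359 and L = "5.8289" and i = 0 and j = 0 and k = 0 and l = 3]) (simp_all add: D4_values power_divide)
  also have "\<forall>x\<in>{360..<383}. D4 x \<le> 1 / 3 * x * ln x ^ 3"
    by (rule D4_le_on_block[where b = 382 and L = "5.8861" and i = 3 and j = 2 and k = 1 and l = 0]) (simp_all add: D4_values power_divide)
  also have "\<forall>x\<in>{383..<405}. D4 x \<le> 1 / 3 * x * ln x ^ 3"
    by (rule D4_le_on_block[where b = 404 and L = "5.948" and i = 7 and j = 1 and k = 0 and l = 0]) (simp_all add: D4_values power_divide)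
  finally show ?thesis .
qed

text \<open>From 405 on, \<open>q \<ge> 4.48\<close> turns the error into at most
  \<open>0.983 * x * X\<close>, and \<open>X \<ge> 6\<close> lets the spare \<open>X ^ 3 / 6\<close>
  dominate all lower terms.\<close>

lemma D4_le_large:
  assumes "x \<ge> 405"
  shows "D4 x \<le> 1 / 3 * x * ln x ^ 3"
proof -
  define q where "q = sqrt (sqrt x)"
  define X where "X = ln x"
  \<comment> \<open>405 = 3 ^ 4 * 5 is itself 7-smooth, so the tangent correction is zero.\<close>
  have "6 \<le> real 0 * 0.69314718 + real 4 * 1.09861228 + real 1 * 1.6094379 + real 0 * 1.9459101
           + 1 - 2 ^ 0 * 3 ^ 4 * 5 ^ 1 * 7 ^ 0 / (405 :: real)" by simp
  also have "\<dots> \<le> ln 405" by (rule ln_ge_smooth_approx) simp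
  also have "\<dots> \<le> ln x" using assms by simp
  finally have X: "X \<ge> 6" by (simp add: X_def)
  have q: "q \<ge> 4.48"
    unfolding q_def using assms by (intro real_le_rsqrt) (simp add: power2_eq_square)
  have "sqrt x = q * q" "x = sqrt x * sqrt x" using assms by (simp_all add: q_def)
  hence xq: "x = q ^ 3 * q" by (simp only: power3_eq_cube mult.assoc)
  have "D4 x \<le> D4_main x + 4.4 * q ^ 3 * X"
    using D4_error_bound_large[of x] assms unfolding q_def X_def by linarith
  also have "D4_main x \<le> x * (X ^ 3 / 6 + 0.655 * X ^ 2 + 0.982 * X + 0.273)"
    using assms X by (intro D4_main_bounds) (auto simp: X_def)
  also have "4.4 * q ^ 3 * X \<le> x * (0.983 * X)"
  proof -
    have "4.4 * (q ^ 3 * X) \<le> (0.983 * q) * (q ^ 3 * X)"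
      using q X by (intro mult_right_mono) auto
    thus ?thesis by (simp add: xq mult_ac)
  qed
  also have "x * (X ^ 3 / 6 + 0.655 * X ^ 2 + 0.982 * X + 0.273) + x * (0.983 * X)
      = x * (X ^ 3 / 6 + 0.655 * X ^ 2 + 1.965 * X + 0.273)"
    by (simp add: algebra_simps)
  also have "\<dots> \<le> x * (X ^ 3 / 3)"
  proof (intro mult_left_mono)
    have "6 * X ^ 2 \<le> X * X ^ 2" "6 * X \<le> X * X" using X by (intro mult_right_mono; simp)+
    hence "6 * X ^ 2 \<le> X ^ 3" "6 * X \<le> X ^ 2" by (simp_all add: power2_eq_square power3_eq_cube)
    hence "X ^ 3 / 6 + 131 / 200 * X ^ 2 + 393 / 200 * X + 273 / 1000 \<le> X ^ 3 / 3"
      using X by argo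
    thus "X ^ 3 / 6 + 0.655 * X ^ 2 + 1.965 * X + 0.273 \<le> X ^ 3 / 3" by simp
  qed (use assms in auto)
  finally show ?thesis by (simp add: X_def)
qed

theorem theorem1:
  fixes \<gamma> \<gamma>\<^sub>1 \<gamma>\<^sub>2 C\<^sub>1 C\<^sub>2 C\<^sub>3 C\<^sub>4 :: real
  assumes "\<gamma> = euler_mascheroni" and "\<gamma>\<^sub>1 = stieltjes 1" and "\<gamma>\<^sub>2 = stieltjes 2"
    and "C\<^sub>1 = 1 / 6"
    and "C\<^sub>2 = 2 * \<gamma> - 1 / 2"
    and "C\<^sub>3 = 6 * \<gamma>^2 - 4 * \<gamma> - 4 * \<gamma>\<^sub>1 + 1"
    and "C\<^sub>4 = 4 * \<gamma>^3 - 6 * \<gamma>^2 + 4 * \<gamma> - 12 * \<gamma> * \<gamma>\<^sub>1 + 4 * \<gamma>\<^sub>1 + 2 * \<gamma>\<^sub>2 - 1"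
  shows "(\<forall>x::real. x \<ge> 2 \<longrightarrow>
           \<bar>(\<Sum>n | 1 \<le> n \<and> real n \<le> x. real (d4 n))
              - (C\<^sub>1 * x * ln x ^ 3 + C\<^sub>2 * x * ln x ^ 2 + C\<^sub>3 * x * ln x + C\<^sub>4 * x)\<bar>
             \<le> 4.48 * x powr (3 / 4) * ln x)
       \<and> (0.654 \<le> C\<^sub>2 \<and> C\<^sub>2 < 0.655) \<and> (0.981 \<le> C\<^sub>3 \<and> C\<^sub>3 < 0.982) \<and> (0.272 \<le> C\<^sub>4 \<and> C\<^sub>4 < 0.273)
       \<and> (\<forall>x::real. x \<ge> 193 \<longrightarrow>
           (\<Sum>n | 1 \<le> n \<and> real n \<le> x. real (d4 n)) \<le> 1 / 3 * x * ln x ^ 3)"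
proof (intro conjI allI impI)
  fix x :: real assume "x \<ge> 2"
  thus "\<bar>(\<Sum>n | 1 \<le> n \<and> real n \<le> x. real (d4 n))
          - (C\<^sub>1 * x * ln x ^ 3 + C\<^sub>2 * x * ln x ^ 2 + C\<^sub>3 * x * ln x + C\<^sub>4 * x)\<bar>
        \<le> 4.48 * x powr (3 / 4) * ln x"
    using D4_error_bound[of x]
    unfolding D4_def summatory_def pos_upto_def D4_main_def Let_def assms by simp
next
  fix x :: real assume "x \<ge> 193"
  hence "D4 x \<le> 1 / 3 * x * ln x ^ 3"
    using D4_le_medium D4_le_large[of x] by (cases "x < 405") auto
  thus "(\<Sum>n | 1 \<le> n \<and> real n \<le> x. real (d4 n)) \<le> 1 / 3 * x * ln x ^ 3"
    unfolding D4_def summatory_def pos_upto_def .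
qed (use main_term_coefficient_bounds[OF assms(1,2,3)] assms(4-) in simp_all)

end
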